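(* For all $\delta\in(0,1)$ there is a $(b,w)$-hidden-batch random order streaming algorithm such that, if at least a $\beta$ fraction of the vertices of the input graph $G$ (with $n$ vertices and $m$ edges) are in connected components of size at most $\ell$, it returns a vertex of $G$ together with the connected component containing it, with probability at least $1-\delta$ over its internal randomness and the order of the stream, using $(\ell/(\beta\delta))^{O(\ell)}\,(b+wm)\,\mathrm{polylog}(n)$ bits of space.
   Context: The $(b,w)$-hidden-batch random order stream model: an adversary partitions the edge set $E$ into batches of size at most $b$; each batch $B$ receives an independent uniform start time $\mathbf t_B\in[0,1]$; the adversary assigns each edge $e\in B$ a timestamp $\mathbf t_e\in[\mathbf t_B,\mathbf t_B+w]$; the pairs $(e,\mathbf t_e)$ are presented in non-decreasing order of $\mathbf t_e$ (ties broken adversarially), timestamps given to precision $\mathrm{poly}(1/n)$. The batches are not known to the algorithm. *)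

theory Defs
  imports "HOL-Probability.Probability"
begin

type_synonym edge = "nat set"

text \<open>A graph on \<open>n\<close> vertices has vertex set \<open>{..<n}\<close>; an edge is a two-element set of vertices.\<close>

definition simple_graph :: "nat \<Rightarrow> edge set \<Rightarrow> bool" where
  "simple_graph n E \<longleftrightarrow> E \<subseteq> {{u, v} |u v. u < n \<and> v < n \<and> u \<noteq> v}"

definition component_vertices :: "edge set \<Rightarrow> nat \<Rightarrow> nat set" where
  "component_vertices E v = {u. (v, u) \<in> {(x, y). {x, y} \<in> E}\<^sup>*}"

definition component :: "edge set \<Rightarrow> nat \<Rightarrow> nat set \<times> edge set" where
  "component E v =
     (component_vertices E v, {e \<in> E. e \<subseteq> component_vertices E v})"


text \<open>
  A stream element seen by an algorithm is an edge with a timestamp in units of the timestamp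
  precision. A randomised streaming algorithm keeps a bit string as its only memory between two
  stream elements: coins tossed in one step are lost unless they are recorded there.
\<close>

type_synonym token = "edge \<times> int"

record 'r streaming_algorithm =
  init :: "bool list pmf"
  step :: "bool list \<Rightarrow> token \<Rightarrow> bool list pmf"
  answer :: "bool list \<Rightarrow> 'r pmf"

definition memory_after :: "'r streaming_algorithm \<Rightarrow> token list \<Rightarrow> bool list pmf" where
  "memory_after A xs = foldl (\<lambda>p x. bind_pmf p (\<lambda>s. step A s x)) (init A) xs"

definition run :: "'r streaming_algorithm \<Rightarrow> token list \<Rightarrow> 'r pmf" where
  "run A xs = bind_pmf (memory_after A xs) (answer A)"

text \<open>The space bound is worst case, over all token sequences and all coin tosses.\<close>

definition uses_space :: "'r streaming_algorithm \<Rightarrow> real \<Rightarrow> bool" where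
  "uses_space A S \<longleftrightarrow> (\<forall>xs. \<forall>s \<in> set_pmf (memory_after A xs). real (length s) \<le> S)"


definition start_times :: "edge set set \<Rightarrow> (edge set \<Rightarrow> real) measure" where
  "start_times P = (\<Pi>\<^sub>M B\<in>P. uniform_measure lborel {0..1})"

text \<open>Timestamps are rounded down to multiples of \<open>1 / n ^ c\<close>.\<close>

definition observed :: "nat \<Rightarrow> nat \<Rightarrow> (edge \<times> real) list \<Rightarrow> token list" where
  "observed n c xs = map (\<lambda>(e, x). (e, \<lfloor>x * real n ^ c\<rfloor>)) xs"

text \<open>
  The adversary fixes a partition \<open>P\<close> of the edges into batches. Given the start times \<open>t\<close> of all
  batches, it then chooses the timestamped stream \<open>adv t\<close>, including the order of edges with equal
  timestamps. Measurability is only needed for what the algorithm gets to see.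
\<close>

definition hidden_batch_adversary ::
  "nat \<Rightarrow> nat \<Rightarrow> nat \<Rightarrow> real \<Rightarrow> edge set \<Rightarrow> edge set set \<Rightarrow>
   ((edge set \<Rightarrow> real) \<Rightarrow> (edge \<times> real) list) \<Rightarrow> bool" where
  "hidden_batch_adversary n c b w E P adv \<longleftrightarrow>
     partition_on E P \<and> (\<forall>B\<in>P. card B \<le> b) \<and>
     (\<forall>t \<in> P \<rightarrow>\<^sub>E {0..1}.
        distinct (map fst (adv t)) \<and> set (map fst (adv t)) = E \<and>
        sorted (map snd (adv t)) \<and>
        (\<forall>(e, x) \<in> set (adv t). \<forall>B\<in>P. e \<in> B \<longrightarrow> x \<in> {t B .. t B + w})) \<and>
     (\<lambda>t. observed n c (adv t)) \<in> start_times P \<rightarrow>\<^sub>M count_space UNIV"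

text \<open>Probability over the start times and the coins of the algorithm that the output is in \<open>R\<close>.\<close>

definition output_prob ::
  "'r streaming_algorithm \<Rightarrow> nat \<Rightarrow> nat \<Rightarrow> edge set set \<Rightarrow>
   ((edge set \<Rightarrow> real) \<Rightarrow> (edge \<times> real) list) \<Rightarrow> 'r set \<Rightarrow> real" where
  "output_prob A n c P adv R =
     (\<integral>t. measure_pmf.prob (run A (observed n c (adv t))) R \<partial>start_times P)"

end

theory Submission
  imports Defs
begin

text \<open>
  To explore a vertex \<open>v\<close>, wait in each of \<open>k\<close> short slots at the start of the stream for an
  edge leaving the component known so far, and store all edges arriving within one batch width of it,
  so that its whole batch is caught. Accept if no later edge leaves the component, the growth steps
  came in a canonical order, and there are at most \<open>l\<close> vertices. If \<open>\<sigma>\<close> is the length of a slot, the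
  component of a suitable \<open>v\<close> is found with probability about \<open>\<sigma>^k\<close>, because its \<open>k\<close> growth batches
  have to hit their slots and the others only have to come late. A wrong acceptance also needs
  the \<open>k\<close> hits, and in addition some batch that was missed because it came during the slots. Since
  the order is canonical, the number of ways to miss \<open>j\<close> batches is at most \<open>(c l\<^sup>2)^j\<close>, and wrong
  acceptances are rarer than correct ones by a factor polynomial in \<open>l\<close> times \<open>\<sigma>\<close>. So \<open>\<sigma>\<close> need only be
  polynomial in \<open>\<beta> \<delta> / l\<close>, and \<open>(l / (\<beta> \<delta>))^O(l)\<close> random explorations suffice. Small
  components that share no batch behave independently, and a batch meets few components, which
  gives concentration over the order of the stream. If \<open>n\<close> is small compared to \<open>b\<close>, or if \<open>w\<close> is not
  tiny, one can afford to store all edges at vertices of low degree.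
\<close>

subsection \<open>Finite automata as streaming algorithms\<close>

text \<open>The obstacle is the union bound over sets of missed batches, since high degrees admit
  any number of them. Two facts tame it. Acceptance forces all but \<open>l^2\<close> of the batches
  at the reached set to be missed, because each of the others shows an edge inside at most
  \<open>l\<close> vertices. And as growth is canonical, the missed set is determined by any set of
  ignored batches that agrees with it at the reached set. Random marks therefore turn different
  missed sets into disjoint events, and the price per missed batch is \<open>2 l^2\<close>, against
  a gain of \<tau> = \<open>l\<close> \<sigma> for its being early. The adversary knows all start
  times, so failure is expressed through start times alone, mostly as boxes with one interval per
  batch. A foreign batch that starts within \<open>3 W\<close> of a growth batch may be swallowed by
  its window. The bound for such coincidences carries no power \<open>\<sigma>^k\<close>, so the
  width must be below about \<open>\<sigma>^l\<close>; and the variance is small only if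
  \<open>n\<close> exceeds \<open>b / \<sigma>^(l-1)\<close> by a polynomial factor. These two
  demands separate the two regimes.\<close>

lemma automaton_streaming:
  fixes p0 :: "'s pmf" and st :: "'s \<Rightarrow> token \<Rightarrow> 's" and an :: "'s \<Rightarrow> 'r"
  assumes fin: "finite Q" and cardQ: "card Q \<le> 2 ^ S" and init: "set_pmf p0 \<subseteq> Q"
    and st: "\<And>s z. s \<in> Q \<Longrightarrow> st s z \<in> Q"
  obtains A :: "'r streaming_algorithm"
  where "uses_space A (real S)"
    and "\<And>xs. run A xs = map_pmf (\<lambda>s. an (foldl st s xs)) p0"
proof -
  let ?L = "{bs :: bool list. length bs = S}"
  have L: "finite ?L" "card ?L = 2 ^ S"
    using finite_lists_length_eq[of "UNIV :: bool set" S] card_lists_length_eq[of "UNIV :: bool set" S]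
    by auto
  obtain f where f: "inj_on f Q" "f ` Q \<subseteq> ?L"
    using card_le_inj[OF fin L(1)] cardQ L(2) by auto
  define dec where "dec = inv_into Q f"
  have dec: "dec (f s) = s" if "s \<in> Q" for s
    using f(1) that by (simp add: dec_def)
  \<comment> \<open>All strings have the same length \<open>S\<close>. The coins are tossed once in
    \<open>init\<close> and are part of the state from then on, so \<open>step\<close> and
    \<open>answer\<close> are deterministic.\<close>
  define A :: "'r streaming_algorithm" where
    "A = \<lparr>init = map_pmf f p0, step = (\<lambda>b z. return_pmf (f (st (dec b) z))),
          answer = (\<lambda>b. return_pmf (an (dec b)))\<rparr>"
  have inQ: "foldl st s xs \<in> Q" if "s \<in> Q" for s xs
    using that by (induction xs rule: rev_induct) (auto intro: st)
  have mem: "memory_after A xs = map_pmf (\<lambda>s. f (foldl st s xs)) p0" for xs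
  proof (induction xs rule: rev_induct)
    case Nil
    then show ?case by (simp add: memory_after_def A_def)
  next
    case (snoc z xs)
    have "memory_after A (xs @ [z]) = bind_pmf (memory_after A xs) (\<lambda>s. step A s z)"
      by (simp add: memory_after_def)
    also have "\<dots> = bind_pmf p0 (\<lambda>s. return_pmf (f (st (dec (f (foldl st s xs))) z)))"
      unfolding snoc by (simp add: A_def bind_map_pmf)
    also have "\<dots> = bind_pmf p0 (\<lambda>s. return_pmf (f (foldl st s (xs @ [z]))))"
      using init by (intro bind_pmf_cong refl) (auto simp: dec inQ)
    finally show ?case by (simp add: map_pmf_def)
  qed
  have "uses_space A (real S)"
    using init f(2) inQ by (fastforce simp: uses_space_def mem)
  moreover have "run A xs = map_pmf (\<lambda>s. an (foldl st s xs)) p0" for xs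
  proof -
    have "run A xs = bind_pmf p0 (\<lambda>s. return_pmf (an (dec (f (foldl st s xs)))))"
      by (simp add: run_def mem bind_map_pmf) (simp add: A_def)
    also have "\<dots> = bind_pmf p0 (\<lambda>s. return_pmf (an (foldl st s xs)))"
      using init by (intro bind_pmf_cong refl) (auto simp: dec inQ)
    finally show ?thesis by (simp add: map_pmf_def)
  qed
  ultimately show ?thesis by (rule that)
qed

lemma uses_space_mono: "uses_space A S \<Longrightarrow> S \<le> S' \<Longrightarrow> uses_space A S'"
  by (force simp: uses_space_def)

text \<open>A subset with at most \<open>k\<close> elements can be read off from a list of length
  exactly \<open>k\<close> over \<open>U\<close> and a padding symbol \<open>None\<close>. Storing
  it thus costs \<open>k\<close> times the bits of one element.\<close>

lemma card_bounded_subsets_le: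
  assumes "finite U"
  shows "card {K. K \<subseteq> U \<and> card K \<le> k} \<le> (card U + 1) ^ k"
proof -
  have "{K. K \<subseteq> U \<and> card K \<le> k} \<subseteq> (\<lambda>xs. the ` (set xs - {None})) ` {xs. set xs \<subseteq> insert None (Some ` U) \<and> length xs = k}"
  proof
    fix K assume "K \<in> {K. K \<subseteq> U \<and> card K \<le> k}"
    then have K: "K \<subseteq> U" "card K \<le> k" by auto
    obtain ys where ys: "set ys = K" "distinct ys"
      using finite_distinct_list finite_subset[OF K(1) assms] by blast
    let ?xs = "map Some ys @ replicate (k - length ys) None"
    have "length ?xs = k" using ys K distinct_card[of ys] by simp
    moreover have "set ?xs - {None} = Some ` K" using ys by auto
    then have "the ` (set ?xs - {None}) = K" by (simp only: image_image option.sel image_ident)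
    ultimately show "K \<in> (\<lambda>xs. the ` (set xs - {None})) ` {xs. set xs \<subseteq> insert None (Some ` U) \<and> length xs = k}"
      using ys K by (intro image_eqI[of _ _ ?xs]) auto
  qed
  moreover have fin: "finite {xs. set xs \<subseteq> insert None (Some ` U) \<and> length xs = k}"
    using assms by (intro finite_lists_length_eq) auto
  ultimately have "card {K. K \<subseteq> U \<and> card K \<le> k} \<le> card {xs. set xs \<subseteq> insert None (Some ` U) \<and> length xs = k}"
    by (meson card_image_le card_mono finite_imageI order_trans)
  also have "\<dots> = (card U + 1) ^ k"
    using assms by (subst card_lists_length_eq) (auto simp: card_insert_if card_image)
  finally show ?thesis .
qed

subsection \<open>Components\<close>

lemma component_vertices_self [simp]: "v \<in> component_vertices E v"
  by (simp add: component_vertices_def)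

lemma component_vertices_mono: "E \<subseteq> E' \<Longrightarrow> component_vertices E v \<subseteq> component_vertices E' v"
  unfolding component_vertices_def by (auto elim!: rtrancl_mono[THEN subsetD, rotated])

lemma component_vertices_subset:
  assumes "v \<in> D" and "\<And>x y. x \<in> D \<Longrightarrow> {x, y} \<in> E \<Longrightarrow> y \<in> D"
  shows "component_vertices E v \<subseteq> D"
proof
  fix u assume "u \<in> component_vertices E v"
  then have "(v, u) \<in> {(x, y). {x, y} \<in> E}\<^sup>*" by (simp add: component_vertices_def)
  then show "u \<in> D" by (induction rule: rtrancl_induct) (use assms in auto)
qed

lemma component_vertices_step:
  "x \<in> component_vertices E v \<Longrightarrow> {x, y} \<in> E \<Longrightarrow> y \<in> component_vertices E v"
  unfolding component_vertices_def by (auto intro: rtrancl_into_rtrancl)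

definition all_edges :: "nat \<Rightarrow> edge set" where
  "all_edges n = {{u, v} |u v. u < n \<and> v < n \<and> u \<noteq> v}"

lemma simple_graph_alt: "simple_graph n E \<longleftrightarrow> E \<subseteq> all_edges n"
  by (simp add: simple_graph_def all_edges_def)

lemma all_edges_subset: "all_edges n \<subseteq> (\<lambda>(u, v). {u, v}) ` ({..<n} \<times> {..<n})"
  by (auto simp: all_edges_def)

lemma finite_all_edges [simp]: "finite (all_edges n)"
  using all_edges_subset by (rule finite_subset) auto

lemma card_all_edges_le: "card (all_edges n) \<le> n ^ 2"
proof -
  have "card (all_edges n) \<le> card ({..<n} \<times> {..<n})"
    using all_edges_subset by (rule surj_card_le[rotated]) auto
  then show ?thesis by (simp add: power2_eq_square)
qed

lemma component_vertices_closed: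
  assumes "E \<subseteq> all_edges n" "e \<in> E" "e \<inter> component_vertices E v \<noteq> {}"
  shows "e \<subseteq> component_vertices E v"
proof -
  obtain x y where "e = {x, y}" using assms(1,2) unfolding all_edges_def by blast
  then show ?thesis
    using assms component_vertices_step[of x E v y] component_vertices_step[of y E v x]
    by (auto simp: insert_commute)
qed

text \<open>This is how partial knowledge is certified: if the known edges \<open>A\<close> include
  every edge of \<open>S\<close> at the component known so far, no path of \<open>S\<close> can
  leave it.\<close>

lemma component_vertices_eqI:
  assumes "A \<subseteq> S" and "\<And>e. e \<in> S \<Longrightarrow> e \<inter> component_vertices A v \<noteq> {} \<Longrightarrow> e \<in> A"
  shows "component_vertices S v = component_vertices A v"
proof
  show "component_vertices S v \<subseteq> component_vertices A v"
    using assms by (intro component_vertices_subset) (auto intro: component_vertices_step)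
qed (rule component_vertices_mono[OF assms(1)])

lemma component_vertices_less:
  assumes "E \<subseteq> all_edges n" "v < n"
  shows "component_vertices E v \<subseteq> {..<n}"
  using assms by (intro component_vertices_subset) (fastforce simp: all_edges_def doubleton_eq_iff)+

lemma component_vertices_eq:
  assumes "u \<in> component_vertices E v"
  shows "component_vertices E u = component_vertices E v"
proof -
  have sym: "sym {(x, y). {x, y} \<in> E}" by (auto simp: sym_def insert_commute)
  then have "sym ({(x, y). {x, y} \<in> E}\<^sup>*)" by (rule sym_rtrancl)
  then show ?thesis
    using assms unfolding component_vertices_def by (auto dest: symD intro: rtrancl_trans)
qed

subsection \<open>Start times and streams\<close>

abbreviation unif :: "real measure" where "unif \<equiv> uniform_measure lborel {0..1}"

lemma prob_space_unif: "prob_space unif"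
  by (intro prob_space_uniform_measure) auto

lemma prob_space_start_times: "prob_space (start_times P)"
  unfolding start_times_def by (intro prob_space_PiM prob_space_unif)

lemma space_start_times: "space (start_times P) = P \<rightarrow>\<^sub>E UNIV"
  by (simp add: start_times_def space_PiM)

lemma sets_start_times_PiE:
  "finite P \<Longrightarrow> (\<And>B. B \<in> P \<Longrightarrow> I B \<in> sets borel) \<Longrightarrow> Pi\<^sub>E P I \<in> sets (start_times P)"
  unfolding start_times_def by (intro sets_PiM_I_finite) auto

text \<open>The source of almost all probabilities below: events are arranged to prescribe a set of
  times for each batch separately, so independence becomes a product.\<close>

lemma measure_start_times_PiE:
  assumes "finite P" "\<And>B. B \<in> P \<Longrightarrow> I B \<in> sets borel"
  shows "measure (start_times P) (Pi\<^sub>E P I) = (\<Prod>B\<in>P. measure unif (I B))"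
proof -
  interpret finite_product_prob_space "\<lambda>_. unif" P
    by (intro finite_product_prob_space.intro product_prob_spaceI prob_space_unif
        finite_product_sigma_finite.intro product_prob_space.axioms(1)
        finite_product_sigma_finite_axioms.intro assms(1))
  show ?thesis
    unfolding start_times_def using assms(2) by (intro prob_times) auto
qed

lemma measure_unif_Ico: "0 \<le> a \<Longrightarrow> a \<le> b \<Longrightarrow> b \<le> 1 \<Longrightarrow> measure unif {a..<b} = b - a"
proof -
  assume a: "0 \<le> a" "a \<le> b" "b \<le> 1"
  then have "{0..1} \<inter> {a..<b} = {a..<b}" by auto
  then show ?thesis using a by (simp add: measure_uniform_measure)
qed

lemma measure_unif_Ici: "0 \<le> a \<Longrightarrow> a \<le> 1 \<Longrightarrow> measure unif {a..} = 1 - a"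
proof -
  assume a: "0 \<le> a" "a \<le> 1"
  then have "{0..1} \<inter> {a..} = {a..1}" by auto
  then show ?thesis using a by (simp add: measure_uniform_measure)
qed

lemma measure_unif_Ico_le: "a \<le> b \<Longrightarrow> measure unif {a..<b} \<le> b - a"
proof -
  assume a: "a \<le> b"
  have "measure lborel ({0..1} \<inter> {a..<b}) \<le> measure lborel {a..<b}"
    using a by (intro measure_mono_fmeasurable) (auto simp: fmeasurable_def)
  then show ?thesis using a by (simp add: measure_uniform_measure)
qed

lemma measure_unif_01: "measure unif {0..1} = 1"
  by (simp add: measure_uniform_measure)

lemma AE_start_times:
  assumes "finite P"
  shows "AE t in start_times P. t \<in> P \<rightarrow>\<^sub>E {0..1}"
proof -
  interpret prob_space "start_times P" by (rule prob_space_start_times)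
  have "prob (P \<rightarrow>\<^sub>E {0..1}) = 1"
    using assms by (subst measure_start_times_PiE) (auto simp: measure_unif_01)
  then show ?thesis
    using assms by (intro AE_prob_1) auto
qed

text \<open>\<open>f\<close> bounds the failure probability over the coins for fixed start times.
  Only \<open>f\<close> has to be integrated, so it can be chosen without reference to the stream
  that the adversary picks after seeing \<open>t\<close>.\<close>

lemma output_prob_ge:
  assumes adv: "hidden_batch_adversary n c b w E P adv" and fin: "finite P"
    and int: "integrable (start_times P) f" and le: "(\<integral>t. f t \<partial>start_times P) \<le> \<delta>"
    and ge: "\<And>t. t \<in> P \<rightarrow>\<^sub>E {0..1} \<Longrightarrow>
           measure_pmf.prob (run A (observed n c (adv t))) R \<ge> 1 - f t"
  shows "output_prob A n c P adv R \<ge> 1 - \<delta>"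
proof -
  interpret prob_space "start_times P" by (rule prob_space_start_times)
  let ?g = "\<lambda>t. measure_pmf.prob (run A (observed n c (adv t))) R"
  have meas: "?g \<in> borel_measurable (start_times P)"
  proof -
    have "(\<lambda>t. observed n c (adv t)) \<in> start_times P \<rightarrow>\<^sub>M count_space UNIV"
      using adv by (simp add: hidden_batch_adversary_def)
    then show ?thesis
      by (rule measurable_compose) simp
  qed
  have intg: "integrable (start_times P) ?g"
    by (rule integrable_const_bound[of _ 1]) (auto simp: meas)
  have "1 - \<delta> \<le> 1 - (\<integral>t. f t \<partial>start_times P)" using le by simp
  also have "\<dots> = (\<integral>t. 1 - f t \<partial>start_times P)"
    using int by (simp add: prob_space)
  also have "\<dots> \<le> (\<integral>t. ?g t \<partial>start_times P)"
  proof (rule integral_mono_AE)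
    show "integrable (start_times P) (\<lambda>t. 1 - f t)" using int by simp
    show "AE t in start_times P. 1 - f t \<le> ?g t"
      using AE_start_times[OF fin] by (rule AE_mp) (use ge in simp)
  qed (rule intg)
  finally show ?thesis by (simp add: output_prob_def)
qed

text \<open>Rounding is absorbed here once and for all: as \<lfloor>x + y\<rfloor> \<le>
  \<lfloor>x\<rfloor> + \<lceil>y\<rceil>, batches look as if they started at integer times and
  spread over an integer width.\<close>

lemma adversary_stream:
  assumes "hidden_batch_adversary n c b w E P adv" "t \<in> P \<rightarrow>\<^sub>E {0..1}"
  obtains ts where "distinct (map fst (observed n c (adv t)))"
    "set (observed n c (adv t)) = (\<lambda>e. (e, ts e)) ` E"
    "sorted (map snd (observed n c (adv t)))"
    "\<And>e B. B \<in> P \<Longrightarrow> e \<in> B \<Longrightarrow> \<lfloor>t B * real n ^ c\<rfloor> \<le> ts e"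
    "\<And>e B. B \<in> P \<Longrightarrow> e \<in> B \<Longrightarrow> ts e \<le> \<lfloor>t B * real n ^ c\<rfloor> + \<lceil>w * real n ^ c\<rceil>"
proof -
  let ?o = "observed n c (adv t)"
  have part: "partition_on E P" using assms by (simp add: hidden_batch_adversary_def)
  have H: "distinct (map fst (adv t)) \<and> set (map fst (adv t)) = E \<and> sorted (map snd (adv t)) \<and>
    (\<forall>(e, x) \<in> set (adv t). \<forall>B\<in>P. e \<in> B \<longrightarrow> x \<in> {t B .. t B + w})"
    using assms(1)[unfolded hidden_batch_adversary_def, THEN conjunct2, THEN conjunct2,
        THEN conjunct1] assms(2) by (rule bspec)
  note a = H[THEN conjunct1] H[THEN conjunct2, THEN conjunct1]
    H[THEN conjunct2, THEN conjunct2, THEN conjunct1] H[THEN conjunct2, THEN conjunct2, THEN conjunct2]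
  have fst_o: "map fst ?o = map fst (adv t)" by (auto simp: observed_def)
  have snd_o: "map snd ?o = map (\<lambda>x. \<lfloor>x * real n ^ c\<rfloor>) (map snd (adv t))"
    by (auto simp: observed_def)
  have sorted: "sorted (map snd ?o)"
    unfolding snd_o using a(3)
    by (intro sorted_map_mono) (auto intro!: monoI mono_onI floor_mono mult_right_mono)
  define ts where "ts e = \<lfloor>the (map_of (adv t) e) * real n ^ c\<rfloor>" for e
  have mo: "map_of (adv t) e = Some x \<longleftrightarrow> (e, x) \<in> set (adv t)" for e x
    using a(1) by (auto intro: map_of_is_SomeI dest: map_of_SomeD)
  have dom: "\<exists>x. (e, x) \<in> set (adv t)" if "e \<in> E" for e
    using that a(2) by auto
  have so: "set ?o = (\<lambda>e. (e, ts e)) ` E"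
  proof (intro set_eqI iffI)
    fix z assume "z \<in> set ?o"
    then obtain e x where ex: "(e, x) \<in> set (adv t)" "z = (e, \<lfloor>x * real n ^ c\<rfloor>)"
      by (auto simp: observed_def)
    then have "z = (e, ts e)" using mo[of e x] by (simp add: ts_def)
    moreover have "e \<in> E" unfolding a(2)[symmetric] set_map using imageI[OF ex(1), of fst] by simp
    ultimately show "z \<in> (\<lambda>e. (e, ts e)) ` E" by blast
  next
    fix z assume "z \<in> (\<lambda>e. (e, ts e)) ` E"
    then obtain e where e: "e \<in> E" "z = (e, ts e)" by blast
    then obtain x where x: "(e, x) \<in> set (adv t)" using dom by blast
    then have "z = (e, \<lfloor>x * real n ^ c\<rfloor>)" using mo[of e x] e by (simp add: ts_def)
    then show "z \<in> set ?o" using x by (force simp: observed_def)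
  qed
  have b: "\<lfloor>t B * real n ^ c\<rfloor> \<le> ts e \<and> ts e \<le> \<lfloor>t B * real n ^ c\<rfloor> + \<lceil>w * real n ^ c\<rceil>"
    if "B \<in> P" "e \<in> B" for e B
  proof -
    have "e \<in> E" using that part by (auto simp: partition_on_def)
    then obtain x where x: "(e, x) \<in> set (adv t)" using dom by blast
    then have tse: "ts e = \<lfloor>x * real n ^ c\<rfloor>" using mo[of e x] by (simp add: ts_def)
    have x': "t B \<le> x" "x \<le> t B + w" using bspec[OF a(4) x] that by auto
    have l: "t B * real n ^ c \<le> x * real n ^ c" using x' by (intro mult_right_mono) auto
    have "x * real n ^ c \<le> (t B + w) * real n ^ c" using x' by (intro mult_right_mono) auto
    then have u: "x * real n ^ c \<le> t B * real n ^ c + w * real n ^ c" by (simp add: algebra_simps)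
    show ?thesis unfolding tse using l u by linarith
  qed
  show ?thesis
  proof (rule that[of ts])
    show "distinct (map fst ?o)" using a(1) by (simp only: fst_o)
    show "set ?o = (\<lambda>e. (e, ts e)) ` E" by (rule so)
    show "sorted (map snd ?o)" by (rule sorted)
  qed (use b in blast)+
qed

subsection \<open>Storing the edges at low-degree vertices\<close>

definition hdeg :: "edge set \<Rightarrow> nat \<Rightarrow> nat" where
  "hdeg K u = card {e \<in> K. u \<in> e}"

definition low_degree_step :: "nat \<Rightarrow> edge set \<Rightarrow> edge \<Rightarrow> edge set" where
  "low_degree_step l K e = (if \<exists>u\<in>e. hdeg K u < l then insert e K else K)"

lemma hdeg_mono: "finite K' \<Longrightarrow> K \<subseteq> K' \<Longrightarrow> hdeg K u \<le> hdeg K' u"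
  unfolding hdeg_def by (intro card_mono) auto

text \<open>The sum of \<open>min (hdeg K u) l\<close> is a potential: a stored edge has an endpoint
  of degree below \<open>l\<close>, whose summand rises. So at most \<open>n * l\<close> edges are
  stored. A dropped edge has only saturated endpoints, and they stay saturated because degrees never
  fall.\<close>

lemma low_degree_fold:
  fixes l n :: nat
  assumes "set es \<subseteq> all_edges n" "distinct es"
  defines "K \<equiv> foldl (low_degree_step l) {} es"
  shows "K \<subseteq> set es \<and> (\<forall>e\<in>set es - K. \<forall>u\<in>e. hdeg K u \<ge> l) \<and>
    card K \<le> (\<Sum>u<n. min (hdeg K u) l)"
  using assms(1,2) unfolding K_def
proof (induction es rule: rev_induct)
  case Nil
  then show ?case by simp
next
  case (snoc e es)
  let ?K = "foldl (low_degree_step l) {} es"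
  let ?K' = "foldl (low_degree_step l) {} (es @ [e])"
  have IH: "?K \<subseteq> set es" "\<And>e u. e \<in> set es - ?K \<Longrightarrow> u \<in> e \<Longrightarrow> hdeg ?K u \<ge> l"
    "card ?K \<le> (\<Sum>u<n. min (hdeg ?K u) l)"
    using snoc by auto
  have fin: "finite ?K" using IH(1) by (rule finite_subset) simp
  have e: "e \<in> all_edges n" "e \<notin> ?K" using snoc.prems IH(1) by auto
  show ?case
  proof (cases "\<exists>u\<in>e. hdeg ?K u < l")
    case False
    then have "?K' = ?K" by (simp add: low_degree_step_def)
    moreover have "\<forall>e'\<in>set (es @ [e]) - ?K. \<forall>u\<in>e'. hdeg ?K u \<ge> l"
      using IH(2) False by (auto simp: not_less)
    ultimately show ?thesis using IH(1,3) by auto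
  next
    case True
    then obtain u where u: "u \<in> e" "hdeg ?K u < l" by blast
    have K': "?K' = insert e ?K" using True by (simp add: low_degree_step_def)
    have mono: "hdeg ?K x \<le> hdeg (insert e ?K) x" for x
      using fin by (intro hdeg_mono) auto
    have "{e' \<in> insert e ?K. u \<in> e'} = insert e {e' \<in> ?K. u \<in> e'}" using u by auto
    then have "hdeg (insert e ?K) u = Suc (hdeg ?K u)" using e fin by (simp add: hdeg_def)
    then have less: "min (hdeg ?K u) l < min (hdeg (insert e ?K) u) l" using u by simp
    have "u < n" using u e by (auto simp: all_edges_def)
    then have "(\<Sum>u<n. min (hdeg ?K u) l) < (\<Sum>u<n. min (hdeg (insert e ?K) u) l)"
      using less min.mono[OF mono order_refl] by (intro sum_strict_mono_ex1) auto
    then have "card (insert e ?K) \<le> (\<Sum>u<n. min (hdeg (insert e ?K) u) l)"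
      using IH(3) e fin by simp
    moreover have "hdeg (insert e ?K) u \<ge> l" if "e' \<in> set (es @ [e]) - insert e ?K" "u \<in> e'" for e' u
      using IH(2)[of e' u] mono[of u] that by simp
    ultimately show ?thesis using IH(1) unfolding K' by auto
  qed
qed

lemma hdeg_less_card_component:
  assumes E: "E \<subseteq> all_edges n" and v: "v < n" and u: "u \<in> component_vertices E v" and K: "K \<subseteq> E"
  shows "hdeg K u < card (component_vertices E v)"
proof -
  let ?C = "component_vertices E v"
  have finC: "finite ?C" using component_vertices_less[OF E v] by (rule finite_subset) simp
  have "{e \<in> K. u \<in> e} \<subseteq> (\<lambda>x. {u, x}) ` (?C - {u})"
  proof
    fix e assume e: "e \<in> {e \<in> K. u \<in> e}"
    then obtain x where x: "e = {u, x}" "x \<noteq> u"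
      using E K unfolding all_edges_def by blast
    then have "x \<in> ?C" using u e K by (intro component_vertices_step[OF u]) auto
    then show "e \<in> (\<lambda>x. {u, x}) ` (?C - {u})" using x by auto
  qed
  then have "hdeg K u \<le> card (?C - {u})"
    unfolding hdeg_def using finC by (intro surj_card_le) auto
  also have "\<dots> < card ?C" using u finC by (intro psubset_card_mono) auto
  finally show ?thesis .
qed

text \<open>Space is bounded over all token sequences, also those that no graph produces, so the
  memory is capped explicitly and \<open>None\<close> records an overflow or an invalid token.
  \<open>low_degree_state_fold\<close> shows that genuine streams never lead there.\<close>

definition low_degree_state :: "nat \<Rightarrow> nat \<Rightarrow> nat \<Rightarrow> edge set option \<Rightarrow> token \<Rightarrow> edge set option" where
  "low_degree_state n l k s z = (case s of None \<Rightarrow> None | Some K \<Rightarrow>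
     (let K' = low_degree_step l K (fst z) in
      if fst z \<in> all_edges n \<and> card K' \<le> k then Some K' else None))"

lemma low_degree_state_fold:
  assumes "set (map fst xs) \<subseteq> all_edges n" "distinct (map fst xs)" "card (set (map fst xs)) \<le> m"
  shows "foldl (low_degree_state n l (min m (n * l))) (Some {}) xs =
     Some (foldl (low_degree_step l) {} (map fst xs))"
  using assms
proof (induction xs rule: rev_induct)
  case Nil
  then show ?case by simp
next
  case (snoc z xs)
  let ?K = "foldl (low_degree_step l) {} (map fst (xs @ [z]))"
  have inv: "?K \<subseteq> set (map fst (xs @ [z]))" "card ?K \<le> (\<Sum>u<n. min (hdeg ?K u) l)"
    using low_degree_fold[OF snoc.prems(1,2), of l] by auto
  have "(\<Sum>u<n. min (hdeg ?K u) l) \<le> (\<Sum>u<n. l)" by (intro sum_mono) auto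
  then have "card ?K \<le> n * l" using inv(2) by simp
  moreover have "card ?K \<le> m"
    using card_mono[OF _ inv(1)] snoc.prems(3) by simp
  ultimately have c: "card ?K \<le> min m (n * l)" by simp
  have "card (set (map fst xs)) \<le> card (set (map fst (xs @ [z])))"
    by (intro card_mono) auto
  then have IH: "foldl (low_degree_state n l (min m (n * l))) (Some {}) xs =
     Some (foldl (low_degree_step l) {} (map fst xs))"
    using snoc by auto
  have "foldl (low_degree_state n l (min m (n * l))) (Some {}) (xs @ [z]) =
    low_degree_state n l (min m (n * l)) (Some (foldl (low_degree_step l) {} (map fst xs))) z"
    by (simp only: foldl_append foldl.simps IH)
  also have "\<dots> = Some ?K"
    using c snoc.prems(1) by (simp add: low_degree_state_def Let_def)
  finally show ?case .
qed

definition low_degree_answer :: "nat \<Rightarrow> nat \<Rightarrow> edge set \<Rightarrow> nat \<times> nat set \<times> edge set" where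
  "low_degree_answer n l K =
     (let v = (SOME v. v < n \<and> (\<forall>u\<in>component_vertices K v. hdeg K u < l))
      in (v, component K v))"

text \<open>If all vertices of a component of the stored graph have stored degree below
  \<open>l\<close>, no edge at them was dropped, so it is a component of the input as well. A
  component with at most \<open>l\<close> vertices has this property, so a candidate exists; the one
  returned may be larger.\<close>

lemma low_degree_answer_correct:
  assumes E: "E \<subseteq> all_edges n" and es: "set es = E" "distinct es"
    and v: "v < n" "card (component_vertices E v) \<le> l"
  shows "low_degree_answer n l (foldl (low_degree_step l) {} es) \<in> {(v, C). v < n \<and> C = component E v}"
proof -
  let ?K = "foldl (low_degree_step l) {} es"
  let ?Q = "\<lambda>v. v < n \<and> (\<forall>u\<in>component_vertices ?K v. hdeg ?K u < l)"
  have inv: "?K \<subseteq> E" "\<And>e u. e \<in> E - ?K \<Longrightarrow> u \<in> e \<Longrightarrow> hdeg ?K u \<ge> l"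
    using low_degree_fold[of es n l] E es by auto
  have "hdeg ?K u < l" if "u \<in> component_vertices ?K v" for u
    using hdeg_less_card_component[OF E v(1) _ inv(1)] v(2)
      component_vertices_mono[OF inv(1), of v] that less_le_trans by blast
  then have "?Q v" using v(1) by blast
  define u where "u = (SOME v. ?Q v)"
  have u: "?Q u" unfolding u_def by (rule someI[of ?Q]) fact
  have mem: "e \<in> ?K" if e: "e \<in> E" "e \<inter> component_vertices ?K u \<noteq> {}" for e
  proof (rule ccontr)
    assume "e \<notin> ?K"
    moreover obtain x where "x \<in> e" "x \<in> component_vertices ?K u" using e(2) by blast
    ultimately show False using u inv(2)[of e x] e(1) leD by blast
  qed
  have eq: "component_vertices E u = component_vertices ?K u"
    using inv(1) mem by (rule component_vertices_eqI)
  have ne: "e \<noteq> {}" if "e \<in> E" for e using that E by (auto simp: all_edges_def)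
  have "e \<in> ?K" if "e \<in> E" "e \<subseteq> component_vertices ?K u" for e
    using mem[of e] ne[of e] that by (simp add: Int_absorb2)
  then have "{e \<in> E. e \<subseteq> component_vertices ?K u} = {e \<in> ?K. e \<subseteq> component_vertices ?K u}"
    using inv(1) by auto
  then have "component E u = component ?K u"
    by (simp add: component_def eq)
  moreover have "low_degree_answer n l ?K = (u, component ?K u)"
    by (simp add: low_degree_answer_def u_def Let_def)
  ultimately show ?thesis using u by simp
qed

lemma low_degree_algorithm:
  assumes S: "(card (all_edges n) + 1) ^ min m (n * l) + 1 \<le> 2 ^ S"
  obtains A where "uses_space A (real S)"
    "\<And>E P adv c b w v. E \<subseteq> all_edges n \<Longrightarrow> card E \<le> m \<Longrightarrow>
       v < n \<Longrightarrow> card (component_vertices E v) \<le> l \<Longrightarrow> hidden_batch_adversary n c b w E P adv \<Longrightarrow>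
       output_prob A n c P adv {(v, C). v < n \<and> C = component E v} \<ge> 1"
proof -
  let ?k = "min m (n * l)"
  let ?Q = "insert None (Some ` {K. K \<subseteq> all_edges n \<and> card K \<le> ?k})"
  have fin: "finite {K. K \<subseteq> all_edges n \<and> card K \<le> ?k}"
    by (rule finite_subset[of _ "Pow (all_edges n)"]) auto
  have "card ?Q = Suc (card {K. K \<subseteq> all_edges n \<and> card K \<le> ?k})"
    using fin by (subst card_insert_disjoint) (auto simp: card_image)
  also have "\<dots> \<le> 2 ^ S"
    using S card_bounded_subsets_le[of "all_edges n" ?k] by simp
  finally have card: "card ?Q \<le> 2 ^ S" .
  have step: "low_degree_state n l ?k s z \<in> ?Q" if "s \<in> ?Q" for s z
    using that by (auto simp: low_degree_state_def low_degree_step_def Let_def split: if_splits)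
  obtain A where A: "uses_space A (real S)"
    "\<And>xs. run A xs = map_pmf (\<lambda>s. low_degree_answer n l (the (foldl (low_degree_state n l ?k) s xs)))
        (return_pmf (Some {}))"
    by (rule automaton_streaming[of ?Q S "return_pmf (Some {})" "low_degree_state n l ?k" "low_degree_answer n l \<circ> the"])
      (use fin card step in \<open>auto simp: o_def\<close>)
  have "output_prob A n c P adv {(v, C). v < n \<and> C = component E v} \<ge> 1 - 0"
    if E: "E \<subseteq> all_edges n" "card E \<le> m" and v: "v < n" "card (component_vertices E v) \<le> l"
      and adv: "hidden_batch_adversary n c b w E P adv" for E P adv c b w v
  proof (rule output_prob_ge[OF adv, where f = "\<lambda>_. 0"])
    have part: "partition_on E P" using adv by (simp add: hidden_batch_adversary_def)
    have "finite E" using E(1) by (rule finite_subset) simp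
    then show "finite P" using part by (rule finite_elements)
    fix t assume t: "t \<in> P \<rightarrow>\<^sub>E {0..1::real}"
    let ?o = "observed n c (adv t)"
    obtain ts where o: "distinct (map fst ?o)" "set ?o = (\<lambda>e. (e, ts e)) ` E"
      using adversary_stream[OF adv t] by metis
    have set: "set (map fst ?o) = E" using o(2) by (simp add: image_image)
    have "foldl (low_degree_state n l ?k) (Some {}) ?o = Some (foldl (low_degree_step l) {} (map fst ?o))"
      using o(1) set E by (intro low_degree_state_fold) auto
    moreover have "low_degree_answer n l (foldl (low_degree_step l) {} (map fst ?o))
        \<in> {(v, C). v < n \<and> C = component E v}"
      using E(1) set o(1) v by (rule low_degree_answer_correct)
    ultimately show "1 - 0 \<le> measure_pmf.prob (run A ?o) {(v, C). v < n \<and> C = component E v}"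
      by (simp add: A(2))
  qed auto
  then show ?thesis by (intro that[OF A(1)]) simp
qed

subsection \<open>Growing the component of a vertex\<close>

definition leaves :: "nat set \<Rightarrow> edge \<Rightarrow> bool" where
  "leaves D e \<longleftrightarrow> e \<inter> D \<noteq> {} \<and> \<not> e \<subseteq> D"

text \<open>The margin \<open>W\<close> keeps every window around a token of slot \<open>i\<close> inside
  \<open>[i H, (i + 1) H)\<close>, so that the component reached after slot \<open>i\<close> is known when slot
  \<open>i + 1\<close> begins.\<close>

definition in_slot :: "int \<Rightarrow> int \<Rightarrow> nat \<Rightarrow> int \<Rightarrow> bool" where
  "in_slot H W i x \<longleftrightarrow> int i * H + W \<le> x \<and> x < (int i + 1) * H - W"

fun grow :: "int \<Rightarrow> int \<Rightarrow> nat \<Rightarrow> token set \<Rightarrow> nat \<Rightarrow> token set" where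
  "grow H W v Z 0 = {}"
| "grow H W v Z (Suc i) = grow H W v Z i \<union>
     {z \<in> Z. \<exists>z0\<in>Z. in_slot H W i (snd z0) \<and>
        leaves (component_vertices (fst ` grow H W v Z i) v) (fst z0) \<and> \<bar>snd z - snd z0\<bar> \<le> W}"

definition reach :: "int \<Rightarrow> int \<Rightarrow> nat \<Rightarrow> token set \<Rightarrow> nat \<Rightarrow> nat set" where
  "reach H W v Z i = component_vertices (fst ` grow H W v Z i) v"

definition front :: "int \<Rightarrow> int \<Rightarrow> nat \<Rightarrow> token set \<Rightarrow> nat \<Rightarrow> token set" where
  "front H W v Z i = {z \<in> Z. in_slot H W i (snd z) \<and> leaves (reach H W v Z i) (fst z)}"

lemma grow_Suc:
  "grow H W v Z (Suc i) = grow H W v Z i \<union> {z \<in> Z. \<exists>z0\<in>front H W v Z i. \<bar>snd z - snd z0\<bar> \<le> W}"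
  unfolding grow.simps(2) front_def reach_def by blast

declare grow.simps(2) [simp del]

lemma grow_subset: "grow H W v Z i \<subseteq> Z"
  by (induction i) (auto simp: grow_Suc)

lemma grow_mono: "i \<le> j \<Longrightarrow> grow H W v Z i \<subseteq> grow H W v Z j"
  by (induction rule: dec_induct) (auto simp: grow_Suc)

lemma reach_mono: "i \<le> j \<Longrightarrow> reach H W v Z i \<subseteq> reach H W v Z j"
  unfolding reach_def by (intro component_vertices_mono image_mono grow_mono)

lemma front_subset_grow:
  assumes "0 \<le> W" "i < k"
  shows "front H W v Z i \<subseteq> grow H W v Z k"
proof -
  have "front H W v Z i \<subseteq> grow H W v Z (Suc i)"
    using assms(1) by (force simp: grow_Suc front_def)
  also have "\<dots> \<subseteq> grow H W v Z k" using assms(2) by (intro grow_mono) simp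
  finally show ?thesis .
qed

lemma grow_time: "z \<in> grow H W v Z i \<Longrightarrow> 0 \<le> H \<Longrightarrow> snd z < int i * H"
proof (induction i)
  case (Suc i)
  show ?case
  proof (cases "z \<in> grow H W v Z i")
    case True
    then show ?thesis using Suc by (force simp: algebra_simps)
  next
    case False
    then show ?thesis using Suc.prems(1)
      by (auto simp: grow_Suc front_def in_slot_def algebra_simps)
  qed
qed simp

text \<open>Causality: growth may be defined on the set of all tokens although the algorithm only
  ever sees a prefix.\<close>

lemma grow_cong:
  assumes "0 \<le> H" "0 \<le> W" "\<And>z. snd z < int i * H \<Longrightarrow> z \<in> Z \<longleftrightarrow> z \<in> Z'"
  shows "grow H W v Z i = grow H W v Z' i"
  using assms(3)
proof (induction i)
  case (Suc i)
  have "int i * H \<le> int (Suc i) * H" using assms(1) by (intro mult_right_mono) auto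
  then have IH: "grow H W v Z i = grow H W v Z' i" using Suc by force
  have front: "front H W v Z i = front H W v Z' i"
    using Suc.prems assms(2) IH by (auto simp: front_def reach_def in_slot_def algebra_simps)
  have "{z \<in> Z. \<exists>z0\<in>front H W v Z i. \<bar>snd z - snd z0\<bar> \<le> W} =
      {z \<in> Z'. \<exists>z0\<in>front H W v Z i. \<bar>snd z - snd z0\<bar> \<le> W}"
  proof (intro Collect_cong)
    fix z
    show "(z \<in> Z \<and> (\<exists>z0\<in>front H W v Z i. \<bar>snd z - snd z0\<bar> \<le> W)) =
      (z \<in> Z' \<and> (\<exists>z0\<in>front H W v Z i. \<bar>snd z - snd z0\<bar> \<le> W))"
      using Suc.prems[of z] by (fastforce simp: front_def in_slot_def algebra_simps)
  qed
  then show ?case unfolding grow_Suc IH front by simp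
qed simp

text \<open>Each front token lies in its own window, so tokens outside the windows have no influence
  on the growth. Whatever else is forgotten, the same computation on the reduced set gives the same
  result.\<close>

lemma grow_sandwich:
  assumes W: "0 \<le> W" and "grow H W v Z k \<subseteq> K" "K \<subseteq> Z" "i \<le> k"
  shows "grow H W v K i = grow H W v Z i"
  using assms(4)
proof (induction i)
  case (Suc i)
  then have IH: "grow H W v K i = grow H W v Z i" by simp
  have "front H W v Z i \<subseteq> K"
    using front_subset_grow[OF W, of i k H v Z] Suc.prems assms(2) by auto
  then have front: "front H W v K i = front H W v Z i"
    using assms(3) IH by (auto simp: front_def reach_def)
  have "grow H W v Z (Suc i) \<subseteq> K"
    using grow_mono[OF Suc.prems] assms(2) by blast
  then show ?case using assms(3) unfolding grow_Suc IH front by auto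
qed simp

text \<open>Besides the windows and the late edges at the final component, the memory holds the tokens of
  the last \<open>W\<close> time units, from which the past half of a window is filled when a new one opens.\<close>

definition kept :: "int \<Rightarrow> int \<Rightarrow> int \<Rightarrow> nat \<Rightarrow> nat \<Rightarrow> token set \<Rightarrow> int \<Rightarrow> token set" where
  "kept H W T v k Z x = grow H W v Z k \<union>
     {z \<in> Z. T \<le> snd z \<and> fst z \<inter> reach H W v Z k \<noteq> {}} \<union> {z \<in> Z. x - W \<le> snd z}"

lemma kept_subset: "kept H W T v k Z x \<subseteq> Z"
  using grow_subset by (fastforce simp: kept_def)

lemma grow_subset_kept: "grow H W v Z k \<subseteq> kept H W T v k Z x"
  unfolding kept_def by blast

text \<open>A front token of the prefix in slot \<open>i\<close> has time at least
  \<open>i * H\<close>. Hence the prefix already contains every token before \<open>i * H\<close>,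
  and its growth up to slot \<open>i\<close> is final.\<close>

lemma grow_initial:
  assumes HW: "0 \<le> H" "0 \<le> W" and "Z \<subseteq> Z'"
    and init: "\<And>z z'. z \<in> Z \<Longrightarrow> z' \<in> Z' - Z \<Longrightarrow> snd z \<le> snd z'"
  shows "grow H W v Z i \<subseteq> grow H W v Z' i"
proof (induction i)
  case (Suc i)
  have "front H W v Z i \<subseteq> front H W v Z' i"
  proof
    fix z assume z: "z \<in> front H W v Z i"
    then have "int i * H \<le> snd z" "z \<in> Z" using HW by (auto simp: front_def in_slot_def)
    then have "grow H W v Z i = grow H W v Z' i"
      using HW assms(3) init[of z] by (intro grow_cong) force+
    then show "z \<in> front H W v Z' i" using z assms(3) by (auto simp: front_def reach_def)
  qed
  then show ?case using Suc assms(3) by (auto simp: grow_Suc)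
qed simp

text \<open>A new last token \<open>z\<close> can enlarge the growth only by itself or by opening a
  window, which reaches back \<open>W\<close> time units. Any other front token of slot
  \<open>i\<close> shows that slot \<open>i\<close> has begun, so what was grown before it does not
  depend on \<open>z\<close>.\<close>

lemma grow_insert:
  assumes HW: "0 \<le> H" "0 \<le> W" and x: "\<And>z'. z' \<in> Z \<Longrightarrow> snd z' \<le> snd z"
  shows "grow H W v (insert z Z) i \<subseteq> grow H W v Z i \<union> {z' \<in> Z. snd z - W \<le> snd z'} \<union> {z}"
proof (induction i)
  case (Suc i)
  have "z' \<in> grow H W v Z (Suc i) \<union> {z' \<in> Z. snd z - W \<le> snd z'} \<union> {z}"
    if z': "z' \<in> insert z Z" "z0 \<in> front H W v (insert z Z) i" "\<bar>snd z' - snd z0\<bar> \<le> W" for z' z0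
  proof (cases "z' = z \<or> z0 = z")
    case True
    then show ?thesis using z' by auto
  next
    case False
    then have Z: "z' \<in> Z" "z0 \<in> Z" using z' by (auto simp: front_def)
    have "int i * H \<le> snd z0" using z'(2) HW by (auto simp: front_def in_slot_def)
    then have "int i * H \<le> snd z" using x[OF Z(2)] by simp
    then have "grow H W v (insert z Z) i = grow H W v Z i"
      using HW by (intro grow_cong) auto
    then have "z0 \<in> front H W v Z i" using z'(2) Z by (auto simp: front_def reach_def)
    then show ?thesis using z' Z by (auto simp: grow_Suc)
  qed
  moreover have "grow H W v Z i \<subseteq> grow H W v Z (Suc i)" by (simp add: grow_Suc)
  ultimately show ?case using Suc unfolding grow_Suc[of H W v "insert z Z"] by blast
qed simp

text \<open>This makes \<open>kept\<close> computable online from the reduced memory and the new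
  token. The condition \<open>int k * H \<le> T\<close> ensures that the component is final by the
  time late edges are collected.\<close>

lemma kept_insert:
  assumes HW: "0 \<le> H" "0 \<le> W" and T: "int k * H \<le> T"
    and x: "\<And>z'. z' \<in> Z \<Longrightarrow> snd z' \<le> x" "x \<le> snd z"
  shows "kept H W T v k (insert z (kept H W T v k Z x)) (snd z) = kept H W T v k (insert z Z) (snd z)"
proof -
  let ?K = "insert z (kept H W T v k Z x)" and ?Z = "insert z Z"
  have le: "snd z' \<le> snd z" if "z' \<in> Z" for z' using x(1)[OF that] x(2) by (rule order_trans)
  have "grow H W v ?Z k \<subseteq> ?K"
    using grow_insert[OF HW le, of Z v k] x(2) by (fastforce simp: kept_def)
  moreover have sub: "?K \<subseteq> ?Z" using kept_subset by blast
  ultimately have g: "grow H W v ?K k = grow H W v ?Z k"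
    by (intro grow_sandwich[OF HW(2)]) auto
  then have r: "reach H W v ?K k = reach H W v ?Z k" by (simp add: reach_def)
  have "z' \<in> ?K" if "z' \<in> ?Z" "T \<le> snd z'" "fst z' \<inter> reach H W v ?Z k \<noteq> {}" for z'
  proof (cases "z' = z")
    case False
    then have "z' \<in> Z" using that by simp
    then have "int k * H \<le> snd z" using le[of z'] that(2) T by simp
    then have "grow H W v ?Z k = grow H W v Z k" using HW by (intro grow_cong) auto
    then show ?thesis using that \<open>z' \<in> Z\<close> by (simp add: kept_def reach_def)
  qed simp
  moreover have "z' \<in> ?K" if "z' \<in> ?Z" "snd z - W \<le> snd z'" for z'
    using that x(2) by (auto simp: kept_def)
  ultimately show ?thesis
    using sub unfolding kept_def[of H W T v k ?K] kept_def[of H W T v k ?Z] g r by blast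
qed

text \<open>As for the low-degree automaton, \<open>U\<close> and \<open>r\<close> cap the memory on
  arbitrary token sequences; \<open>None\<close> is an abandoned exploration.\<close>

definition grow_state ::
  "int \<Rightarrow> int \<Rightarrow> int \<Rightarrow> token set \<Rightarrow> nat \<Rightarrow> nat \<Rightarrow> nat \<Rightarrow> token set option \<Rightarrow> token \<Rightarrow> token set option" where
  "grow_state H W T U r v k s z = (case s of None \<Rightarrow> None | Some K \<Rightarrow>
     (let K' = kept H W T v k (insert z K) (snd z) in
      if z \<in> U \<and> card K' \<le> r then Some K' else None))"

lemma grow_state_fold:
  assumes HW: "0 \<le> H" "0 \<le> W" and T: "int k * H \<le> T" and "sorted (map snd xs)"
    and "foldl (grow_state H W T U r v k) (Some {}) xs = Some K"
  shows "\<exists>x. (\<forall>z\<in>set xs. snd z \<le> x) \<and> (xs \<noteq> [] \<longrightarrow> x = snd (last xs)) \<and> K = kept H W T v k (set xs) x"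
  using assms(4,5)
proof (induction xs arbitrary: K rule: rev_induct)
  case Nil
  then show ?case by (auto simp: kept_def grow_subset[of H W v "{}" k, simplified])
next
  case (snoc z xs)
  let ?f = "grow_state H W T U r v k"
  have le: "\<forall>z'\<in>set xs. snd z' \<le> snd z" and s: "sorted (map snd xs)"
    using snoc.prems(1) by (auto simp: sorted_append)
  have *: "?f (foldl ?f (Some {}) xs) z = Some K" using snoc.prems(2) by simp
  then obtain K0 where K0: "foldl ?f (Some {}) xs = Some K0"
    by (cases "foldl ?f (Some {}) xs") (auto simp: grow_state_def)
  obtain x where x: "\<forall>z\<in>set xs. snd z \<le> x" "xs \<noteq> [] \<longrightarrow> x = snd (last xs)"
    "K0 = kept H W T v k (set xs) x"
    using snoc.IH[OF s K0] by blast
  have K: "K = kept H W T v k (insert z K0) (snd z)"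
    using * unfolding K0 by (auto simp: grow_state_def Let_def split: if_splits)
  have "K = kept H W T v k (insert z (set xs)) (snd z)"
  proof (cases "xs = []")
    case True
    then have "K0 = {}" using x(3) kept_subset[of H W T v k "{}" x] by auto
    then show ?thesis using K True by simp
  next
    case False
    then have "x \<le> snd z" using x(2) le by auto
    then show ?thesis unfolding K x(3) using x(1) by (intro kept_insert[OF HW T]) auto
  qed
  then show ?case using le by auto
qed

lemma grow_state_fold_Some:
  assumes HW: "0 \<le> H" "0 \<le> W" and T: "int k * H \<le> T"
    and "sorted (map snd xs)" "set xs \<subseteq> U"
    and "\<And>ys zs. xs = ys @ zs \<Longrightarrow> ys \<noteq> [] \<Longrightarrow> card (kept H W T v k (set ys) (snd (last ys))) \<le> r"
  shows "\<exists>K. foldl (grow_state H W T U r v k) (Some {}) xs = Some K"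
  using assms(4-6)
proof (induction xs rule: rev_induct)
  case (snoc z xs)
  let ?f = "grow_state H W T U r v k"
  have s: "sorted (map snd xs)" and U: "set xs \<subseteq> U" "z \<in> U"
    using snoc.prems by (auto simp: sorted_append)
  have "\<exists>K. foldl ?f (Some {}) xs = Some K"
    using s U(1) by (intro snoc.IH) (use snoc.prems(3) in auto)
  then obtain K0 where K0: "foldl ?f (Some {}) xs = Some K0" by blast
  obtain x where x: "\<forall>z\<in>set xs. snd z \<le> x" "xs \<noteq> [] \<longrightarrow> x = snd (last xs)"
    "K0 = kept H W T v k (set xs) x"
    using grow_state_fold[OF HW T s K0] by blast
  have "kept H W T v k (insert z K0) (snd z) = kept H W T v k (insert z (set xs)) (snd z)"
  proof (cases "xs = []")
    case True
    then have "K0 = {}" using x(3) kept_subset[of H W T v k "{}" x] by auto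
    then show ?thesis using True by simp
  next
    case False
    then have "x \<le> snd z" using x(2) snoc.prems(1) by (auto simp: sorted_append)
    then show ?thesis unfolding x(3) using x(1) by (intro kept_insert[OF HW T]) auto
  qed
  moreover have "card (kept H W T v k (insert z (set xs)) (snd z)) \<le> r"
    using snoc.prems(3)[of "xs @ [z]" "[]"] by simp
  ultimately have "?f (Some K0) z = Some (kept H W T v k (insert z K0) (snd z))"
    using U(2) by (simp add: grow_state_def Let_def)
  then show ?case by (simp add: K0)
qed simp

subsection \<open>Wrong acceptances\<close>

text \<open>The last condition makes the order of growth canonical: slot \<open>i\<close> must contain the
  edge of least code leaving the component reached so far. A given set of missed batches can then
  cause a wrong acceptance in one order only, instead of in up to \<open>k!\<close> many.\<close>

definition accepted :: "int \<Rightarrow> int \<Rightarrow> int \<Rightarrow> nat \<Rightarrow> nat \<Rightarrow> nat \<Rightarrow> token set \<Rightarrow> bool" where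
  "accepted H W T l v k K \<longleftrightarrow> card (reach H W v K k) \<le> l \<and>
     (\<forall>z\<in>K. T \<le> snd z \<and> fst z \<inter> reach H W v K k \<noteq> {} \<longrightarrow> fst z \<subseteq> reach H W v K k) \<and>
     (\<forall>i<k. (\<forall>z\<in>front H W v K i. \<forall>z'\<in>front H W v K i. \<bar>snd z - snd z'\<bar> \<le> W) \<and>
       (\<exists>z0\<in>front H W v K i. \<forall>z\<in>K. fst z \<subseteq> reach H W v K k \<and> leaves (reach H W v K i) (fst z) \<longrightarrow>
          set_encode (fst z0) \<le> set_encode (fst z)))"

definition found :: "int \<Rightarrow> int \<Rightarrow> nat \<Rightarrow> nat \<Rightarrow> token set \<Rightarrow> nat set \<times> edge set" where
  "found H W v k K = (reach H W v K k, {e \<in> fst ` K. e \<subseteq> reach H W v K k})"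

section \<open>Batches, canonical growth and sets of missed batches\<close>

locale batched_graph =
  fixes n :: nat and E :: "edge set" and P :: "edge set set"
  assumes E: "E \<subseteq> all_edges n" and part: "partition_on E P"
begin

definition batch :: "edge \<Rightarrow> edge set" where
  "batch e = (THE B. B \<in> P \<and> e \<in> B)"

definition pick :: "edge set set \<Rightarrow> nat set \<Rightarrow> edge" where
  "pick Y D = (ARG_MIN set_encode e. e \<in> E \<and> e \<notin> \<Union>Y \<and> leaves D e)"

text \<open>\<open>chain v Y i\<close> lists the batches by which the component of \<open>v\<close> grows canonically
  when the batches in \<open>Y\<close> are ignored.\<close>

primrec chain :: "nat \<Rightarrow> edge set set \<Rightarrow> nat \<Rightarrow> edge set list" where
  "chain v Y 0 = []"
| "chain v Y (Suc i) =
     chain v Y i @ [batch (pick Y (component_vertices (\<Union>(set (chain v Y i))) v))]"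

definition cdom :: "nat \<Rightarrow> edge set set \<Rightarrow> nat \<Rightarrow> nat set" where
  "cdom v Y i = component_vertices (\<Union>(set (chain v Y i))) v"

definition touching :: "nat set \<Rightarrow> edge set set" where
  "touching D = {B \<in> P. \<exists>e\<in>B. e \<inter> D \<noteq> {}}"

text \<open>The conditions that a wrong acceptance imposes on the missed batches \<open>Y\<close>
  and that mention no start times. The last one is decisive: a touching batch outside
  \<open>Y\<close> has an edge inside a set of at most \<open>l\<close> vertices, so such batches
  are few whatever the degrees.\<close>

definition valid :: "nat \<Rightarrow> nat \<Rightarrow> nat \<Rightarrow> edge set set \<Rightarrow> bool" where
  "valid l v i Y \<longleftrightarrow> Y \<subseteq> touching (cdom v Y i) \<and> distinct (chain v Y i) \<and>
     set (chain v Y i) \<subseteq> P \<and> set (chain v Y i) \<inter> Y = {} \<and>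
     card (touching (cdom v Y i) - Y) \<le> l ^ 2"

lemma chain_Suc: "chain v Y (Suc i) = chain v Y i @ [batch (pick Y (cdom v Y i))]"
  by (simp add: cdom_def)

lemma length_chain [simp]: "length (chain v Y i) = i"
  by (induction i) auto

lemma finE: "finite E"
  using E by (rule finite_subset) simp

lemma finP: "finite P"
  using finE part by (rule finite_elements)

lemma batch_eq: "B \<in> P \<Longrightarrow> e \<in> B \<Longrightarrow> batch e = B"
  unfolding batch_def using part
  by (intro the_equality) (auto simp: partition_on_def disjoint_def)

lemma batch: "e \<in> E \<Longrightarrow> batch e \<in> P \<and> e \<in> batch e"
  using batch_eq part by (fastforce simp: partition_on_def)

lemma batch_subset: "B \<in> P \<Longrightarrow> B \<subseteq> E"
  using part by (auto simp: partition_on_def)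

lemma finite_edge: "e \<in> E \<Longrightarrow> finite e"
  using E by (auto simp: all_edges_def)

lemma edge_nonempty: "e \<in> E \<Longrightarrow> e \<noteq> {}"
  using E by (auto simp: all_edges_def)

lemma pick_eq:
  assumes "e \<in> E" "e \<notin> \<Union>Y" "leaves D e"
    and "\<And>e'. e' \<in> E \<Longrightarrow> e' \<notin> \<Union>Y \<Longrightarrow> leaves D e' \<Longrightarrow> set_encode e \<le> set_encode e'"
  shows "pick Y D = e"
proof -
  let ?R = "\<lambda>e. e \<in> E \<and> e \<notin> \<Union>Y \<and> leaves D e"
  have "?R (pick Y D) \<and> set_encode (pick Y D) \<le> set_encode e"
    unfolding pick_def using assms arg_min_nat_lemma[of ?R e set_encode] by blast
  then have "set_encode (pick Y D) = set_encode e" "pick Y D \<in> E"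
    using assms(4)[of "pick Y D"] by auto
  then show ?thesis using assms(1) finite_edge set_encode_eq by blast
qed

lemma pick:
  assumes "e \<in> E" "e \<notin> \<Union>Y" "leaves D e"
  shows "pick Y D \<in> E" "pick Y D \<notin> \<Union>Y" "leaves D (pick Y D)" "set_encode (pick Y D) \<le> set_encode e"
proof -
  let ?R = "\<lambda>e. e \<in> E \<and> e \<notin> \<Union>Y \<and> leaves D e"
  have "?R (pick Y D) \<and> set_encode (pick Y D) \<le> set_encode e"
    unfolding pick_def using assms arg_min_nat_lemma[of ?R e set_encode] by blast
  then show "pick Y D \<in> E" "pick Y D \<notin> \<Union>Y" "leaves D (pick Y D)" "set_encode (pick Y D) \<le> set_encode e"
    by auto
qed

lemma card_edges_inside:
  assumes "finite D"
  shows "finite {e \<in> E. e \<subseteq> D}" "card {e \<in> E. e \<subseteq> D} \<le> card D ^ 2"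
proof -
  have "{e \<in> E. e \<subseteq> D} \<subseteq> (\<lambda>(u, v). {u, v}) ` (D \<times> D)"
  proof
    fix e assume e: "e \<in> {e \<in> E. e \<subseteq> D}"
    then obtain u w where "e = {u, w}" using E unfolding all_edges_def by blast
    then show "e \<in> (\<lambda>(u, v). {u, v}) ` (D \<times> D)" using e by (intro image_eqI[of _ _ "(u, w)"]) auto
  qed
  then show "card {e \<in> E. e \<subseteq> D} \<le> card D ^ 2"
    using surj_card_le[of "D \<times> D"] assms by (simp add: power2_eq_square card_cartesian_product)
  show "finite {e \<in> E. e \<subseteq> D}" using finE by simp
qed

text \<open>Different batches have different edges inside \<open>D\<close>, and edges inside
  \<open>D\<close> are pairs of its vertices.\<close>

lemma card_touching_le:
  assumes "finite D" and "\<And>B. B \<in> \<T> \<Longrightarrow> B \<in> P \<and> (\<exists>e\<in>B. e \<subseteq> D)"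
  shows "card \<T> \<le> card D ^ 2"
proof -
  have "\<T> \<subseteq> batch ` {e \<in> E. e \<subseteq> D}"
  proof
    fix B assume "B \<in> \<T>"
    then obtain e where "B \<in> P" "e \<in> B" "e \<subseteq> D" using assms(2) by blast
    then show "B \<in> batch ` {e \<in> E. e \<subseteq> D}"
      using batch_eq[of B e] batch_subset[of B] by (intro image_eqI[of _ _ e]) auto
  qed
  then have "card \<T> \<le> card {e \<in> E. e \<subseteq> D}"
    by (intro surj_card_le card_edges_inside(1) assms(1))
  then show ?thesis using card_edges_inside(2)[OF assms(1)] by simp
qed

end

text \<open>A single outcome, treated deterministically: \<open>X\<close> stands for the rounded
  start times, \<open>ts\<close> for the timestamps chosen by the adversary.\<close>

locale timed_batches = batched_graph +
  fixes ts :: "edge \<Rightarrow> int" and X :: "edge set \<Rightarrow> int" and H W T :: int and l :: nat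
  assumes W: "0 \<le> W" and H: "0 \<le> H" and T: "T = int l * H"
    and X_le: "\<And>B e. B \<in> P \<Longrightarrow> e \<in> B \<Longrightarrow> X B \<le> ts e"
    and ts_le: "\<And>B e. B \<in> P \<Longrightarrow> e \<in> B \<Longrightarrow> ts e \<le> X B + W"
begin

definition tokens :: "token set" where "tokens = (\<lambda>e. (e, ts e)) ` E"

lemma fst_tokens: "fst ` tokens = E"
  by (simp add: tokens_def image_image)

lemma tokensD: "z \<in> tokens \<Longrightarrow> fst z \<in> E \<and> snd z = ts (fst z)"
  by (auto simp: tokens_def)

lemma slot_le_T: "i < l \<Longrightarrow> (int i + 1) * H \<le> T"
  unfolding T using H by (intro mult_right_mono) auto

text \<open>\<open>Y\<close> consists of the early batches at the reached component that are not growth batches.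
  The reached component need not be determined by \<open>Y\<close> if some early batch happens to fall
  into a growth window; in that case the chain is cut at the first such coincidence.\<close>

lemma false_positive:
  fixes x :: int
  assumes v: "v < n" and k: "k \<le> l"
  defines "K \<equiv> kept H W T v k tokens x"
  assumes acc: "accepted H W T l v k K" and wrong: "found H W v k K \<noteq> component E v"
  shows "\<exists>i\<le>k. \<exists>Y. valid l v i Y \<and> Y \<noteq> {} \<and>
    (\<forall>a<i. int a * H \<le> X (chain v Y i ! a) \<and> X (chain v Y i ! a) < (int a + 1) * H) \<and>
    (\<forall>B\<in>Y. X B < T) \<and>
    (i = k \<or> (\<exists>B\<in>Y. \<exists>a<i. \<bar>X B - X (chain v Y i ! a)\<bar> \<le> 3 * W))"
proof -
  have Ksub: "K \<subseteq> tokens" unfolding K_def by (rule kept_subset)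
  have growK: "grow H W v K i = grow H W v tokens i" if "i \<le> k" for i
    unfolding K_def using that by (intro grow_sandwich[OF W grow_subset_kept kept_subset])
  define G where "G i = grow H W v tokens i" for i
  define D where "D i = reach H W v tokens i" for i
  have D_G: "D i = component_vertices (fst ` G i) v" for i by (simp add: D_def G_def reach_def)
  have reachK: "reach H W v K i = D i" if "i \<le> k" for i
    using growK[OF that] by (simp add: D_def reach_def)
  have G_tok: "G i \<subseteq> tokens" for i unfolding G_def by (rule grow_subset)
  have G_mono: "G i \<subseteq> G j" if "i \<le> j" for i j unfolding G_def using that by (rule grow_mono)
  have D_mono: "D i \<subseteq> D j" if "i \<le> j" for i j unfolding D_def using that by (rule reach_mono)
  have GE: "fst ` G i \<subseteq> E" for i using G_tok fst_tokens by blast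
  have G_all: "fst ` G i \<subseteq> all_edges n" for i using GE E by blast
  have D_less: "D i \<subseteq> {..<n}" for i unfolding D_G using G_all v by (rule component_vertices_less)
  have finD: "finite (D i)" for i using D_less by (rule finite_subset) simp
  have D_closed: "e \<subseteq> D i" if "e \<in> fst ` G i" "e \<inter> D i \<noteq> {}" for e i
    using component_vertices_closed[OF G_all] that unfolding D_G by blast
  have G_K: "G k \<subseteq> K" unfolding G_def K_def by (rule grow_subset_kept)
  have G_time: "ts e < int i * H" if "e \<in> fst ` G i" for e i
  proof -
    obtain z where "z \<in> G i" "fst z = e" using \<open>e \<in> fst ` G i\<close> by blast
    then show ?thesis using grow_time[of z H W v tokens i] H G_tok[of i] tokensD[of z] unfolding G_def by auto
  qed
  have Dk: "reach H W v K k = D k" by (simp add: reachK)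
  have cardD: "card (D k) \<le> l" using acc by (simp add: accepted_def Dk)
  have late: "e \<in> fst ` K \<and> e \<subseteq> D k" if e: "e \<in> E" "T \<le> ts e" "e \<inter> D k \<noteq> {}" for e
  proof -
    have "(e, ts e) \<in> K" using e by (auto simp: K_def kept_def tokens_def D_def)
    moreover have "\<forall>z\<in>K. T \<le> snd z \<and> fst z \<inter> D k \<noteq> {} \<longrightarrow> fst z \<subseteq> D k"
      using acc unfolding accepted_def Dk by (elim conjE)
    ultimately have "e \<subseteq> D k" using e by fastforce
    then show ?thesis using \<open>(e, ts e) \<in> K\<close> by (intro conjI image_eqI[of _ _ "(e, ts e)"]) simp_all
  qed
  have frontK: "front H W v K i = front H W v tokens i" if "i < k" for i
    using front_subset_grow[OF W that, of H v tokens] G_K Ksub that reachK[of i]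
    unfolding front_def G_def D_def by auto
  define A where "A i = front H W v tokens i" for i
  have diam: "\<bar>snd z - snd z'\<bar> \<le> W" if "i < k" "z \<in> A i" "z' \<in> A i" for i z z'
    using acc that frontK unfolding accepted_def A_def by blast
  have canonical: "\<exists>z0\<in>A i. \<forall>z\<in>K. fst z \<subseteq> D k \<and> leaves (D i) (fst z) \<longrightarrow>
          set_encode (fst z0) \<le> set_encode (fst z)" if "i < k" for i
  proof -
    have "\<exists>z0\<in>front H W v K i. \<forall>z\<in>K. fst z \<subseteq> reach H W v K k \<and> leaves (reach H W v K i) (fst z) \<longrightarrow>
          set_encode (fst z0) \<le> set_encode (fst z)"
      using acc that unfolding accepted_def by blast
    then show ?thesis unfolding Dk frontK[OF that] reachK[OF less_imp_le[OF that]] A_def .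
  qed
  have "\<exists>z0. i < k \<longrightarrow> z0 \<in> A i \<and> (\<forall>z\<in>K. fst z \<subseteq> D k \<and> leaves (D i) (fst z) \<longrightarrow>
          set_encode (fst z0) \<le> set_encode (fst z))" for i
    using canonical[of i] by blast
  then obtain g where g: "\<And>i. i < k \<Longrightarrow> g i \<in> A i"
    "\<And>i z. i < k \<Longrightarrow> z \<in> K \<Longrightarrow> fst z \<subseteq> D k \<Longrightarrow> leaves (D i) (fst z) \<Longrightarrow>
          set_encode (fst (g i)) \<le> set_encode (fst z)"
    by metis
  \<comment> \<open>\<open>f i\<close> is the front edge of slot \<open>i\<close> that passed the
    canonicity test, and its batch \<open>Bt i\<close> is the growth batch of the slot.\<close>
  define f where "f i = fst (g i)" for i
  define Bt where "Bt i = batch (f i)" for i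
  have A_tok: "A i \<subseteq> tokens" for i by (auto simp: A_def front_def)
  have f: "f i \<in> E" "snd (g i) = ts (f i)" "leaves (D i) (f i)" "in_slot H W i (ts (f i))" if "i < k" for i
    using g(1)[OF that] A_tok tokensD[of "g i"] by (auto simp: f_def A_def front_def D_def)
  have Bt: "Bt i \<in> P" "f i \<in> Bt i" if "i < k" for i
    using batch[OF f(1)[OF that]] by (auto simp: Bt_def)
  have Bt_slot: "int i * H \<le> X (Bt i)" "X (Bt i) < (int i + 1) * H" if "i < k" for i
    using X_le[OF Bt[OF that]] ts_le[OF Bt[OF that]] f(4)[OF that] W by (auto simp: in_slot_def)
  have Bt_G: "Bt i \<subseteq> fst ` G (Suc i)" if "i < k" for i
  proof
    fix e assume e: "e \<in> Bt i"
    have "e \<in> E" using e Bt(1)[OF that] batch_subset by blast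
    moreover have "\<bar>ts e - ts (f i)\<bar> \<le> W"
      using X_le[OF Bt(1)[OF that] e] ts_le[OF Bt(1)[OF that] e] X_le[OF Bt[OF that]] ts_le[OF Bt[OF that]]
      by linarith
    ultimately have "(e, ts e) \<in> G (Suc i)"
      using g(1)[OF that] f(2)[OF that] unfolding G_def grow_Suc A_def by (force simp: tokens_def)
    then show "e \<in> fst ` G (Suc i)" by force
  qed
  have Bt_G': "Bt a \<subseteq> fst ` G i" if "a < i" "a < k" for a i
    using Bt_G[OF that(2)] G_mono[of "Suc a" i] that(1) by fastforce
  have distinct_Bt: "Bt a \<noteq> Bt b" if "a < b" "b < k" for a b
  proof
    assume "Bt a = Bt b"
    then have "f b \<in> fst ` G b" using Bt(2)[OF that(2)] Bt_G'[of a b] that by auto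
    then have "f b \<subseteq> D b" if "f b \<inter> D b \<noteq> {}" using D_closed that by blast
    then show False using f(3)[OF that(2)] by (auto simp: leaves_def)
  qed
  have inj: "inj_on Bt {..<k}"
    by (intro linorder_inj_onI) (use distinct_Bt in auto)
  \<comment> \<open>\<open>G i\<close> holds everything caught by the windows, \<open>F i\<close>
    only the growth batches. They give the same component as long as no stray edge touches the part
    reached through \<open>F i\<close>, which is what \<open>clean\<close> will say.\<close>
  define F where "F i = (\<Union>a<i. Bt a)" for i
  define Dh where "Dh i = component_vertices (F i) v" for i
  have F_G: "F i \<subseteq> fst ` G i" if "i \<le> k" for i
    using Bt_G'[of _ i] that by (auto simp: F_def)
  have Dh_D: "Dh i \<subseteq> D i" if "i \<le> k" for i
    unfolding Dh_def D_G using F_G[OF that] by (rule component_vertices_mono)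
  define clean where "clean i \<longleftrightarrow> (\<forall>e\<in>fst ` G i. e \<inter> Dh i \<noteq> {} \<longrightarrow> e \<in> F i)" for i
  have clean_D: "D i = Dh i" if "clean i" "i \<le> k" for i
    unfolding D_G Dh_def using F_G[OF that(2)] that(1)
    by (intro component_vertices_eqI) (auto simp: clean_def Dh_def)
  have clean0: "clean 0" by (simp add: clean_def G_def)
  \<comment> \<open>The chain is cut at the first unclean stage; up to there it can be reconstructed
    from \<open>Y\<close> alone.\<close>
  obtain i where i: "i \<le> k" "\<And>j. j < i \<Longrightarrow> clean j" "i = k \<and> clean k \<or> \<not> clean i"
  proof (cases "\<forall>j\<le>k. clean j")
    case True
    then show ?thesis using that[of k] by auto
  next
    case False
    then obtain j0 where j0: "j0 \<le> k" "\<not> clean j0" by blast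
    define i where "i = (LEAST j. \<not> clean j)"
    have "\<not> clean i" unfolding i_def using j0(2) by (rule LeastI)
    moreover have "clean j" if "j < i" for j using that not_less_Least unfolding i_def by blast
    moreover have "i \<le> k" using j0 Least_le[of "\<lambda>j. \<not> clean j" j0] unfolding i_def by simp
    ultimately show ?thesis using that by blast
  qed
  have Dhi: "Dh i \<subseteq> D k" using Dh_D[OF i(1)] D_mono[OF i(1)] by blast
  \<comment> \<open>The growth batches of all \<open>k\<close> slots are excluded, also those after
    the cut: their edges are in the memory, so they do not count as missed.\<close>
  define Y where "Y = {B \<in> touching (Dh i). X B < T \<and> B \<notin> Bt ` {..<k}}"
  have inside: "e \<in> fst ` K \<and> e \<subseteq> D k"
    if e: "e \<in> E" "e \<inter> D k \<noteq> {}" "T \<le> X (batch e) \<or> batch e \<in> Bt ` {..<k}" for e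
    using e(3)
  proof
    assume "T \<le> X (batch e)"
    then show ?thesis using late[OF e(1) _ e(2)] X_le[of "batch e" e] batch[OF e(1)] by simp
  next
    assume "batch e \<in> Bt ` {..<k}"
    then have "e \<in> fst ` G k" using batch[OF e(1)] Bt_G'[of _ k] by auto
    then show ?thesis using D_closed e(2) G_K by blast
  qed
  \<comment> \<open>An edge outside \<open>\<Union>Y\<close> that leaves \<open>D a\<close> belongs
    to a late batch or to a growth batch. Hence it was kept and lies inside \<open>D k\<close>, and
    the acceptance test compared its code with that of \<open>f a\<close>.\<close>
  have pick: "pick Y (D a) = f a" if a: "a < i" for a
  proof (rule pick_eq)
    have ak: "a < k" using a i(1) by simp
    show "f a \<in> E" "leaves (D a) (f a)" using f ak by auto
    show "f a \<notin> \<Union>Y"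
    proof
      assume "f a \<in> \<Union>Y"
      then obtain B where "B \<in> Y" "f a \<in> B" by blast
      then have "B = Bt a" using batch_eq[of B "f a"] by (auto simp: Y_def touching_def Bt_def)
      then show False using \<open>B \<in> Y\<close> ak by (auto simp: Y_def)
    qed
    fix e assume e: "e \<in> E" "e \<notin> \<Union>Y" "leaves (D a) e"
    have "e \<inter> D a \<noteq> {}" using e(3) by (simp add: leaves_def)
    moreover have "D a = Dh a" using clean_D[OF i(2)[OF a]] ak by simp
    moreover have "Dh a \<subseteq> Dh i" unfolding Dh_def F_def
      using a by (intro component_vertices_mono UN_mono) auto
    ultimately have t: "e \<inter> Dh i \<noteq> {}" by blast
    then have "batch e \<in> touching (Dh i)" using batch[OF e(1)] by (auto simp: touching_def)
    moreover have "batch e \<notin> Y" using e(2) batch[OF e(1)] by blast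
    ultimately have "T \<le> X (batch e) \<or> batch e \<in> Bt ` {..<k}"
      unfolding Y_def not_less[symmetric] by blast
    moreover have "e \<inter> D k \<noteq> {}" using t Dhi by blast
    ultimately have "e \<in> fst ` K \<and> e \<subseteq> D k" using inside[OF e(1)] by blast
    then show "set_encode (f a) \<le> set_encode e"
      using g(2)[OF ak] e(3) unfolding f_def by blast
  qed
  have chain: "chain v Y a = map Bt [0..<a]" if "a \<le> i" for a
    using that
  proof (induction a)
    case (Suc a)
    then have IH: "chain v Y a = map Bt [0..<a]" by simp
    have "set (map Bt [0..<a]) = Bt ` {..<a}" by auto
    then have "cdom v Y a = Dh a" unfolding cdom_def IH Dh_def F_def by simp
    also have "\<dots> = D a" using clean_D[OF i(2), of a] Suc.prems i(1) by simp
    finally show ?case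
      unfolding chain_Suc IH using pick[of a] Suc.prems by (simp add: Bt_def)
  qed simp
  have ch: "chain v Y i = map Bt [0..<i]" by (rule chain) simp
  have set_ch: "set (chain v Y i) = Bt ` {..<i}" unfolding ch by auto
  then have cdom: "cdom v Y i = Dh i" unfolding cdom_def Dh_def F_def by simp
  have ch_nth: "chain v Y i ! a = Bt a" if "a < i" for a using that by (simp add: ch)
  have valid: "valid l v i Y"
    unfolding valid_def
  proof (intro conjI)
    show "Y \<subseteq> touching (cdom v Y i)" unfolding cdom by (auto simp: Y_def)
    show "distinct (chain v Y i)" unfolding ch distinct_map
      using inj i(1) by (auto intro: inj_on_subset)
    show "set (chain v Y i) \<subseteq> P" unfolding set_ch using Bt(1) i(1) by auto
    show "set (chain v Y i) \<inter> Y = {}" unfolding set_ch using i(1) by (auto simp: Y_def)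
    have "card (touching (cdom v Y i) - Y) \<le> card (D k) ^ 2"
      unfolding cdom
    proof (rule card_touching_le[OF finD])
      fix B assume B: "B \<in> touching (Dh i) - Y"
      then obtain e where e: "B \<in> P" "e \<in> B" "e \<inter> Dh i \<noteq> {}" by (auto simp: touching_def)
      have "T \<le> X B \<or> B \<in> Bt ` {..<k}" using B unfolding Y_def not_less[symmetric] by blast
      moreover have "e \<in> E" "batch e = B" using e batch_subset batch_eq by auto
      moreover have "e \<inter> D k \<noteq> {}" using e(3) Dhi by blast
      ultimately have "e \<subseteq> D k" using inside by blast
      then show "B \<in> P \<and> (\<exists>e\<in>B. e \<subseteq> D k)" using e by blast
    qed
    also have "\<dots> \<le> l ^ 2" using cardD by (rule power_mono) simp
    finally show "card (touching (cdom v Y i) - Y) \<le> l ^ 2" .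
  qed
  have slot: "\<forall>a<i. int a * H \<le> X (chain v Y i ! a) \<and> X (chain v Y i ! a) < (int a + 1) * H"
    using Bt_slot ch_nth i(1) by simp
  have early: "\<forall>B\<in>Y. X B < T" by (simp add: Y_def)
  from i(3) show ?thesis
  proof
    assume "\<not> clean i"
    then obtain e where e: "e \<in> fst ` G i" "e \<inter> Dh i \<noteq> {}" "e \<notin> F i" by (auto simp: clean_def)
    have eE: "e \<in> E" using e(1) GE by blast
    let ?B = "batch e"
    have B: "?B \<in> P" "e \<in> ?B" using batch[OF eE] by auto
    have early_e: "ts e < int i * H" using G_time[OF e(1)] .
    have "int i * H \<le> T" unfolding T using i(1) k H by (intro mult_right_mono) auto
    then have XB: "X ?B < T" using X_le[OF B] early_e by simp
    \<comment> \<open>The batch of a slot before \<open>i\<close> would put \<open>e\<close> into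
      \<open>F i\<close>; that of a later slot starts at \<open>i * H\<close> or after, too late for
      \<open>e\<close>.\<close>
    have notBt: "?B \<noteq> Bt a" if "a < k" for a
    proof
      assume eq: "?B = Bt a"
      show False
      proof (cases "a < i")
        case True
        then show False using eq B(2) e(3) by (auto simp: F_def)
      next
        case False
        then have "int i * H \<le> int a * H" using H by (intro mult_right_mono) auto
        then show False using Bt_slot(1)[OF that] eq X_le[OF B] early_e by simp
      qed
    qed
    have "?B \<in> Y" using B e(2) XB notBt by (auto simp: Y_def touching_def)
    \<comment> \<open>\<open>e\<close> is within \<open>W\<close> of a front token, which the
      diameter test puts within \<open>W\<close> of \<open>f a\<close>; passing from timestamps to
      start times costs one more \<open>W\<close>.\<close>
    moreover have "\<exists>a<i. \<bar>X ?B - X (Bt a)\<bar> \<le> 3 * W"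
    proof -
      obtain z where z: "z \<in> grow H W v tokens i" "fst z = e" using e(1) unfolding G_def by blast
      have "\<exists>a<j. \<exists>z0\<in>A a. \<bar>snd z - snd z0\<bar> \<le> W" if "z \<in> grow H W v tokens j" for j
        using that
      proof (induction j)
        case (Suc j)
        then show ?case unfolding grow_Suc A_def using less_Suc_eq by blast
      qed simp
      then obtain a z0 where a: "a < i" "z0 \<in> A a" "\<bar>snd z - snd z0\<bar> \<le> W" using z(1) by blast
      have ak: "a < k" using a(1) i(1) by simp
      have "snd z = ts e" using z G_tok[of i] tokensD[of z] unfolding G_def by auto
      moreover have "\<bar>snd z0 - ts (f a)\<bar> \<le> W"
        using diam[OF ak a(2) g(1)[OF ak]] f(2)[OF ak] by simp
      ultimately have "\<bar>X ?B - X (Bt a)\<bar> \<le> 3 * W"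
        using a(3) X_le[OF B] ts_le[OF B] X_le[OF Bt[OF ak]] ts_le[OF Bt[OF ak]] by linarith
      then show ?thesis using a(1) by blast
    qed
    ultimately have "Y \<noteq> {}" "\<exists>B\<in>Y. \<exists>a<i. \<bar>X B - X (chain v Y i ! a)\<bar> \<le> 3 * W"
      using ch_nth by (blast, metis)
    then show ?thesis using i(1) valid slot early by blast
  next
    assume c: "i = k \<and> clean k"
    then have Dhk: "D k = Dh i" using clean_D[of k] by simp
    \<comment> \<open>With nothing missed, no edge leaves \<open>D k\<close> and all edges inside
      were kept, so the answer would be right.\<close>
    have "Y \<noteq> {}"
    proof
      assume "Y = {}"
      have ins: "e \<in> fst ` K \<and> e \<subseteq> D k" if e: "e \<in> E" "e \<inter> D k \<noteq> {}" for e
      proof -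
        have "batch e \<in> touching (Dh i)" using e batch[OF e(1)] Dhk by (auto simp: touching_def)
        then have "T \<le> X (batch e) \<or> batch e \<in> Bt ` {..<k}"
          using \<open>Y = {}\<close> unfolding Y_def not_less[symmetric] by blast
        then show ?thesis using inside[OF e] by blast
      qed
      have "component_vertices E v = D k"
      proof
        show "D k \<subseteq> component_vertices E v" unfolding D_G using GE by (rule component_vertices_mono)
        show "component_vertices E v \<subseteq> D k"
          using ins by (intro component_vertices_subset) (auto simp: D_G)
      qed
      moreover have "{e \<in> fst ` K. e \<subseteq> D k} = {e \<in> E. e \<subseteq> D k}"
      proof -
        have "e \<in> fst ` K" if "e \<in> E" "e \<subseteq> D k" for e
          using ins[OF that(1)] edge_nonempty[OF that(1)] that(2) by (simp add: Int_absorb2)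
        moreover have "fst ` K \<subseteq> E" using Ksub fst_tokens by blast
        ultimately show ?thesis by blast
      qed
      ultimately have "found H W v k K = component E v"
        by (simp add: found_def component_def Dk)
      then show False using wrong by simp
    qed
    then show ?thesis using c valid slot early by blast
  qed
qed

end

subsection \<open>Favourable schedules\<close>

context batched_graph
begin

abbreviation comp :: "nat \<Rightarrow> nat set" where "comp v \<equiv> component_vertices E v"

text \<open>The canonical number of growth steps for \<open>v\<close> when no batch is ignored. The
  analysis credits \<open>v\<close> only with the instances whose \<open>k\<close> has this
  value.\<close>

definition level :: "nat \<Rightarrow> nat" where
  "level v = (LEAST i. cdom v {} i = comp v)"

lemma comp_less: "v < n \<Longrightarrow> comp v \<subseteq> {..<n}"
  using E by (rule component_vertices_less)

lemma finite_comp: "v < n \<Longrightarrow> finite (comp v)"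
  using comp_less by (rule finite_subset) auto

lemma comp_closed: "e \<in> E \<Longrightarrow> e \<inter> comp v \<noteq> {} \<Longrightarrow> e \<subseteq> comp v"
  using component_vertices_closed[OF E] .

lemma card_touching_comp:
  assumes "v < n"
  shows "card (touching (comp v)) \<le> card (comp v) ^ 2"
  using finite_comp[OF assms]
proof (rule card_touching_le)
  fix B assume "B \<in> touching (comp v)"
  then show "B \<in> P \<and> (\<exists>e\<in>B. e \<subseteq> comp v)"
    using comp_closed batch_subset unfolding touching_def by blast
qed

lemma chain_take: "i \<le> k \<Longrightarrow> chain v Y i = take i (chain v Y k)"
  by (induction k) (auto simp: le_Suc_eq)

lemma cdom_mono: "i \<le> k \<Longrightarrow> cdom v Y i \<subseteq> cdom v Y k"
  unfolding cdom_def
  by (intro component_vertices_mono Union_mono) (simp add: chain_take[of i k] set_take_subset)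

lemma pick_grows:
  assumes "cdom v {} i \<subseteq> comp v" "cdom v {} i \<noteq> comp v"
  shows "pick {} (cdom v {} i) \<in> E" "leaves (cdom v {} i) (pick {} (cdom v {} i))"
    "e \<in> E \<Longrightarrow> leaves (cdom v {} i) e \<Longrightarrow> set_encode (pick {} (cdom v {} i)) \<le> set_encode e"
proof -
  let ?D = "cdom v {} i"
  have "\<exists>e\<in>E. leaves ?D e"
  proof (rule ccontr)
    assume none: "\<not> (\<exists>e\<in>E. leaves ?D e)"
    have "comp v \<subseteq> ?D"
    proof (rule component_vertices_subset)
      show "v \<in> ?D" by (simp add: cdom_def)
      show "y \<in> ?D" if "x \<in> ?D" "{x, y} \<in> E" for x y
        using none that by (auto simp: leaves_def)
    qed
    then show False using assms by blast
  qed
  then obtain e0 where e0: "e0 \<in> E" "e0 \<notin> \<Union>{}" "leaves ?D e0" by blast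
  show "pick {} ?D \<in> E" "leaves ?D (pick {} ?D)" using pick[OF e0] by auto
  show "set_encode (pick {} ?D) \<le> set_encode e" if "e \<in> E" "leaves ?D e"
    using pick(4)[of e "{}" ?D] that by simp
qed

lemma chain_grows:
  assumes v: "v < n" and "\<And>j. j < i \<Longrightarrow> cdom v {} j \<noteq> comp v"
  shows "set (chain v {} i) \<subseteq> touching (comp v) \<and> distinct (chain v {} i) \<and>
    cdom v {} i \<subseteq> comp v \<and> i < card (cdom v {} i)"
  using assms(2)
proof (induction i)
  case 0
  have "component_vertices {} v = {v}"
    using component_vertices_subset[of v "{v}" "{}"] by fastforce
  then show ?case by (simp add: cdom_def)
next
  case (Suc i)
  let ?f = "pick {} (cdom v {} i)"
  have IH: "set (chain v {} i) \<subseteq> touching (comp v)" "distinct (chain v {} i)"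
    "cdom v {} i \<subseteq> comp v" "i < card (cdom v {} i)"
    using Suc by auto
  have f: "?f \<in> E" "leaves (cdom v {} i) ?f" using pick_grows[OF IH(3)] Suc.prems[of i] by auto
  have B: "batch ?f \<in> P" "?f \<in> batch ?f" using batch[OF f(1)] by auto
  have t: "batch ?f \<in> touching (comp v)"
    using B f(2) IH(3) unfolding touching_def leaves_def by blast
  have sub: "\<Union>(set (chain v {} j)) \<subseteq> all_edges n" if "set (chain v {} j) \<subseteq> touching (comp v)" for j
    using that batch_subset E unfolding touching_def by blast
  have new: "batch ?f \<notin> set (chain v {} i)"
  proof
    assume "batch ?f \<in> set (chain v {} i)"
    then have "?f \<in> \<Union>(set (chain v {} i))" using B(2) by blast
    then have "?f \<subseteq> cdom v {} i"
      using component_vertices_closed[OF sub[OF IH(1)]] f(2) unfolding cdom_def leaves_def by blast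
    then show False using f(2) by (simp add: leaves_def)
  qed
  have ch: "chain v {} (Suc i) = chain v {} i @ [batch ?f]" by (rule chain_Suc)
  have s: "set (chain v {} (Suc i)) \<subseteq> touching (comp v)" unfolding ch using IH(1) t by simp
  have mono: "cdom v {} i \<subseteq> cdom v {} (Suc i)" by (rule cdom_mono) simp
  have "?f \<in> \<Union>(set (chain v {} (Suc i)))" unfolding ch using B(2) by simp
  moreover have "?f \<inter> cdom v {} (Suc i) \<noteq> {}" using f(2) mono unfolding leaves_def by blast
  ultimately have "?f \<subseteq> cdom v {} (Suc i)"
    using component_vertices_closed[OF sub[OF s]] unfolding cdom_def by blast
  then have ps: "cdom v {} i \<subset> cdom v {} (Suc i)" using mono f(2) unfolding leaves_def by blast
  have "\<Union>(set (chain v {} (Suc i))) \<subseteq> E"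
    using s batch_subset unfolding touching_def by blast
  then have c: "cdom v {} (Suc i) \<subseteq> comp v" unfolding cdom_def by (rule component_vertices_mono)
  then have "finite (cdom v {} (Suc i))" using finite_comp[OF v] by (rule finite_subset)
  then have "card (cdom v {} i) < card (cdom v {} (Suc i))" using ps by (intro psubset_card_mono)
  then show ?case using s c IH(2,4) new ch by auto
qed

lemma level_properties:
  assumes v: "v < n"
  shows "cdom v {} (level v) = comp v" "j < level v \<Longrightarrow> cdom v {} j \<noteq> comp v"
    "level v < card (comp v)" "set (chain v {} (level v)) \<subseteq> touching (comp v)"
    "distinct (chain v {} (level v))" "j \<le> level v \<Longrightarrow> cdom v {} j \<subseteq> comp v"
proof -
  have "\<exists>i. cdom v {} i = comp v"
  proof (rule ccontr)
    assume "\<not> ?thesis"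
    then have "cdom v {} (card (comp v)) \<subseteq> comp v" "card (comp v) < card (cdom v {} (card (comp v)))"
      using chain_grows[OF v, of "card (comp v)"] by auto
    then show False
      using card_mono[OF finite_comp[OF v], of "cdom v {} (card (comp v))"] by linarith
  qed
  then show 1: "cdom v {} (level v) = comp v" unfolding level_def by (rule LeastI_ex)
  have 2: "cdom v {} j \<noteq> comp v" if "j < level v" for j
    using that unfolding level_def by (rule not_less_Least)
  then show "j < level v \<Longrightarrow> cdom v {} j \<noteq> comp v" .
  show "set (chain v {} (level v)) \<subseteq> touching (comp v)" "distinct (chain v {} (level v))"
    "level v < card (comp v)"
    using chain_grows[OF v 2, of "level v"] 1 by auto
  show "j \<le> level v \<Longrightarrow> cdom v {} j \<subseteq> comp v"
    using cdom_mono[of j "level v" v "{}"] 1 by simp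
qed

end

context timed_batches
begin

text \<open>The upper margin is \<open>2 * W\<close>, as a batch spreads over \<open>W\<close> after
  its start and all its tokens must satisfy \<open>in_slot\<close>.\<close>

definition on_schedule :: "nat \<Rightarrow> bool" where
  "on_schedule v \<longleftrightarrow> (\<forall>a<level v. int a * H + W \<le> X (chain v {} (level v) ! a) \<and>
      X (chain v {} (level v) ! a) < (int a + 1) * H - 2 * W) \<and>
    (\<forall>B\<in>touching (comp v) - set (chain v {} (level v)). T \<le> X B)"

text \<open>On schedule, an edge at the component of \<open>v\<close> that arrives before the end of
  slot \<open>i\<close> belongs to a growth batch of slot at most \<open>i\<close>, because all
  other touching batches come after \<open>T\<close>. Foreign batches may enter the windows, but
  they do not touch the component.\<close>

lemma on_schedule_grow:
  assumes v: "v < n" and lv: "level v \<le> l" and os: "on_schedule v" and i: "i \<le> level v"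
  shows "reach H W v tokens i = cdom v {} i"
    and "i < level v \<Longrightarrow> front H W v tokens i \<subseteq> (\<lambda>e. (e, ts e)) ` (chain v {} (level v) ! i)"
    and "i < level v \<Longrightarrow> (pick {} (cdom v {} i), ts (pick {} (cdom v {} i))) \<in> front H W v tokens i"
    and "\<Union>(set (chain v {} i)) \<subseteq> fst ` grow H W v tokens i"
proof -
  let ?k = "level v"
  define Bt where "Bt a = chain v {} ?k ! a" for a
  note lev = level_properties[OF v]
  have ch: "chain v {} i = map Bt [0..<i]" if "i \<le> ?k" for i
    using that by (intro nth_equalityI) (simp_all add: Bt_def chain_take[of i ?k])
  have set_ch: "set (chain v {} i) = Bt ` {..<i}" if "i \<le> ?k" for i
    unfolding ch[OF that] by auto
  have Bt_P: "Bt a \<in> P" if "a < ?k" for a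
    using lev(4) set_ch[of ?k] that unfolding touching_def by auto
  have Bt_X: "int a * H + W \<le> X (Bt a)" "X (Bt a) < (int a + 1) * H - 2 * W" if "a < ?k" for a
    using os that unfolding on_schedule_def Bt_def by auto
  have pickB: "batch (pick {} (cdom v {} a)) = Bt a" "pick {} (cdom v {} a) \<in> Bt a"
    "pick {} (cdom v {} a) \<in> E" "leaves (cdom v {} a) (pick {} (cdom v {} a))" if "a < ?k" for a
  proof -
    have "chain v {} (Suc a) ! a = Bt a" using that ch[of "Suc a"] by (simp del: upt_Suc)
    then show 1: "batch (pick {} (cdom v {} a)) = Bt a" by (simp add: cdom_def nth_append)
    show 2: "pick {} (cdom v {} a) \<in> E" "leaves (cdom v {} a) (pick {} (cdom v {} a))"
      using pick_grows[OF lev(6) lev(2)] that by auto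
    show "pick {} (cdom v {} a) \<in> Bt a" using batch[OF 2(1)] 1 by simp
  qed
  have ts_Bt: "int a * H + W \<le> ts e" "ts e < (int a + 1) * H - W" if "a < ?k" "e \<in> Bt a" for a e
    using Bt_X[OF that(1)] X_le[OF Bt_P that(2)] ts_le[OF Bt_P that(2)] that(1) by auto
  have early: "\<exists>a\<le>i. a < ?k \<and> e \<in> Bt a"
    if e: "e \<in> E" "e \<inter> comp v \<noteq> {}" "ts e < (int i + 1) * H" "i < ?k" for e i
  proof -
    have B: "batch e \<in> P" "e \<in> batch e" using batch[OF e(1)] by auto
    then have t: "batch e \<in> touching (comp v)" using e(2) by (auto simp: touching_def)
    have "(int i + 1) * H \<le> T" using e(4) lv by (intro slot_le_T) simp
    then have "X (batch e) < T" using e(3) X_le[OF B] by simp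
    then have "batch e \<in> Bt ` {..<?k}"
      using t os set_ch[OF order_refl] unfolding on_schedule_def not_le[symmetric] by blast
    then obtain a where a: "a < ?k" "e \<in> Bt a" using B by auto
    have "\<not> i < a"
    proof
      assume "i < a"
      then have "(int i + 1) * H \<le> int a * H" using H by (intro mult_right_mono) auto
      then show False using ts_Bt(1)[OF a] e(3) W by simp
    qed
    then show ?thesis using a by (intro exI[of _ a]) simp
  qed
  have front_sub: "front H W v tokens i \<subseteq> (\<lambda>e. (e, ts e)) ` Bt i"
    if i: "i < ?k" "reach H W v tokens i = cdom v {} i" for i
  proof
    fix z assume "z \<in> front H W v tokens i"
    then have z: "fst z \<in> E" "z = (fst z, ts (fst z))" "in_slot H W i (ts (fst z))" "leaves (cdom v {} i) (fst z)"
      using i(2) by (auto simp: front_def tokens_def)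
    have "fst z \<inter> comp v \<noteq> {}" using z(4) lev(6)[of i] i(1) unfolding leaves_def by auto
    then obtain a where a: "a \<le> i" "a < ?k" "fst z \<in> Bt a"
      using early[OF z(1) _ _ i(1)] z(3) W by (auto simp: in_slot_def)
    have "a = i"
    proof (rule ccontr)
      assume "a \<noteq> i"
      then have "(int a + 1) * H \<le> int i * H" using a(1) H by (intro mult_right_mono) auto
      then show False using ts_Bt(2)[OF a(2,3)] z(3) W by (simp add: in_slot_def)
    qed
    then show "z \<in> (\<lambda>e. (e, ts e)) ` Bt i" using z(2) a(3) by (intro image_eqI[of _ _ "fst z"]) auto
  qed
  have pick_front: "(pick {} (cdom v {} i), ts (pick {} (cdom v {} i))) \<in> front H W v tokens i"
    if i: "i < ?k" "reach H W v tokens i = cdom v {} i" for i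
    using pickB[OF i(1)] ts_Bt[OF i(1)] i(2) by (auto simp: front_def tokens_def in_slot_def)
  have main: "reach H W v tokens i = cdom v {} i \<and> \<Union>(set (chain v {} i)) \<subseteq> fst ` grow H W v tokens i"
    if "i \<le> ?k" for i
    using that
  proof (induction i)
    case 0
    then show ?case by (simp add: reach_def cdom_def)
  next
    case (Suc i)
    then have i: "i < ?k" and IH: "reach H W v tokens i = cdom v {} i"
      "\<Union>(set (chain v {} i)) \<subseteq> fst ` grow H W v tokens i" by auto
    have Bi: "Bt i \<subseteq> fst ` grow H W v tokens (Suc i)"
    proof
      fix e assume e: "e \<in> Bt i"
      let ?f = "pick {} (cdom v {} i)"
      have "\<bar>ts e - ts ?f\<bar> \<le> W"
        using X_le[OF Bt_P[OF i] e] ts_le[OF Bt_P[OF i] e] X_le[OF Bt_P[OF i] pickB(2)[OF i]]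
          ts_le[OF Bt_P[OF i] pickB(2)[OF i]] by linarith
      moreover have "e \<in> E" using e Bt_P[OF i] batch_subset by blast
      ultimately have "(e, ts e) \<in> grow H W v tokens (Suc i)"
        using pick_front[OF i IH(1)] unfolding grow_Suc
        by (intro UnI2 CollectI conjI bexI[of _ "(?f, ts ?f)"]) (auto simp: tokens_def)
      then show "e \<in> fst ` grow H W v tokens (Suc i)" by force
    qed
    have sup: "\<Union>(set (chain v {} (Suc i))) \<subseteq> fst ` grow H W v tokens (Suc i)"
    proof -
      have "fst ` grow H W v tokens i \<subseteq> fst ` grow H W v tokens (Suc i)"
        by (intro image_mono grow_mono) simp
      then have "\<Union>(set (chain v {} i)) \<subseteq> fst ` grow H W v tokens (Suc i)" using IH(2) by blast
      then show ?thesis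
        using Bi unfolding set_ch[OF Suc.prems] set_ch[OF less_imp_le[OF i]] lessThan_Suc by simp
    qed
    have "reach H W v tokens (Suc i) = cdom v {} (Suc i)"
      unfolding reach_def cdom_def
    proof (rule component_vertices_eqI[OF sup])
      fix e assume e: "e \<in> fst ` grow H W v tokens (Suc i)"
        "e \<inter> component_vertices (\<Union>(set (chain v {} (Suc i)))) v \<noteq> {}"
      then have "e \<inter> comp v \<noteq> {}" using lev(6)[OF Suc.prems] unfolding cdom_def by blast
      moreover obtain z where z: "z \<in> grow H W v tokens (Suc i)" "fst z = e" using e(1) by blast
      moreover have "ts e < (int i + 1) * H" "e \<in> E"
        using grow_time[OF z(1) H] grow_subset[of H W v tokens "Suc i"] z tokensD[of z]
        by (auto simp: add.commute)
      ultimately obtain a where "a \<le> i" "e \<in> Bt a" using early[OF _ _ _ i] by blast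
      then show "e \<in> \<Union>(set (chain v {} (Suc i)))" unfolding set_ch[OF Suc.prems] by auto
    qed
    then show ?case using sup by blast
  qed
  show "reach H W v tokens i = cdom v {} i" "\<Union>(set (chain v {} i)) \<subseteq> fst ` grow H W v tokens i"
    using main[OF i] by auto
  show "i < level v \<Longrightarrow> front H W v tokens i \<subseteq> (\<lambda>e. (e, ts e)) ` (chain v {} (level v) ! i)"
    using front_sub main[OF i] unfolding Bt_def by blast
  show "i < level v \<Longrightarrow> (pick {} (cdom v {} i), ts (pick {} (cdom v {} i))) \<in> front H W v tokens i"
    using pick_front main[OF i] by blast
qed

text \<open>All edges of the component are retained: those of growth batches through the windows,
  the others because they come after \<open>T\<close>. The canonicity test is passed since
  \<open>pick\<close> is minimal among all edges of the graph.\<close>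

lemma true_positive:
  fixes x :: int
  assumes v: "v < n" and card: "card (comp v) \<le> l" and os: "on_schedule v"
  defines "K \<equiv> kept H W T v (level v) tokens x"
  shows "accepted H W T l v (level v) K" and "found H W v (level v) K = component E v"
proof -
  let ?k = "level v"
  note lev = level_properties[OF v]
  have lv: "?k \<le> l" using lev(3) card by simp
  note og = on_schedule_grow[OF v lv os]
  have Ksub: "K \<subseteq> tokens" unfolding K_def by (rule kept_subset)
  have G_K: "grow H W v tokens ?k \<subseteq> K" unfolding K_def by (rule grow_subset_kept)
  have growK: "grow H W v K i = grow H W v tokens i" if "i \<le> ?k" for i
    unfolding K_def using that by (intro grow_sandwich[OF W grow_subset_kept kept_subset])
  have reachK: "reach H W v K i = cdom v {} i" if "i \<le> ?k" for i
    using growK[OF that] og(1)[OF that] by (simp add: reach_def)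
  have rk: "reach H W v K ?k = comp v" using reachK[of ?k] lev(1) by simp
  have frontK: "front H W v K i = front H W v tokens i" if "i < ?k" for i
    using front_subset_grow[OF W that, of H v tokens] G_K Ksub that reachK[of i] og(1)[of i]
    unfolding front_def by auto
  have KE: "fst z \<in> E" if "z \<in> K" for z using that Ksub tokensD by blast
  show "accepted H W T l v ?k K"
    unfolding accepted_def rk
  proof (intro conjI ballI allI impI)
    show "card (comp v) \<le> l" by (rule card)
    show "fst z \<subseteq> comp v" if "z \<in> K" "T \<le> snd z \<and> fst z \<inter> comp v \<noteq> {}" for z
      using comp_closed[OF KE[OF that(1)]] that(2) by blast
    fix i assume i: "i < ?k"
    have "chain v {} ?k ! i \<in> touching (comp v)"
      using lev(4) nth_mem[of i "chain v {} ?k"] i by auto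
    then have B: "chain v {} ?k ! i \<in> P" by (simp add: touching_def)
    show "\<bar>snd z - snd z'\<bar> \<le> W" if z: "z \<in> front H W v K i" "z' \<in> front H W v K i" for z z'
    proof -
      have "z \<in> (\<lambda>e. (e, ts e)) ` (chain v {} ?k ! i)" "z' \<in> (\<lambda>e. (e, ts e)) ` (chain v {} ?k ! i)"
        using z og(2)[OF less_imp_le[OF i] i] unfolding frontK[OF i] by (auto dest: subsetD)
      then obtain e e' where "e \<in> chain v {} ?k ! i" "z = (e, ts e)" "e' \<in> chain v {} ?k ! i" "z' = (e', ts e')"
        by (elim imageE)
      then show ?thesis using X_le[OF B, of e] ts_le[OF B, of e] X_le[OF B, of e'] ts_le[OF B, of e'] by simp
    qed
    show "\<exists>z0\<in>front H W v K i. \<forall>z\<in>K. fst z \<subseteq> comp v \<and> leaves (reach H W v K i) (fst z) \<longrightarrow>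
        set_encode (fst z0) \<le> set_encode (fst z)"
    proof (intro bexI ballI impI)
      show "(pick {} (cdom v {} i), ts (pick {} (cdom v {} i))) \<in> front H W v K i"
        using og(3)[OF less_imp_le[OF i] i] unfolding frontK[OF i] .
      fix z assume z: "z \<in> K" "fst z \<subseteq> comp v \<and> leaves (reach H W v K i) (fst z)"
      then have "leaves (cdom v {} i) (fst z)" using reachK[of i] i by simp
      then show "set_encode (fst (pick {} (cdom v {} i), ts (pick {} (cdom v {} i)))) \<le> set_encode (fst z)"
        using pick_grows(3)[OF lev(6) lev(2)] i KE[OF z(1)] by simp
    qed
  qed
  have "e \<in> fst ` K" if e: "e \<in> E" "e \<subseteq> comp v" for e
  proof -
    have t: "e \<inter> comp v \<noteq> {}" using e edge_nonempty by blast
    have B: "batch e \<in> touching (comp v)" "e \<in> batch e" "batch e \<in> P"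
      using batch[OF e(1)] t unfolding touching_def by auto
    show ?thesis
    proof (cases "batch e \<in> set (chain v {} ?k)")
      case True
      then show ?thesis using og(4)[OF order_refl] B(2) G_K by blast
    next
      case False
      then have "T \<le> ts e" using B os X_le[OF B(3,2)] unfolding on_schedule_def by force
      then have "(e, ts e) \<in> K"
        using e(1) t og(1)[OF order_refl] lev(1) by (auto simp: K_def kept_def tokens_def)
      then show ?thesis by force
    qed
  qed
  then have "{e \<in> fst ` K. e \<subseteq> comp v} = {e \<in> E. e \<subseteq> comp v}" using KE by blast
  then show "found H W v ?k K = component E v" by (simp add: found_def rk component_def)
qed

text \<open>A front token comes at most \<open>W\<close> after the start of its growth batch, and
  its window extends \<open>W\<close> to both sides, which makes an interval of length
  \<open>3 * W\<close>. There are fewer than \<open>l\<close> of them; one more covers the recent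
  tokens, and the late edges lie inside the component. \<open>grow_initial\<close> gives the bound
  for every prefix.\<close>

lemma kept_card:
  fixes x :: int
  assumes v: "v < n" and card: "card (comp v) \<le> l" and os: "on_schedule v"
    and Z: "Z \<subseteq> tokens" "\<And>z z'. z \<in> Z \<Longrightarrow> z' \<in> tokens - Z \<Longrightarrow> snd z \<le> snd z'"
    and x: "\<And>z. z \<in> Z \<Longrightarrow> snd z \<le> x"
    and win: "\<And>y. card {e \<in> E. y \<le> ts e \<and> ts e \<le> y + 3 * W} \<le> r"
  shows "card (kept H W T v (level v) Z x) \<le> l * r + l ^ 2"
proof -
  let ?k = "level v"
  note lev = level_properties[OF v]
  have lv: "?k \<le> l" "?k < l" using lev(3) card by auto
  note og = on_schedule_grow[OF v lv(1) os]
  define Wd where "Wd y = {e \<in> E. y \<le> ts e \<and> ts e \<le> y + 3 * W}" for y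
  have finWd: "finite (Wd y)" for y using finE unfolding Wd_def by simp
  define Late where "Late = {e \<in> E. e \<subseteq> comp v}"
  have cl: "card Late \<le> l ^ 2"
    using card_edges_inside(2)[OF finite_comp[OF v]] power_mono[OF card, of 2]
    unfolding Late_def by (meson order_trans zero_le)
  define S where "S = (\<Union>a<?k. Wd (X (chain v {} ?k ! a) - W)) \<union> Late \<union> Wd (x - W)"
  have inE: "fst z \<in> E" "z = (fst z, ts (fst z))" if "z \<in> Z" for z
    using that Z(1) by (auto simp: tokens_def)
  have gz: "grow H W v Z ?k \<subseteq> grow H W v tokens ?k" by (rule grow_initial[OF H W Z])
  have gS: "fst z \<in> S" if zg: "z \<in> grow H W v tokens ?k" for z
  proof -
    have "\<exists>a<j. \<exists>z0\<in>front H W v tokens a. \<bar>snd z - snd z0\<bar> \<le> W" if "z \<in> grow H W v tokens j" for j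
      using that
    proof (induction j)
      case (Suc j)
      then show ?case unfolding grow_Suc using less_Suc_eq by blast
    qed simp
    then obtain a z0 where a: "a < ?k" "z0 \<in> front H W v tokens a" "\<bar>snd z - snd z0\<bar> \<le> W"
      using zg by blast
    obtain e0 where e0: "e0 \<in> chain v {} ?k ! a" "z0 = (e0, ts e0)"
      using og(2)[OF less_imp_le[OF a(1)] a(1)] a(2) by blast
    have "chain v {} ?k ! a \<in> touching (comp v)"
      using lev(4) nth_mem[of a "chain v {} ?k"] a(1) by auto
    then have B: "chain v {} ?k ! a \<in> P" by (simp add: touching_def)
    have "z \<in> tokens" using zg grow_subset by blast
    then have "fst z \<in> Wd (X (chain v {} ?k ! a) - W)"
      using a(3) e0(2) X_le[OF B e0(1)] ts_le[OF B e0(1)] tokensD[of z] unfolding Wd_def by auto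
    then show ?thesis using a(1) unfolding S_def by blast
  qed
  have late: "fst z \<in> S" if z: "z \<in> Z" "T \<le> snd z" "fst z \<inter> reach H W v Z ?k \<noteq> {}" for z
  proof -
    have "reach H W v Z ?k \<subseteq> reach H W v tokens ?k"
      unfolding reach_def using gz by (intro component_vertices_mono image_mono)
    then have "fst z \<inter> comp v \<noteq> {}" using z(3) og(1)[OF order_refl] lev(1) by auto
    then show ?thesis using comp_closed inE(1)[OF z(1)] unfolding S_def Late_def by blast
  qed
  have recent: "fst z \<in> S" if z: "z \<in> Z" "x - W \<le> snd z" for z
    using z inE[OF z(1)] x[OF z(1)] W tokensD[of z] Z(1) unfolding S_def Wd_def by auto
  have sub: "kept H W T v ?k Z x \<subseteq> (\<lambda>e. (e, ts e)) ` S"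
  proof
    fix z assume z: "z \<in> kept H W T v ?k Z x"
    then have zZ: "z \<in> Z" using kept_subset by blast
    have "fst z \<in> S" using z gz gS late recent unfolding kept_def by blast
    then show "z \<in> (\<lambda>e. (e, ts e)) ` S" using inE(2)[OF zZ] by blast
  qed
  have finS: "finite S" unfolding S_def Late_def using finWd finE by auto
  have "card (kept H W T v ?k Z x) \<le> card S" using finS sub by (rule surj_card_le)
  also have "\<dots> \<le> card (\<Union>a<?k. Wd (X (chain v {} ?k ! a) - W)) + card Late + card (Wd (x - W))"
    unfolding S_def by (meson add_le_mono1 card_Un_le order_trans)
  also have "card (\<Union>a<?k. Wd (X (chain v {} ?k ! a) - W)) \<le> (\<Sum>a<?k. card (Wd (X (chain v {} ?k ! a) - W)))"
    by (rule card_UN_le) simp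
  also have "\<dots> \<le> (\<Sum>a<?k. r)" using win unfolding Wd_def by (intro sum_mono)
  also have "(\<Sum>a<?k. r) + card Late + card (Wd (x - W)) \<le> ?k * r + l ^ 2 + r"
    using cl win[of "x - W"] unfolding Wd_def by simp
  also have "\<dots> \<le> l * r + l ^ 2"
    using mult_le_mono1[of "Suc ?k" l r] lv(2) by simp
  finally show ?thesis by simp
qed

end

subsection \<open>Probability of wrong acceptances\<close>

lemma prod_two_levels:
  fixes a b :: real
  assumes "finite P" "A \<subseteq> P" "B \<subseteq> P" "A \<inter> B = {}"
  shows "(\<Prod>x\<in>P. if x \<in> A then a else if x \<in> B then b else 1) = a ^ card A * b ^ card B"
proof -
  have "(\<Prod>x\<in>P. if x \<in> A then a else if x \<in> B then b else 1) =
    (\<Prod>x\<in>P. (if x \<in> A then a else 1) * (if x \<in> B then b else 1))"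
    using assms(4) by (intro prod.cong) auto
  also have "\<dots> = (\<Prod>x\<in>P \<inter> A. a) * (\<Prod>x\<in>P \<inter> B. b)"
    by (simp only: prod.distrib prod.inter_restrict[OF assms(1)])
  also have "\<dots> = a ^ card A * b ^ card B"
    using assms(2,3) by (simp add: Int_absorb1)
  finally show ?thesis .
qed

lemma le_floor_mult_iff: "0 < N \<Longrightarrow> a \<le> \<lfloor>x * N\<rfloor> \<longleftrightarrow> of_int a / N \<le> (x::real)"
  by (simp add: le_floor_iff pos_divide_le_eq)

lemma floor_mult_less_iff: "0 < N \<Longrightarrow> \<lfloor>x * N\<rfloor> < a \<longleftrightarrow> (x::real) < of_int a / N"
  by (simp add: floor_less_iff pos_less_divide_eq)

section \<open>Random start times, measured in units of the timestamp precision\<close>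

locale random_batches = batched_graph +
  fixes N :: real and H W :: int and l :: nat
  assumes N: "0 < N" and H: "0 < H" and W: "0 \<le> W" and l: "1 \<le> l" and lH: "real l * of_int H \<le> N"
begin

definition \<sigma> :: real where "\<sigma> = of_int H / N"
definition \<tau> :: real where "\<tau> = real l * \<sigma>"

abbreviation "M \<equiv> start_times P"

sublocale prob_space M by (rule prob_space_start_times)

lemma sg: "0 < \<sigma>" "\<tau> \<le> 1" "\<sigma> \<le> \<tau>" "0 < \<tau>"
proof -
  show 1: "0 < \<sigma>" using N H by (simp add: \<sigma>_def)
  show "\<tau> \<le> 1" using N lH by (simp add: \<tau>_def \<sigma>_def field_simps)
  show 2: "\<sigma> \<le> \<tau>" using 1 l by (simp add: \<tau>_def)
  show "0 < \<tau>" using 1 2 by simp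
qed

definition slot :: "nat \<Rightarrow> real set" where "slot a = {real a * \<sigma>..<(real a + 1) * \<sigma>}"

lemma slot_iff: "int a * H \<le> \<lfloor>x * N\<rfloor> \<and> \<lfloor>x * N\<rfloor> < (int a + 1) * H \<longleftrightarrow> x \<in> slot a"
  using N by (simp add: le_floor_mult_iff floor_mult_less_iff slot_def \<sigma>_def)

lemma early_iff: "\<lfloor>x * N\<rfloor> < int l * H \<longleftrightarrow> x < \<tau>"
  using N by (simp add: floor_mult_less_iff \<tau>_def \<sigma>_def)

lemma measure_slot: "a < l \<Longrightarrow> measure unif (slot a) = \<sigma>"
proof -
  assume "a < l"
  then have "(real a + 1) * \<sigma> \<le> \<tau>" unfolding \<tau>_def using sg by (intro mult_right_mono) auto
  then show ?thesis unfolding slot_def using sg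
    by (subst measure_unif_Ico) (auto simp: algebra_simps)
qed

lemma measure_early: "measure unif {0..<\<tau>} = \<tau>"
  using sg by (subst measure_unif_Ico) auto

lemma measure_unif_UNIV: "measure unif UNIV = 1"
  using prob_space.prob_space[OF prob_space_unif] by simp

text \<open>The growth avoiding \<open>Y\<close> only inspects batches touching
  \<open>cdom v Y i\<close>. Any set \<open>R\<close> of ignored batches that agrees with
  \<open>Y\<close> there yields the same growth, which makes \<open>Y\<close> recoverable from
  \<open>R\<close>.\<close>

lemma chain_cong:
  assumes "valid l' v i Y" "R \<subseteq> P" "R \<inter> touching (cdom v Y i) = Y" "a \<le> i"
  shows "chain v R a = chain v Y a"
  using assms(4)
proof (induction a)
  case (Suc a)
  then have IH: "chain v R a = chain v Y a" by simp
  then have cd: "cdom v R a = cdom v Y a" by (simp add: cdom_def)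
  have sub: "cdom v Y a \<subseteq> cdom v Y i" using Suc.prems by (intro cdom_mono) simp
  have YP: "Y \<subseteq> P" using assms(2,3) by blast
  have "e \<in> \<Union>R \<longleftrightarrow> e \<in> \<Union>Y" if e: "e \<in> E" "leaves (cdom v Y a) e" for e
  proof -
    have "batch e \<in> touching (cdom v Y i)"
      using batch[OF e(1)] e(2) sub unfolding touching_def leaves_def by blast
    then have "batch e \<in> R \<longleftrightarrow> batch e \<in> Y" using assms(3) by blast
    moreover have "e \<in> \<Union>R \<longleftrightarrow> batch e \<in> R" if "R \<subseteq> P" for R
      using batch[OF e(1)] batch_eq that by blast
    ultimately show ?thesis using assms(2) YP by blast
  qed
  then have "(\<lambda>e. e \<in> E \<and> e \<notin> \<Union>R \<and> leaves (cdom v Y a) e) =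
      (\<lambda>e. e \<in> E \<and> e \<notin> \<Union>Y \<and> leaves (cdom v Y a) e)" by (intro ext) blast
  then have "pick R (cdom v Y a) = pick Y (cdom v Y a)" unfolding pick_def by simp
  then show ?case unfolding chain_Suc IH cd by simp
qed simp

section \<open>Counting the possible sets of missed batches\<close>

definition valids :: "nat \<Rightarrow> nat \<Rightarrow> edge set set set" where
  "valids v i = {Y. valid l v i Y}"

lemma valid_subset: "Y \<in> valids v i \<Longrightarrow> Y \<subseteq> P"
  unfolding valids_def valid_def touching_def by blast

lemma finite_valids: "finite (valids v i)"
proof (rule finite_subset)
  show "valids v i \<subseteq> Pow P" using valid_subset by blast
qed (use finP in simp)

text \<open>Mark every batch independently with probability \<open>1 / (2 l\<^sup>2)\<close>. The events that \<open>Y\<close> is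
  exactly the set of marked batches among those seen by the exploration avoiding \<open>Y\<close> are
  disjoint for different \<open>Y\<close>, whence a bound on the number of valid \<open>Y\<close> of each size
  that does not depend on the degrees.\<close>

lemma valids_weight:
  defines "p \<equiv> 1 / (2 * real l ^ 2)"
  shows "(\<Sum>Y\<in>valids v i. p ^ card Y) \<le> 2"
proof -
  have l2: "1 \<le> real l ^ 2" using l by (simp add: one_le_power)
  then have p: "0 < p" "p \<le> 1/2" unfolding p_def using l by (auto simp: divide_simps)
  define \<Theta> where "\<Theta> Y = touching (cdom v Y i)" for Y
  \<comment> \<open>The start times merely serve as a source of independent marks: \<open>B\<close>
    is marked if \<open>t B < p\<close>.\<close>
  define I where "I Y B = (if B \<in> Y then {0..<p} else if B \<in> \<Theta> Y - Y then {p..} else UNIV)" for Y B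
  have \<Theta>: "Y \<subseteq> \<Theta> Y" "\<Theta> Y \<subseteq> P" "card (\<Theta> Y - Y) \<le> l ^ 2" if "Y \<in> valids v i" for Y
    using that unfolding valids_def valid_def \<Theta>_def touching_def by auto
  have box: "Pi\<^sub>E P (I Y) \<in> sets M" for Y
    using finP by (intro sets_start_times_PiE) (auto simp: I_def)
  have m: "p ^ card Y / 2 \<le> measure M (Pi\<^sub>E P (I Y))" if Y: "Y \<in> valids v i" for Y
  proof -
    have "measure M (Pi\<^sub>E P (I Y)) = (\<Prod>B\<in>P. measure unif (I Y B))"
      using finP by (intro measure_start_times_PiE) (auto simp: I_def)
    also have "\<dots> = (\<Prod>B\<in>P. if B \<in> Y then p else if B \<in> \<Theta> Y - Y then 1 - p else 1)"
      using p by (intro prod.cong) (auto simp: I_def measure_unif_Ico measure_unif_Ici measure_unif_UNIV simp del: measure_uniform_measure)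
    also have "\<dots> = p ^ card Y * (1 - p) ^ card (\<Theta> Y - Y)"
      using finP \<Theta>[OF Y] by (intro prod_two_levels) auto
    finally have eq: "measure M (Pi\<^sub>E P (I Y)) = p ^ card Y * (1 - p) ^ card (\<Theta> Y - Y)" .
    \<comment> \<open>By the choice of \<open>p\<close>, the at most \<open>l ^ 2\<close> touching
      batches outside \<open>Y\<close> all stay unmarked with probability at least one half.\<close>
    have "1 / 2 = 1 + real (l ^ 2) * (- p)" using l by (simp add: p_def)
    also have "\<dots> \<le> (1 + - p) ^ (l ^ 2)" using p by (intro Bernoulli_inequality) simp
    also have "\<dots> \<le> (1 - p) ^ card (\<Theta> Y - Y)"
      using p power_decreasing[OF \<Theta>(3)[OF Y], of "1 - p"] by simp
    finally show ?thesis unfolding eq using p by (simp add: mult_left_mono field_simps)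
  qed
  have disj: "disjoint_family_on (\<lambda>Y. Pi\<^sub>E P (I Y)) (valids v i)"
    unfolding disjoint_family_on_def
  proof (intro ballI impI equals0I)
    fix Y Y' t assume Y: "Y \<in> valids v i" "Y' \<in> valids v i" "Y \<noteq> Y'" and t: "t \<in> Pi\<^sub>E P (I Y) \<inter> Pi\<^sub>E P (I Y')"
    define R where "R = {B \<in> P. t B \<in> {0..<p}}"
    have R: "R \<inter> \<Theta> Y = Y" if "Y \<in> valids v i" "t \<in> Pi\<^sub>E P (I Y)" for Y
    proof (intro equalityI subsetI)
      fix B assume B: "B \<in> R \<inter> \<Theta> Y"
      then have "t B \<in> I Y B" using that(2) by (auto simp: R_def)
      then show "B \<in> Y" using B by (auto simp: R_def I_def split: if_splits)
    next
      fix B assume B: "B \<in> Y"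
      then have "t B \<in> I Y B" "B \<in> P" "B \<in> \<Theta> Y" using that \<Theta>[OF that(1)] by blast+
      then show "B \<in> R \<inter> \<Theta> Y" using B by (auto simp: R_def I_def)
    qed
    have RP: "R \<subseteq> P" by (auto simp: R_def)
    \<comment> \<open>The right-hand side depends on the marks only, so two valid sets compatible
      with the same \<open>t\<close> coincide.\<close>
    have "Y = R \<inter> touching (cdom v R i)" if "Y \<in> valids v i" "t \<in> Pi\<^sub>E P (I Y)" for Y
    proof -
      have "chain v R i = chain v Y i"
        using chain_cong[OF _ RP R[OF that, unfolded \<Theta>_def] order_refl] that(1) by (simp add: valids_def)
      then show ?thesis using R[OF that] by (simp add: \<Theta>_def cdom_def)
    qed
    then show False using Y t by blast
  qed
  have "(\<Sum>Y\<in>valids v i. p ^ card Y / 2) \<le> (\<Sum>Y\<in>valids v i. measure M (Pi\<^sub>E P (I Y)))"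
    using m by (rule sum_mono)
  also have "\<dots> = measure M (\<Union>Y\<in>valids v i. Pi\<^sub>E P (I Y))"
    using box disj finite_valids by (intro finite_measure_finite_Union[symmetric]) auto
  also have "\<dots> \<le> 1" by (rule prob_le_1)
  finally show ?thesis by (simp add: sum_divide_distrib[symmetric])
qed

text \<open>The conclusion of \<open>false_positive\<close> as a condition on the start times; the
  choices of the adversary have disappeared from it.\<close>

definition false_growth :: "nat \<Rightarrow> nat \<Rightarrow> (edge set \<Rightarrow> real) \<Rightarrow> bool" where
  "false_growth v k t \<longleftrightarrow> (\<exists>i\<le>k. \<exists>Y. valid l v i Y \<and> Y \<noteq> {} \<and>
    (\<forall>a<i. int a * H \<le> \<lfloor>t (chain v Y i ! a) * N\<rfloor> \<and> \<lfloor>t (chain v Y i ! a) * N\<rfloor> < (int a + 1) * H) \<and>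
    (\<forall>B\<in>Y. \<lfloor>t B * N\<rfloor> < int l * H) \<and>
    (i = k \<or> (\<exists>B\<in>Y. \<exists>a<i. \<bar>\<lfloor>t B * N\<rfloor> - \<lfloor>t (chain v Y i ! a) * N\<rfloor>\<bar> \<le> 3 * W)))"

lemma chain_nth:
  assumes "Y \<in> valids v i" "a < i"
  shows "chain v Y i ! a \<in> P" "chain v Y i ! a \<notin> Y"
proof -
  have "chain v Y i ! a \<in> set (chain v Y i)" using assms(2) by simp
  then show "chain v Y i ! a \<in> P" "chain v Y i ! a \<notin> Y"
    using assms(1) unfolding valids_def valid_def by blast+
qed

text \<open>The batches of the chain are distinct and not in \<open>Y\<close>, so hitting
  \<open>k\<close> slots and being early are constraints on different coordinates.\<close>

lemma regular_growth_box:
  assumes Y: "Y \<in> valids v k" and k: "k \<le> l"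
  obtains S where "S \<in> sets M" "measure M S = \<sigma> ^ k * \<tau> ^ card Y"
    "\<And>t. t \<in> P \<rightarrow>\<^sub>E {0..1} \<Longrightarrow> \<forall>a<k. t (chain v Y k ! a) \<in> slot a \<Longrightarrow> \<forall>B\<in>Y. t B < \<tau> \<Longrightarrow> t \<in> S"
proof -
  let ?ch = "chain v Y k"
  have ch: "distinct ?ch" "set ?ch \<subseteq> P" "set ?ch \<inter> Y = {}"
    using Y unfolding valids_def valid_def by auto
  define pos where "pos B = (SOME a. a < k \<and> ?ch ! a = B)" for B
  have pos: "pos B < k \<and> ?ch ! pos B = B" if B: "B \<in> set ?ch" for B
  proof -
    obtain a where "a < k" "?ch ! a = B" using B by (auto simp: in_set_conv_nth)
    then show ?thesis unfolding pos_def by (intro someI[of "\<lambda>a. a < k \<and> ?ch ! a = B" a]) simp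
  qed
  define I where "I B = (if B \<in> set ?ch then slot (pos B) else if B \<in> Y then {0..<\<tau>} else UNIV)" for B
  have I: "I B \<in> sets borel" for B by (simp add: I_def slot_def)
  have "measure M (Pi\<^sub>E P I) = (\<Prod>B\<in>P. measure unif (I B))"
    using finP I by (intro measure_start_times_PiE) auto
  also have "\<dots> = (\<Prod>B\<in>P. if B \<in> set ?ch then \<sigma> else if B \<in> Y then \<tau> else 1)"
  proof (intro prod.cong refl)
    fix B
    show "measure unif (I B) = (if B \<in> set ?ch then \<sigma> else if B \<in> Y then \<tau> else 1)"
    proof (cases "B \<in> set ?ch")
      case True
      then show ?thesis
        using pos[OF True] k measure_slot[of "pos B"] by (simp add: I_def del: measure_uniform_measure)
    next
      case False
      then show ?thesis
        using measure_early measure_unif_UNIV by (simp add: I_def del: measure_uniform_measure)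
    qed
  qed
  also have "\<dots> = \<sigma> ^ k * \<tau> ^ card Y"
    using finP ch valid_subset[OF Y] distinct_card[OF ch(1)] by (subst prod_two_levels) auto
  finally have m: "measure M (Pi\<^sub>E P I) = \<sigma> ^ k * \<tau> ^ card Y" .
  show ?thesis
  proof (rule that[of "Pi\<^sub>E P I"])
    show "Pi\<^sub>E P I \<in> sets M" using finP I by (intro sets_start_times_PiE) auto
    fix t assume t: "t \<in> P \<rightarrow>\<^sub>E {0..1}" "\<forall>a<k. t (?ch ! a) \<in> slot a" "\<forall>B\<in>Y. t B < \<tau>"
    show "t \<in> Pi\<^sub>E P I"
    proof (rule PiE_I)
      fix B assume B: "B \<in> P"
      show "t B \<in> I B"
      proof (cases "B \<in> set ?ch")
        case True
        then show ?thesis using t(2) pos[OF True] by (auto simp: I_def)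
      next
        case False
        then show ?thesis using t(1,3) B by (auto simp: I_def PiE_iff)
      qed
    qed (use t(1) in \<open>auto simp: PiE_iff extensional_def\<close>)
  qed (rule m)
qed

text \<open>The position \<open>y\<close> of the growth batch is summed over. For given
  \<open>y\<close> the two coinciding batches cost \<open>1 / N\<close> and
  \<open>(6 * W + 1) / N\<close>; the \<open>l * H\<close> possible values of \<open>y\<close>, a
  fraction \<tau> of \<open>N\<close>, turn \<open>1 / N\<close> into a factor \<tau> that makes up
  for the one of \<open>B0\<close>. The other batches of the chain are not charged, hence no power
  of \<sigma>.\<close>

lemma coincidence_box:
  assumes Y: "Y \<in> valids v i" and i: "i \<le> l" and a: "a < i" and B0: "B0 \<in> Y"
  obtains S where "S \<in> sets M" "measure M S \<le> (6 * of_int W + 1) / N * \<tau> ^ card Y"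
    "\<And>t. t \<in> P \<rightarrow>\<^sub>E {0..1} \<Longrightarrow> t (chain v Y i ! a) \<in> slot a \<Longrightarrow> \<forall>B\<in>Y. t B < \<tau> \<Longrightarrow>
       \<bar>\<lfloor>t B0 * N\<rfloor> - \<lfloor>t (chain v Y i ! a) * N\<rfloor>\<bar> \<le> 3 * W \<Longrightarrow> t \<in> S"
proof -
  let ?A = "chain v Y i ! a"
  note A = chain_nth[OF Y a]
  have YP: "Y \<subseteq> P" using valid_subset[OF Y] .
  have finY: "finite Y" using YP finP by (rule finite_subset)
  define I where "I y B = (if B = ?A then {of_int y / N..<(of_int y + 1) / N}
     else if B = B0 then {of_int (y - 3 * W) / N..<of_int (y + 3 * W + 1) / N}
     else if B \<in> Y then {0..<\<tau>} else UNIV)" for y :: int and B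
  have I: "I y B \<in> sets borel" for y B by (simp add: I_def)
  let ?T = "int l * H"
  have TN: "of_int ?T \<le> N" using lH by simp
  have m: "measure M (Pi\<^sub>E P (I y)) \<le> 1 / N * ((6 * of_int W + 1) / N) * \<tau> ^ (card Y - 1)"
    if y: "y \<in> {0..<?T}" for y
  proof -
    have "real_of_int (y + 1) \<le> of_int ?T" using y by (intro of_int_le_iff[THEN iffD2]) simp
    then have yN: "of_int y + 1 \<le> N" using TN by simp
    have "measure M (Pi\<^sub>E P (I y)) = (\<Prod>B\<in>P. measure unif (I y B))"
      using finP I by (intro measure_start_times_PiE) auto
    also have "\<dots> = measure unif (I y ?A) * (measure unif (I y B0) * (\<Prod>B\<in>P - {?A} - {B0}. measure unif (I y B)))"
      using finP A B0 YP by (subst prod.remove[of P ?A], simp, simp, subst prod.remove[of "P - {?A}" B0]) auto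
    also have "measure unif (I y ?A) = 1 / N"
    proof -
      have "measure unif (I y ?A) = (of_int y + 1) / N - of_int y / N"
        unfolding I_def using yN y N by (simp del: measure_uniform_measure) (intro measure_unif_Ico; simp add: field_simps)
      then show ?thesis by (simp add: diff_divide_distrib[symmetric])
    qed
    also have "(\<Prod>B\<in>P - {?A} - {B0}. measure unif (I y B)) =
        (\<Prod>B\<in>P - {?A} - {B0}. if B \<in> Y - {B0} then \<tau> else if B \<in> {} then 1 else 1)"
      using measure_early measure_unif_UNIV
      by (intro prod.cong) (auto simp: I_def simp del: measure_uniform_measure)
    also have "\<dots> = \<tau> ^ card (Y - {B0}) * 1 ^ card ({} :: edge set set)"
      using finP YP A by (intro prod_two_levels) auto
    also have "\<dots> = \<tau> ^ (card Y - 1)" using B0 finY by (simp add: card_Diff_singleton)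
    also have "measure unif (I y B0) \<le> (6 * of_int W + 1) / N"
    proof -
      have "B0 \<noteq> ?A" using A B0 by auto
      then have "measure unif (I y B0) \<le> of_int (y + 3 * W + 1) / N - of_int (y - 3 * W) / N"
        unfolding I_def using N W
        by (simp del: measure_uniform_measure of_int_add of_int_diff) (intro measure_unif_Ico_le divide_right_mono; simp)
      also have "\<dots> = (6 * of_int W + 1) / N" by (simp add: diff_divide_distrib[symmetric])
      finally show ?thesis .
    qed
    finally show ?thesis using N sg(4) by (simp add: mult_left_mono mult_right_mono divide_right_mono)
  qed
  show ?thesis
  proof (rule that[of "\<Union>y\<in>{0..<?T}. Pi\<^sub>E P (I y)"])
    show "(\<Union>y\<in>{0..<?T}. Pi\<^sub>E P (I y)) \<in> sets M"
      using finP I by (intro sets.finite_UN sets_start_times_PiE) auto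
    have "measure M (\<Union>y\<in>{0..<?T}. Pi\<^sub>E P (I y)) \<le> (\<Sum>y\<in>{0..<?T}. measure M (Pi\<^sub>E P (I y)))"
      using finP I by (intro finite_measure_subadditive_finite) (auto intro!: sets_start_times_PiE)
    also have "\<dots> \<le> (\<Sum>y\<in>{0..<?T}. 1 / N * ((6 * of_int W + 1) / N) * \<tau> ^ (card Y - 1))"
      using m by (rule sum_mono)
    also have "\<dots> = (6 * of_int W + 1) / N * (\<tau> * \<tau> ^ (card Y - 1))"
      using H by (simp add: \<tau>_def \<sigma>_def)
    also have "\<tau> * \<tau> ^ (card Y - 1) = \<tau> ^ card Y"
      using B0 finY by (metis card_Suc_Diff1 card_Diff_singleton power_Suc)
    finally show "measure M (\<Union>y\<in>{0..<?T}. Pi\<^sub>E P (I y)) \<le> (6 * of_int W + 1) / N * \<tau> ^ card Y" .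
    fix t assume t: "t \<in> P \<rightarrow>\<^sub>E {0..1}" "t ?A \<in> slot a" "\<forall>B\<in>Y. t B < \<tau>"
      "\<bar>\<lfloor>t B0 * N\<rfloor> - \<lfloor>t ?A * N\<rfloor>\<bar> \<le> 3 * W"
    define y where "y = \<lfloor>t ?A * N\<rfloor>"
    have y: "int a * H \<le> y" "y < (int a + 1) * H" using t(2) slot_iff[of a "t ?A"] by (auto simp: y_def)
    have "(int a + 1) * H \<le> ?T" using a i H by (intro mult_right_mono) auto
    moreover have "0 \<le> int a * H" using H by simp
    ultimately have yT: "y \<in> {0..<?T}" using y by auto
    have "t \<in> Pi\<^sub>E P (I y)"
    proof (rule PiE_I)
      fix B assume B: "B \<in> P"
      have "t ?A \<in> {of_int y / N..<(of_int y + 1) / N}"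
        using le_floor_mult_iff[OF N, of y "t ?A"] floor_mult_less_iff[OF N, of "t ?A" "y + 1"] by (simp add: y_def)
      moreover have "t B0 \<in> {of_int (y - 3 * W) / N..<of_int (y + 3 * W + 1) / N}"
        using le_floor_mult_iff[OF N, of "y - 3 * W" "t B0"]
          floor_mult_less_iff[OF N, of "t B0" "y + 3 * W + 1"] t(4) unfolding y_def[symmetric] by auto
      moreover have "t B \<in> {0..<\<tau>}" if "B \<in> Y" using t(1,3) B that by (auto simp: PiE_iff)
      ultimately show "t B \<in> I y B" by (auto simp: I_def)
    qed (use t(1) in \<open>auto simp: PiE_iff extensional_def\<close>)
    then show "t \<in> (\<Union>y\<in>{0..<?T}. Pi\<^sub>E P (I y))" using yT by blast
  qed
qed

text \<open>The first term is below the scale \<open>\<sigma> ^ k\<close> of correct acceptances by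
  the factor \<open>4 l^2 \<tau>\<close>. The second comes from chains cut at a coincidence and has
  no power of \<sigma>, which is why \<open>W / N\<close> will have to be below about
  \<open>\<sigma> ^ l\<close>.\<close>

lemma false_growth_bound:
  assumes k: "k < l" and \<tau>: "\<tau> \<le> 1 / (4 * real l ^ 2)"
  obtains S where "S \<in> sets M"
    "measure M S \<le> 4 * real l ^ 2 * \<tau> * \<sigma> ^ k + 2 * real l ^ 2 * ((6 * of_int W + 1) / N)"
    "\<And>t. t \<in> P \<rightarrow>\<^sub>E {0..1} \<Longrightarrow> false_growth v k t \<Longrightarrow> t \<in> S"
proof -
  define p where "p = 1 / (2 * real l ^ 2)"
  let ?u = "(6 * of_int W + 1) / N"
  have l2: "1 \<le> real l ^ 2" using l by (simp add: one_le_power)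
  have p: "0 < p" "\<tau> \<le> p / 2" using \<tau> l2 l by (auto simp: p_def)
  have u: "0 \<le> ?u" using N W by simp
  let ?V = "\<lambda>i. valids v i - {{}}"
  have wt: "(\<Sum>Y\<in>?V i. p ^ card Y) \<le> 2" for i
  proof -
    have "(\<Sum>Y\<in>?V i. p ^ card Y) \<le> (\<Sum>Y\<in>valids v i. p ^ card Y)"
      using p finite_valids by (intro sum_mono2) auto
    then show ?thesis using valids_weight[of v i] unfolding p_def by simp
  qed
  have card_pos: "1 \<le> card Y" if "Y \<in> ?V i" for Y i
    using that valid_subset[of Y v i] finP finite_subset[of Y P] card_gt_0_iff[of Y] by (auto simp: Suc_le_eq)
  have "\<forall>Y. \<exists>S. Y \<in> valids v k \<longrightarrow> S \<in> sets M \<and> measure M S = \<sigma> ^ k * \<tau> ^ card Y \<and>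
    (\<forall>t. t \<in> P \<rightarrow>\<^sub>E {0..1} \<longrightarrow> (\<forall>a<k. t (chain v Y k ! a) \<in> slot a) \<longrightarrow> (\<forall>B\<in>Y. t B < \<tau>) \<longrightarrow> t \<in> S)"
    using regular_growth_box[of _ v k] k by (metis less_imp_le)
  then obtain S1 where S1: "\<And>Y. Y \<in> valids v k \<Longrightarrow> S1 Y \<in> sets M"
    "\<And>Y. Y \<in> valids v k \<Longrightarrow> measure M (S1 Y) = \<sigma> ^ k * \<tau> ^ card Y"
    "\<And>Y t. Y \<in> valids v k \<Longrightarrow> t \<in> P \<rightarrow>\<^sub>E {0..1} \<Longrightarrow> (\<forall>a<k. t (chain v Y k ! a) \<in> slot a) \<Longrightarrow>
       (\<forall>B\<in>Y. t B < \<tau>) \<Longrightarrow> t \<in> S1 Y"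
    by metis
  have "\<exists>S. i \<le> k \<and> Y \<in> valids v i \<and> a < i \<and> B0 \<in> Y \<longrightarrow> S \<in> sets M \<and> measure M S \<le> ?u * \<tau> ^ card Y \<and>
    (\<forall>t. t \<in> P \<rightarrow>\<^sub>E {0..1} \<longrightarrow> t (chain v Y i ! a) \<in> slot a \<longrightarrow> (\<forall>B\<in>Y. t B < \<tau>) \<longrightarrow>
       \<bar>\<lfloor>t B0 * N\<rfloor> - \<lfloor>t (chain v Y i ! a) * N\<rfloor>\<bar> \<le> 3 * W \<longrightarrow> t \<in> S)" for i Y a B0
  proof (cases "i \<le> k \<and> Y \<in> valids v i \<and> a < i \<and> B0 \<in> Y")
    case True
    then have c: "Y \<in> valids v i" "i \<le> l" "a < i" "B0 \<in> Y" using k by auto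
    show ?thesis by (rule coincidence_box[OF c]) blast
  next
    case False
    then show ?thesis by blast
  qed
  then obtain S2 where S2': "\<And>i Y a B0. i \<le> k \<and> Y \<in> valids v i \<and> a < i \<and> B0 \<in> Y \<longrightarrow>
     S2 i Y a B0 \<in> sets M \<and> measure M (S2 i Y a B0) \<le> ?u * \<tau> ^ card Y \<and>
    (\<forall>t. t \<in> P \<rightarrow>\<^sub>E {0..1} \<longrightarrow> t (chain v Y i ! a) \<in> slot a \<longrightarrow> (\<forall>B\<in>Y. t B < \<tau>) \<longrightarrow>
       \<bar>\<lfloor>t B0 * N\<rfloor> - \<lfloor>t (chain v Y i ! a) * N\<rfloor>\<bar> \<le> 3 * W \<longrightarrow> t \<in> S2 i Y a B0)"
    by metis
  define J where "J = (SIGMA i:{..k}. SIGMA Y:?V i. {..<i} \<times> Y)"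
  have finJ: "finite J" unfolding J_def
  proof (intro finite_SigmaI)
    show "finite (?V i)" for i using finite_valids by simp
    show "finite Y" if "Y \<in> ?V i" for i Y
      using that by (intro finite_subset[OF valid_subset[of Y v i] finP]) simp
  qed auto
  define U1 where "U1 = (\<Union>Y\<in>?V k. S1 Y)"
  define g where "g = (\<lambda>(i, Y, a, B). S2 i Y a B)"
  define U2 where "U2 = (\<Union>q\<in>J. g q)"
  have Jd: "i \<le> k" "Y \<in> valids v i" "Y \<noteq> {}" "a < i" "B \<in> Y" if "(i, Y, a, B) \<in> J" for i Y a B
    using that by (auto simp: J_def)
  have U1: "U1 \<in> sets M" unfolding U1_def using S1(1) finite_valids by (intro sets.finite_UN) auto
  have g: "g q \<in> sets M \<and> measure M (g q) \<le> ?u * \<tau> ^ card (fst (snd q))" if q: "q \<in> J" for q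
  proof -
    obtain i Y a B where q': "q = (i, Y, a, B)" by (cases q) auto
    show ?thesis using S2'[of i Y a B] Jd[OF q[unfolded q']] by (simp add: q' g_def)
  qed
  have U2: "U2 \<in> sets M" unfolding U2_def
    using g finJ by (intro sets.finite_UN) auto
  have "measure M U1 \<le> (\<Sum>Y\<in>?V k. measure M (S1 Y))"
    unfolding U1_def using S1(1) finite_valids by (intro finite_measure_subadditive_finite) auto
  also have "\<dots> = (\<Sum>Y\<in>?V k. \<sigma> ^ k * \<tau> ^ card Y)" using S1(2) by (intro sum.cong) auto
  \<comment> \<open>As \<open>Y\<close> is nonempty, one factor \<tau> can be set aside; the others
    are weakened to \<open>p\<close>, and \<open>valids_weight\<close> bounds the remaining sum by
    2.\<close>
  also have "\<dots> \<le> (\<Sum>Y\<in>?V k. \<sigma> ^ k * (\<tau> / p * p ^ card Y))"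
  proof (intro sum_mono mult_left_mono)
    fix Y assume Y: "Y \<in> ?V k"
    obtain j where j: "card Y = Suc j" using card_pos[OF Y] by (cases "card Y") auto
    have "\<tau> ^ j \<le> p ^ j" using p sg by (intro power_mono) auto
    then show "\<tau> ^ card Y \<le> \<tau> / p * p ^ card Y" using p sg by (simp add: j mult_left_mono)
  qed (use sg in auto)
  also have "\<dots> = \<sigma> ^ k * (\<tau> / p) * (\<Sum>Y\<in>?V k. p ^ card Y)" by (simp add: sum_distrib_left mult.assoc)
  also have "\<dots> \<le> \<sigma> ^ k * (\<tau> / p) * 2" using wt sg p by (intro mult_left_mono) auto
  also have "\<dots> = 4 * real l ^ 2 * \<tau> * \<sigma> ^ k" by (simp add: p_def)
  finally have m1: "measure M U1 \<le> 4 * real l ^ 2 * \<tau> * \<sigma> ^ k" .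
  have "measure M U2 \<le> (\<Sum>q\<in>J. measure M (g q))"
    unfolding U2_def using g finJ by (intro finite_measure_subadditive_finite) auto
  also have "\<dots> \<le> (\<Sum>q\<in>J. ?u * \<tau> ^ card (fst (snd q)))"
    using g by (intro sum_mono) auto
  also have "\<dots> = (\<Sum>(i, Y, a, B)\<in>J. ?u * \<tau> ^ card Y)"
    by (intro sum.cong) auto
  also have "\<dots> = (\<Sum>i\<in>{..k}. \<Sum>Y\<in>?V i. \<Sum>(a, B)\<in>{..<i} \<times> Y. ?u * \<tau> ^ card Y)"
  proof -
    have finY: "finite Y" if "Y \<in> ?V i" for i Y
      using that by (intro finite_subset[OF valid_subset[of Y v i] finP]) simp
    have finp: "\<forall>Y\<in>?V i. finite ({..<i} \<times> Y)" for i
      using finY by (intro ballI finite_cartesian_product) auto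
    have finV: "finite (?V i)" for i using finite_valids by simp
    have finS: "\<forall>i\<in>{..k}. finite (SIGMA Y:?V i. {..<i} \<times> Y)"
      by (intro ballI finite_SigmaI[OF finV] finp[THEN bspec])
    have "(\<Sum>i\<in>{..k}. \<Sum>Y\<in>?V i. \<Sum>(a, B)\<in>{..<i} \<times> Y. ?u * \<tau> ^ card Y) =
        (\<Sum>i\<in>{..k}. \<Sum>(Y, a, B)\<in>(SIGMA Y:?V i. {..<i} \<times> Y). ?u * \<tau> ^ card Y)"
      by (intro sum.cong refl) (subst sum.Sigma[OF finV finp], simp add: case_prod_unfold)
    also have "\<dots> = (\<Sum>(i, Y, a, B)\<in>J. ?u * \<tau> ^ card Y)"
      unfolding J_def by (subst sum.Sigma[OF finite_atMost finS]) (simp add: case_prod_unfold)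
    finally show ?thesis by (rule sym)
  qed
  also have "\<dots> \<le> (\<Sum>i\<in>{..k}. \<Sum>Y\<in>?V i. real l * ?u * p ^ card Y)"
  proof (intro sum_mono)
    fix i Y assume i: "i \<in> {..k}" and Y: "Y \<in> ?V i"
    \<comment> \<open>The choice of the coinciding batch in \<open>Y\<close> costs
      \<open>card Y\<close>, which is less than \<open>2 ^ card Y\<close> and is paid for by
      \<open>\<tau> \<le> p / 2\<close>.\<close>
    have "real (card Y) * \<tau> ^ card Y \<le> 2 ^ card Y * (p / 2) ^ card Y"
      using p sg of_nat_less_two_power[of "card Y", where ?'a = real] by (intro mult_mono power_mono) auto
    also have "\<dots> = p ^ card Y" by (simp add: power_mult_distrib[symmetric])
    finally have c: "real (card Y) * \<tau> ^ card Y \<le> p ^ card Y" .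
    have "(\<Sum>(a, B)\<in>{..<i} \<times> Y. ?u * \<tau> ^ card Y) = real i * ?u * (real (card Y) * \<tau> ^ card Y)"
      by (simp add: case_prod_unfold card_cartesian_product)
    also have "\<dots> \<le> real l * ?u * p ^ card Y"
      by (intro mult_mono[OF mult_right_mono[OF _ u] c] mult_nonneg_nonneg u) (use i k sg in auto)
    finally show "(\<Sum>(a, B)\<in>{..<i} \<times> Y. ?u * \<tau> ^ card Y) \<le> real l * ?u * p ^ card Y" .
  qed
  also have "\<dots> \<le> (\<Sum>i\<in>{..k}. real l * ?u * 2)"
    unfolding sum_distrib_left[symmetric]
    using wt u by (intro sum_mono mult_left_mono mult_nonneg_nonneg) simp_all
  also have "\<dots> = real (k + 1) * (real l * ?u * 2)" by simp
  also have "\<dots> \<le> real l * (real l * ?u * 2)" by (intro mult_right_mono mult_nonneg_nonneg u) (use k in auto)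
  also have "\<dots> = 2 * real l ^ 2 * ?u" by (simp add: power2_eq_square)
  finally have m2: "measure M U2 \<le> 2 * real l ^ 2 * ?u" .
  show ?thesis
  proof (rule that[of "U1 \<union> U2"])
    show "U1 \<union> U2 \<in> sets M" using U1 U2 by simp
    show "measure M (U1 \<union> U2) \<le> 4 * real l ^ 2 * \<tau> * \<sigma> ^ k + 2 * real l ^ 2 * ?u"
      using measure_Un_le[OF U1 U2] m1 m2 by simp
    fix t assume t: "t \<in> P \<rightarrow>\<^sub>E {0..1}" and fg: "false_growth v k t"
    then obtain i Y where iY: "i \<le> k" "Y \<in> valids v i" "Y \<noteq> {}"
      "\<And>a. a < i \<Longrightarrow> t (chain v Y i ! a) \<in> slot a" "\<forall>B\<in>Y. t B < \<tau>"
      and alt: "i = k \<or> (\<exists>B\<in>Y. \<exists>a<i. \<bar>\<lfloor>t B * N\<rfloor> - \<lfloor>t (chain v Y i ! a) * N\<rfloor>\<bar> \<le> 3 * W)"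
      unfolding false_growth_def slot_iff early_iff valids_def by auto
    show "t \<in> U1 \<union> U2" using alt
    proof
      assume "i = k"
      then have "t \<in> S1 Y" using iY t by (intro S1(3)) auto
      then show ?thesis using iY \<open>i = k\<close> by (auto simp: U1_def)
    next
      assume "\<exists>B\<in>Y. \<exists>a<i. \<bar>\<lfloor>t B * N\<rfloor> - \<lfloor>t (chain v Y i ! a) * N\<rfloor>\<bar> \<le> 3 * W"
      then obtain B a where Ba: "B \<in> Y" "a < i" "\<bar>\<lfloor>t B * N\<rfloor> - \<lfloor>t (chain v Y i ! a) * N\<rfloor>\<bar> \<le> 3 * W" by blast
      have "i \<le> k \<and> Y \<in> valids v i \<and> a < i \<and> B \<in> Y" using iY(1,2) Ba(1,2) by blast
      note S2'[THEN mp, OF this, THEN conjunct2, THEN conjunct2, rule_format]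
      from this[OF t iY(4)[OF Ba(2)] _ Ba(3)] have "t \<in> S2 i Y a B" using iY(5) by simp
      moreover have "(i, Y, a, B) \<in> J" using iY Ba by (auto simp: J_def)
      ultimately have "t \<in> U2" unfolding U2_def g_def by (intro UN_I[of "(i, Y, a, B)"]) auto
      then show ?thesis by blast
    qed
  qed
qed

end

subsection \<open>Concentration over the start times\<close>

text \<open>Second moment method: dependent pairs add at most \<open>d * \<mu>\<close> to the
  variance, and Chebyshev's inequality bounds a deviation by half the mean.\<close>

lemma (in prob_space) weighted_count_lower_tail:
  fixes S :: "'i \<Rightarrow> 'a set" and a :: "'i \<Rightarrow> real"
  assumes V: "finite V" and S: "\<And>v. v \<in> V \<Longrightarrow> S v \<in> events" and a: "\<And>v. v \<in> V \<Longrightarrow> 0 \<le> a v"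
    and indep: "\<And>v v'. v \<in> V \<Longrightarrow> v' \<in> V \<Longrightarrow> \<not> dep v v' \<Longrightarrow> prob (S v \<inter> S v') = prob (S v) * prob (S v')"
    and d: "\<And>v. v \<in> V \<Longrightarrow> (\<Sum>v'\<in>{v' \<in> V. dep v v'}. a v') \<le> d"
    and \<mu>: "\<mu> = (\<Sum>v\<in>V. a v * prob (S v))" "0 < \<mu>"
  shows "prob {x \<in> space M. (\<Sum>v\<in>V. a v * indicator (S v) x) \<le> \<mu> / 2} \<le> 4 * d / \<mu>"
proof -
  define f where "f x = (\<Sum>v\<in>V. a v * indicator (S v) x :: real)" for x
  have meas[measurable]: "f \<in> borel_measurable M"
    unfolding f_def using S by (intro borel_measurable_sum) auto
  have f2: "f x ^ 2 = (\<Sum>v\<in>V. \<Sum>v'\<in>V. a v * a v' * indicator (S v \<inter> S v') x)" for x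
    unfolding f_def power2_eq_square sum_product
    by (intro sum.cong refl) (auto simp: indicator_def)
  have int: "integrable M (\<lambda>x. indicator (S v) x :: real)" if "v \<in> V" for v
    using S[OF that] by (intro integrable_real_indicator) (auto simp: emeasure_eq_measure)
  have int2: "integrable M (\<lambda>x. indicator (S v \<inter> S v') x :: real)" if "v \<in> V" "v' \<in> V" for v v'
    using S that by (intro integrable_real_indicator) (auto simp: emeasure_eq_measure)
  have exp_f: "expectation f = \<mu>"
    unfolding f_def \<mu>(1) using int S by (subst Bochner_Integration.integral_sum) (auto intro!: sum.cong)
  have int_f: "integrable M f" unfolding f_def using int by (intro Bochner_Integration.integrable_sum) auto
  have int_f2: "integrable M (\<lambda>x. f x ^ 2)"
    unfolding f2 using int2 by (intro Bochner_Integration.integrable_sum integrable_mult_right) auto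
  have "expectation (\<lambda>x. f x ^ 2) = (\<Sum>v\<in>V. \<Sum>v'\<in>V. a v * a v' * prob (S v \<inter> S v'))"
    unfolding f2 using int2 S
    by (subst Bochner_Integration.integral_sum | auto intro!: sum.cong Bochner_Integration.integrable_sum)+
  also have "\<dots> \<le> (\<Sum>v\<in>V. \<Sum>v'\<in>V. a v * a v' * (prob (S v) * prob (S v')) +
      (if dep v v' then a v * a v' * prob (S v) else 0))"
  proof (intro sum_mono)
    fix v v' assume v: "v \<in> V" "v' \<in> V"
    show "a v * a v' * prob (S v \<inter> S v') \<le> a v * a v' * (prob (S v) * prob (S v')) +
      (if dep v v' then a v * a v' * prob (S v) else 0)"
    proof (cases "dep v v'")
      case True
      have "prob (S v \<inter> S v') \<le> prob (S v)" using S v by (intro finite_measure_mono) auto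
      then have "a v * a v' * prob (S v \<inter> S v') \<le> a v * a v' * prob (S v)"
        using a v by (intro mult_left_mono) auto
      then show ?thesis using True a v by (simp add: add_increasing)
    qed (use indep v in simp)
  qed
  also have "\<dots> = (\<Sum>v\<in>V. \<Sum>v'\<in>V. (a v * prob (S v)) * (a v' * prob (S v'))) +
      (\<Sum>v\<in>V. a v * prob (S v) * (\<Sum>v'\<in>{v' \<in> V. dep v v'}. a v'))"
  proof -
    have "(\<Sum>v'\<in>V. if dep v v' then a v * a v' * prob (S v) else 0) =
        a v * prob (S v) * (\<Sum>v'\<in>{v' \<in> V. dep v v'}. a v')" for v
      unfolding sum_distrib_left sum.inter_filter[OF V] by (intro sum.cong) auto
    then show ?thesis by (simp add: sum.distrib ac_simps)
  qed
  also have "(\<Sum>v\<in>V. \<Sum>v'\<in>V. (a v * prob (S v)) * (a v' * prob (S v'))) = \<mu> ^ 2"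
    unfolding \<mu>(1) power2_eq_square sum_product ..
  also have "(\<Sum>v\<in>V. a v * prob (S v) * (\<Sum>v'\<in>{v' \<in> V. dep v v'}. a v')) \<le> (\<Sum>v\<in>V. a v * prob (S v) * d)"
    using d a by (intro sum_mono mult_left_mono) auto
  also have "\<dots> = d * \<mu>" unfolding \<mu>(1) by (simp add: sum_distrib_left mult.commute)
  finally have "variance f \<le> d * \<mu>"
    using variance_eq[OF int_f int_f2] by (simp add: exp_f)
  moreover have "prob {x \<in> space M. \<bar>f x - expectation f\<bar> \<ge> \<mu> / 2} \<le> variance f / (\<mu> / 2) ^ 2"
    using \<mu>(2) by (intro Chebyshev_inequality meas int_f2) simp
  moreover have "prob {x \<in> space M. f x \<le> \<mu> / 2} \<le> prob {x \<in> space M. \<bar>f x - expectation f\<bar> \<ge> \<mu> / 2}"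
    unfolding exp_f using \<mu>(2) by (intro finite_measure_mono) (auto simp: abs_real_def field_simps)
  ultimately have "prob {x \<in> space M. f x \<le> \<mu> / 2} \<le> d * \<mu> / (\<mu> / 2) ^ 2"
    using divide_right_mono[of "variance f" "d * \<mu>" "(\<mu> / 2) ^ 2"] by simp
  also have "\<dots> = 4 * d / \<mu>" using \<mu>(2) by (simp add: power2_eq_square)
  finally show ?thesis unfolding f_def .
qed

context random_batches
begin

section \<open>Being on schedule as a product event\<close>

abbreviation "tchain v \<equiv> chain v {} (level v)"

text \<open>These are the constraints of \<open>on_schedule\<close> divided by \<open>N\<close>.
  \<open>SOME\<close> recovers the slot of \<open>B\<close>, which is unique because the chain is
  distinct.\<close>

definition sched_interval :: "nat \<Rightarrow> edge set \<Rightarrow> real set" where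
  "sched_interval v B = (if B \<in> set (tchain v) then
     (let a = (SOME a. a < level v \<and> tchain v ! a = B)
      in {real a * \<sigma> + of_int W / N..<(real a + 1) * \<sigma> - 2 * of_int W / N})
    else if B \<in> touching (comp v) then {\<tau>..} else UNIV)"

definition sched_box :: "nat \<Rightarrow> (edge set \<Rightarrow> real) set" where
  "sched_box v = Pi\<^sub>E P (sched_interval v)"

lemma sched_interval_borel: "sched_interval v B \<in> sets borel"
  by (simp add: sched_interval_def Let_def)

lemma sched_box_sets: "sched_box v \<in> sets M"
  unfolding sched_box_def using finP sched_interval_borel by (intro sets_start_times_PiE)

lemma tchain_index:
  assumes v: "v < n" and a: "a < level v"
  shows "(SOME a'. a' < level v \<and> tchain v ! a' = tchain v ! a) = a"
proof (rule some_equality)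
  show "a < level v \<and> tchain v ! a = tchain v ! a" using a by simp
  fix a' assume "a' < level v \<and> tchain v ! a' = tchain v ! a"
  then show "a' = a"
    using a nth_eq_iff_index_eq[OF level_properties(5)[OF v], of a' a] by simp
qed

lemma sched_interval_chain:
  assumes "v < n" "a < level v"
  shows "sched_interval v (tchain v ! a) = {real a * \<sigma> + of_int W / N..<(real a + 1) * \<sigma> - 2 * of_int W / N}"
proof -
  have "tchain v ! a \<in> set (tchain v)" using assms(2) by simp
  then show ?thesis unfolding sched_interval_def Let_def tchain_index[OF assms] by simp
qed

lemma sched_boxD:
  assumes v: "v < n" and t: "t \<in> sched_box v"
  shows "a < level v \<Longrightarrow> int a * H + W \<le> \<lfloor>t (tchain v ! a) * N\<rfloor> \<and>
      \<lfloor>t (tchain v ! a) * N\<rfloor> < (int a + 1) * H - 2 * W"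
    and "B \<in> touching (comp v) - set (tchain v) \<Longrightarrow> int l * H \<le> \<lfloor>t B * N\<rfloor>"
proof -
  show "int a * H + W \<le> \<lfloor>t (tchain v ! a) * N\<rfloor> \<and>
      \<lfloor>t (tchain v ! a) * N\<rfloor> < (int a + 1) * H - 2 * W" if a: "a < level v"
  proof -
    have "tchain v ! a \<in> touching (comp v)" using level_properties(4)[OF v] a nth_mem[of a "tchain v"] by auto
    then have "tchain v ! a \<in> P" by (simp add: touching_def)
    then have "t (tchain v ! a) \<in> sched_interval v (tchain v ! a)" using t by (auto simp: sched_box_def)
    moreover have "of_int (int a * H + W) / N = real a * \<sigma> + of_int W / N"
      by (simp add: \<sigma>_def add_divide_distrib)
    moreover have "of_int ((int a + 1) * H - 2 * W) / N = (real a + 1) * \<sigma> - 2 * of_int W / N"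
      by (simp add: \<sigma>_def diff_divide_distrib)
    ultimately show ?thesis
      unfolding sched_interval_chain[OF v a] le_floor_mult_iff[OF N] floor_mult_less_iff[OF N] by simp
  qed
  show "int l * H \<le> \<lfloor>t B * N\<rfloor>" if B: "B \<in> touching (comp v) - set (tchain v)"
  proof -
    have "B \<in> P" using B by (simp add: touching_def)
    then have "t B \<in> sched_interval v B" using t by (auto simp: sched_box_def)
    then have "\<tau> \<le> t B" using B by (simp add: sched_interval_def)
    then show ?thesis using early_iff[of "t B"] by linarith
  qed
qed

text \<open>The factor 4 is twice Bernoulli's inequality: once for shrinking fewer than
  \<open>l\<close> slots by \<open>3 * W\<close>, once for keeping at most \<open>l ^ 2\<close>
  other batches late.\<close>

lemma measure_sched_box:
  assumes v: "v < n" and c: "card (comp v) \<le> l" and HW: "6 * real l * of_int W \<le> of_int H"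
    and \<tau>: "real l ^ 2 * \<tau> \<le> 1 / 2"
  shows "\<sigma> ^ level v / 4 \<le> prob (sched_box v)"
proof -
  define s where "s = \<sigma> - 3 * of_int W / N"
  note lev = level_properties[OF v]
  have W3: "3 * real_of_int W \<le> of_int H"
  proof -
    have "3 * real_of_int W \<le> 6 * real l * of_int W" using l W by (intro mult_right_mono) auto
    also note HW
    finally show ?thesis .
  qed
  then have s0: "0 \<le> s" unfolding s_def \<sigma>_def using N by (simp add: diff_divide_distrib[symmetric])
  have Bm: "measure unif (sched_interval v B) =
      (if B \<in> set (tchain v) then s else if B \<in> touching (comp v) - set (tchain v) then 1 - \<tau> else 1)" for B
  proof (cases "B \<in> set (tchain v)")
    case True
    then obtain a where a: "a < level v" "tchain v ! a = B" by (auto simp: in_set_conv_nth)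
    have "real a + 1 \<le> real l" using a(1) lev(3) c by simp
    then have 1: "(real a + 1) * \<sigma> \<le> \<tau>" unfolding \<tau>_def using sg by (intro mult_right_mono) auto
    obtain w where w: "w = of_int W / N" by blast
    have 2: "0 \<le> real a * \<sigma>" "0 \<le> w" using sg W N by (auto simp: w)
    have 3: "s = \<sigma> - 3 * w" by (simp add: s_def w)
    have "0 \<le> real a * \<sigma> + w" "real a * \<sigma> + w \<le> (real a + 1) * \<sigma> - 2 * w"
      "(real a + 1) * \<sigma> - 2 * w \<le> 1"
      using 1 2 3 s0 sg(2) by (auto simp: algebra_simps)
    from measure_unif_Ico[OF this] have "measure unif (sched_interval v B) = s"
      unfolding a(2)[symmetric] sched_interval_chain[OF v a(1)] s_def w
      by (simp add: algebra_simps del: measure_uniform_measure)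
    then show ?thesis using True by simp
  next
    case False
    then show ?thesis using sg measure_unif_Ici[of \<tau>] measure_unif_UNIV
      by (simp add: sched_interval_def del: measure_uniform_measure)
  qed
  have "prob (sched_box v) = (\<Prod>B\<in>P. measure unif (sched_interval v B))"
    unfolding sched_box_def using finP sched_interval_borel by (intro measure_start_times_PiE)
  also have "\<dots> = s ^ card (set (tchain v)) * (1 - \<tau>) ^ card (touching (comp v) - set (tchain v))"
    unfolding Bm using finP lev(4) by (intro prod_two_levels) (auto simp: touching_def)
  also have "card (set (tchain v)) = level v" using distinct_card[OF lev(5)] by simp
  finally have eq: "prob (sched_box v) = s ^ level v * (1 - \<tau>) ^ card (touching (comp v) - set (tchain v))" .
  have r: "3 * of_int W / of_int H \<le> (1::real)" using W3 H by simp
  have "1 / 2 \<le> 1 + real (level v) * (- (3 * of_int W / of_int H))"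
  proof -
    have "real (level v) * (3 * of_int W) \<le> real l * (3 * of_int W)"
      using lev(3) c W by (intro mult_right_mono) auto
    also have "\<dots> \<le> of_int H / 2" using HW by simp
    finally show ?thesis using H by (simp add: field_simps)
  qed
  also have "\<dots> \<le> (1 + - (3 * of_int W / of_int H)) ^ level v" using r by (intro Bernoulli_inequality) simp
  finally have "\<sigma> ^ level v * (1 / 2) \<le> \<sigma> ^ level v * (1 + - (3 * of_int W / of_int H)) ^ level v"
    using sg by (intro mult_left_mono) auto
  also have "\<dots> = (\<sigma> * (1 + - (3 * of_int W / of_int H))) ^ level v" by (rule power_mult_distrib[symmetric])
  also have "\<sigma> * (1 + - (3 * of_int W / of_int H)) = s"
    using N H by (simp add: s_def \<sigma>_def field_simps)
  finally have p1: "\<sigma> ^ level v * (1 / 2) \<le> s ^ level v" .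
  have ct: "card (touching (comp v) - set (tchain v)) \<le> l ^ 2"
  proof -
    have "card (touching (comp v) - set (tchain v)) \<le> card (touching (comp v))"
      using finP by (intro card_mono) (auto simp: touching_def)
    also have "\<dots> \<le> card (comp v) ^ 2" using v by (rule card_touching_comp)
    also have "\<dots> \<le> l ^ 2" using c by (intro power_mono) auto
    finally show ?thesis .
  qed
  have "1 / 2 \<le> 1 + real (l ^ 2) * (- \<tau>)" using \<tau> by simp
  also have "\<dots> \<le> (1 + - \<tau>) ^ (l ^ 2)" using sg by (intro Bernoulli_inequality) simp
  also have "\<dots> \<le> (1 - \<tau>) ^ card (touching (comp v) - set (tchain v))"
    using sg power_decreasing[OF ct, of "1 - \<tau>"] by simp
  finally have p2: "1 / 2 \<le> (1 - \<tau>) ^ card (touching (comp v) - set (tchain v))" .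
  have "\<sigma> ^ level v * (1 / 2) * (1 / 2) \<le> prob (sched_box v)"
    unfolding eq using p1 p2 s0 by (intro mult_mono) auto
  then show ?thesis by simp
qed

lemma sched_box_indep:
  assumes v: "v < n" "v' < n" and disj: "touching (comp v) \<inter> touching (comp v') = {}"
  shows "prob (sched_box v \<inter> sched_box v') = prob (sched_box v) * prob (sched_box v')"
proof -
  have UN: "sched_interval v B = UNIV" if "v < n" "B \<notin> touching (comp v)" for v B
    using that level_properties(4)[OF that(1)] by (auto simp: sched_interval_def)
  have "sched_box v \<inter> sched_box v' = Pi\<^sub>E P (\<lambda>B. sched_interval v B \<inter> sched_interval v' B)"
    by (simp add: sched_box_def PiE_Int)
  then have "prob (sched_box v \<inter> sched_box v') = (\<Prod>B\<in>P. measure unif (sched_interval v B \<inter> sched_interval v' B))"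
    using finP sched_interval_borel by (simp add: measure_start_times_PiE del: measure_uniform_measure)
  also have "\<dots> = (\<Prod>B\<in>P. measure unif (sched_interval v B) * measure unif (sched_interval v' B))"
  proof (intro prod.cong refl)
    fix B
    show "measure unif (sched_interval v B \<inter> sched_interval v' B) =
        measure unif (sched_interval v B) * measure unif (sched_interval v' B)"
    proof (cases "B \<in> touching (comp v)")
      case True
      then have "sched_interval v' B = UNIV" using disj UN[OF v(2)] by blast
      then show ?thesis using measure_unif_UNIV by (simp del: measure_uniform_measure)
    next
      case False
      then have "sched_interval v B = UNIV" using UN[OF v(1)] by blast
      then show ?thesis using measure_unif_UNIV by (simp del: measure_uniform_measure)
    qed
  qed
  also have "\<dots> = prob (sched_box v) * prob (sched_box v')"
    using finP sched_interval_borel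
    by (simp add: sched_box_def measure_start_times_PiE prod.distrib del: measure_uniform_measure)
  finally show ?thesis .
qed

text \<open>At most \<open>l ^ 2\<close> batches touch the component of \<open>v\<close>, each has
  at most \<open>b\<close> edges, and an edge lies in one component, which has at most
  \<open>l\<close> vertices if it is small.\<close>

lemma card_dependent_le:
  assumes b: "\<And>B. B \<in> P \<Longrightarrow> card B \<le> b" and v: "v < n" "card (comp v) \<le> l"
  shows "card {v'. v' < n \<and> card (comp v') \<le> l \<and> touching (comp v) \<inter> touching (comp v') \<noteq> {}} \<le> l ^ 3 * b"
proof -
  define D where "D e = {v'. v' < n \<and> card (comp v') \<le> l \<and> e \<inter> comp v' \<noteq> {}}" for e :: edge
  have cD: "card (D e) \<le> l" if "e \<in> E" for e
  proof (cases "D e = {}")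
    case False
    then obtain u where u: "u < n" "card (comp u) \<le> l" "e \<inter> comp u \<noteq> {}" by (auto simp: D_def)
    then have eu: "e \<subseteq> comp u" using comp_closed[OF that] by blast
    have "D e \<subseteq> comp u"
    proof
      fix v' assume "v' \<in> D e"
      then obtain x where x: "x \<in> e" "x \<in> comp v'" by (auto simp: D_def)
      then have "comp v' = comp x" "comp u = comp x"
        using component_vertices_eq[of x E v'] component_vertices_eq[of x E u] eu by auto
      then show "v' \<in> comp u" using component_vertices_self[of v' E] by simp
    qed
    then have "card (D e) \<le> card (comp u)" using finite_comp[OF u(1)] by (intro card_mono)
    then show ?thesis using u(2) by simp
  qed simp
  have finD: "finite (D e)" for e by (rule finite_subset[of _ "{..<n}"]) (auto simp: D_def)
  have "{v'. v' < n \<and> card (comp v') \<le> l \<and> touching (comp v) \<inter> touching (comp v') \<noteq> {}} \<subseteq>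
      (\<Union>B\<in>touching (comp v). \<Union>e\<in>B. D e)"
    by (fastforce simp: D_def touching_def)
  moreover have finB: "finite B" if "B \<in> touching (comp v)" for B
    using that batch_subset[of B] finE finite_subset unfolding touching_def by blast
  moreover have finT: "finite (touching (comp v))" using finP unfolding touching_def by simp
  ultimately have "card {v'. v' < n \<and> card (comp v') \<le> l \<and> touching (comp v) \<inter> touching (comp v') \<noteq> {}} \<le>
      card (\<Union>B\<in>touching (comp v). \<Union>e\<in>B. D e)"
    using finD by (intro card_mono) auto
  also have "\<dots> \<le> (\<Sum>B\<in>touching (comp v). card (\<Union>e\<in>B. D e))" using finT by (rule card_UN_le)
  also have "\<dots> \<le> (\<Sum>B\<in>touching (comp v). b * l)"
  proof (intro sum_mono)
    fix B assume B: "B \<in> touching (comp v)"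
    have BP: "B \<in> P" using B by (simp add: touching_def)
    have "card (\<Union>e\<in>B. D e) \<le> (\<Sum>e\<in>B. card (D e))" using finB[OF B] by (rule card_UN_le)
    also have "\<dots> \<le> (\<Sum>e\<in>B. l)" using cD batch_subset[OF BP] by (intro sum_mono) auto
    also have "\<dots> \<le> b * l" using b[OF BP] by simp
    finally show "card (\<Union>e\<in>B. D e) \<le> b * l" .
  qed
  also have "\<dots> = card (touching (comp v)) * (b * l)" by simp
  also have "\<dots> \<le> l ^ 2 * (b * l)"
    using order_trans[OF card_touching_comp[OF v(1)] power_mono[OF v(2), of 2]]
    by (intro mult_right_mono) auto
  also have "\<dots> = l ^ 3 * b" by (simp add: power3_eq_cube power2_eq_square)
  finally show ?thesis .
qed

section \<open>The number of edges in a short time window\<close>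

lemma sum_card_batches: "(\<Sum>B\<in>P. card B) = card E"
proof -
  have "card (\<Union>P) = (\<Sum>B\<in>P. card B)"
    using part finE by (intro card_Union_disjoint)
      (auto simp: partition_on_def pairwise_def disjnt_def disjoint_def intro: finite_subset)
  then show ?thesis using part by (simp add: partition_on_def)
qed

text \<open>An arrival window of length \<open>3 * W\<close> catches batches that start in
  \<open>4 * W + 1\<close> consecutive time units. Counting whole batches by their start makes the
  bound independent of the adversary.\<close>

definition load :: "int \<Rightarrow> (edge set \<Rightarrow> real) \<Rightarrow> real" where
  "load z t = (\<Sum>B\<in>P. real (card B) * indicator {of_int z / N..<of_int (z + 4 * W + 1) / N} (t B))"

lemma load_measurable [measurable]: "load z \<in> borel_measurable M"
  unfolding load_def
proof (intro borel_measurable_sum borel_measurable_times borel_measurable_const)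
  fix B assume "B \<in> P"
  then have [measurable]: "(\<lambda>t. t B) \<in> borel_measurable M"
    unfolding start_times_def using measurable_component_singleton[of B P "\<lambda>_. unif"] by simp
  show "(\<lambda>t. indicator {of_int z / N..<of_int (z + 4 * W + 1) / N} (t B) :: real) \<in> borel_measurable M"
    by measurable
qed

text \<open>A Chernoff bound for batches of different sizes: divided by \<open>b\<close> the sizes
  lie in \<open>[0,1]\<close>, where \<open>exp x - 1 \<le> 2 * x\<close>, and their sum is known
  from \<open>card E\<close>.\<close>

lemma load_tail:
  fixes r :: real
  assumes b: "1 \<le> b" "\<And>B. B \<in> P \<Longrightarrow> card B \<le> b"
  shows "prob {t \<in> space M. r \<le> load z t} \<le> exp (2 * ((4 * of_int W + 1) / N) * real (card E) / real b - r / real b)"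
proof -
  define J where "J = {of_int z / N..<of_int (z + 4 * W + 1) / N}"
  let ?u = "(4 * of_int W + 1) / N"
  define c where "c B = real (card B) / real b" for B :: "edge set"
  have c: "0 \<le> c B" "c B \<le> 1" if "B \<in> P" for B using b(2)[OF that] b(1) by (auto simp: c_def)
  interpret U: product_sigma_finite "\<lambda>_. unif"
    by (intro product_sigma_finite.intro prob_space_imp_sigma_finite prob_space_unif)
  interpret U: prob_space unif by (rule prob_space_unif)
  define f where "f B x = 1 + (exp (c B) - 1) * indicator J x" for B and x :: real
  have int: "integrable unif (f B)" for B
    unfolding f_def J_def by (auto intro!: integrable_real_indicator simp: U.emeasure_eq_measure)
  have mJ: "measure unif J \<le> ?u"
  proof -
    have "of_int z / N \<le> of_int (z + 4 * W + 1) / N" using N W by (intro divide_right_mono) auto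
    then have "measure unif J \<le> of_int (z + 4 * W + 1) / N - of_int z / N"
      unfolding J_def by (rule measure_unif_Ico_le)
    then show ?thesis by (simp add: diff_divide_distrib[symmetric] del: measure_uniform_measure)
  qed
  have fB: "(\<integral>x. f B x \<partial>unif) \<le> exp (2 * c B * ?u)" "0 \<le> (\<integral>x. f B x \<partial>unif)" if B: "B \<in> P" for B
  proof -
    have "(\<integral>x. f B x \<partial>unif) = 1 + (exp (c B) - 1) * measure unif J"
      unfolding f_def J_def using U.prob_space
      by (subst Bochner_Integration.integral_add) (auto intro!: integrable_real_indicator simp: U.emeasure_eq_measure simp del: measure_uniform_measure)
    also have "\<dots> \<le> 1 + (2 * c B) * ?u"
    proof -
      have "c B ^ 2 \<le> c B" using c[OF B] by (simp add: power2_eq_square mult_left_le)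
      then have "exp (c B) - 1 \<le> 2 * c B" using exp_bound[OF c[OF B]] by simp
      then show ?thesis using mJ c[OF B] by (intro add_left_mono mult_mono) auto
    qed
    also have "\<dots> \<le> exp (2 * c B * ?u)" by (rule exp_ge_add_one_self)
    finally show "(\<integral>x. f B x \<partial>unif) \<le> exp (2 * c B * ?u)" .
    show "0 \<le> (\<integral>x. f B x \<partial>unif)"
      using c[OF B] by (intro integral_nonneg_AE) (auto simp: f_def)
  qed
  have prod_f: "(\<Prod>B\<in>P. f B (t B)) = exp (load z t / real b)" for t
  proof -
    have "f B x = exp (c B * indicator J x)" for B x by (simp add: f_def indicator_def)
    then have "(\<Prod>B\<in>P. f B (t B)) = exp (\<Sum>B\<in>P. c B * indicator J (t B))"
      by (simp only: exp_sum[OF finP])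
    then show ?thesis by (simp add: load_def c_def J_def sum_divide_distrib)
  qed
  have intg: "integrable M (\<lambda>t. exp (load z t / real b))"
    unfolding prod_f[symmetric] start_times_def using finP int by (rule U.product_integrable_prod)
  have "(\<integral>t. exp (load z t / real b) \<partial>M) = (\<Prod>B\<in>P. \<integral>x. f B x \<partial>unif)"
    unfolding prod_f[symmetric] start_times_def using finP int by (rule U.product_integral_prod)
  also have "\<dots> \<le> (\<Prod>B\<in>P. exp (2 * c B * ?u))" using fB by (intro prod_mono) auto
  also have "\<dots> = exp (\<Sum>B\<in>P. 2 * c B * ?u)" using finP by (simp add: exp_sum)
  also have "(\<Sum>B\<in>P. 2 * c B * ?u) = 2 * ?u * real (card E) / real b"
    unfolding sum_card_batches[symmetric] of_nat_sum c_def
    unfolding sum_distrib_left sum_divide_distrib by (intro sum.cong) (simp_all add: mult_ac)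
  finally have le: "(\<integral>t. exp (load z t / real b) \<partial>M) \<le> exp (2 * ?u * real (card E) / real b)" .
  have "prob {t \<in> space M. r \<le> load z t} = prob {t \<in> space M. exp (r / real b) \<le> exp (load z t / real b)}"
    using b(1) by (simp add: divide_le_cancel)
  also have "\<dots> \<le> (\<integral>t. exp (load z t / real b) \<partial>M) / exp (r / real b)"
    by (rule integral_Markov_inequality_measure[OF intg sets.top]) auto
  also have "\<dots> \<le> exp (2 * ?u * real (card E) / real b) / exp (r / real b)"
    using le by (intro divide_right_mono) auto
  finally show ?thesis by (simp add: exp_diff)
qed

end

subsection \<open>Independent instances\<close>

primrec first_result :: "'r \<Rightarrow> ('s \<Rightarrow> 'r option) \<Rightarrow> 's list \<Rightarrow> 'r" where
  "first_result d h [] = d"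
| "first_result d h (s # ss) = (case h s of None \<Rightarrow> first_result d h ss | Some x \<Rightarrow> x)"

lemma prob_bind_pmf:
  "measure_pmf.prob (bind_pmf p f) A = (\<integral>x. measure_pmf.prob (f x) A \<partial>measure_pmf p)"
proof -
  have "ennreal (measure_pmf.prob (bind_pmf p f) A) = (\<integral>\<^sup>+x. ennreal (measure_pmf.prob (f x) A) \<partial>measure_pmf p)"
    unfolding measure_pmf.emeasure_eq_measure[symmetric] by simp
  also have "\<dots> = ennreal (\<integral>x. measure_pmf.prob (f x) A \<partial>measure_pmf p)"
    by (intro nn_integral_eq_integral measure_pmf.integrable_const_bound[of _ 1]) auto
  finally show ?thesis by (subst (asm) ennreal_inj) auto
qed

text \<open>Wrong results are charged by a union bound over all instances, so that a right one only
  has to occur once.\<close>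

lemma first_result_prob:
  fixes D :: "'s pmf" and h :: "'s \<Rightarrow> 'r option" and A :: "'r set"
  defines "g \<equiv> measure_pmf.prob D {s. h s \<in> Some ` A}"
    and "q \<equiv> measure_pmf.prob D {s. h s \<notin> insert None (Some ` A)}"
  shows "measure_pmf.prob (map_pmf (first_result d h) (replicate_pmf r D)) A \<ge> 1 - real r * q - (1 - g) ^ r"
proof (induction r)
  case (Suc r)
  define F where "F = measure_pmf.prob (map_pmf (first_result d h) (replicate_pmf r D)) A"
  let ?G = "{s. h s \<in> Some ` A}" and ?B = "{s. h s \<notin> insert None (Some ` A)}"
  have q: "0 \<le> q" "g \<le> 1" "0 \<le> g" unfolding q_def g_def by auto
  have F: "F \<le> 1" "0 \<le> F" unfolding F_def by auto
  have "map_pmf (first_result d h) (replicate_pmf (Suc r) D) =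
      bind_pmf D (\<lambda>s. map_pmf (\<lambda>ss. first_result d h (s # ss)) (replicate_pmf r D))"
    by (simp add: map_bind_pmf map_pmf_def bind_assoc_pmf bind_return_pmf)
  also have "\<dots> = bind_pmf D (\<lambda>s. case h s of None \<Rightarrow> map_pmf (first_result d h) (replicate_pmf r D)
      | Some x \<Rightarrow> return_pmf x)"
    by (intro bind_pmf_cong refl) (auto split: option.split simp: map_pmf_const)
  finally have eq: "map_pmf (first_result d h) (replicate_pmf (Suc r) D) = \<dots>" .
  have int: "integrable (measure_pmf D) (\<lambda>s. indicator X s :: real)" for X
    by (intro measure_pmf.integrable_const_bound[of _ 1]) auto
  have "g + F * (1 - g) - q =
      (\<integral>s. indicator ?G s + F * (1 - indicator ?G s) - indicator ?B s \<partial>measure_pmf D)"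
    unfolding g_def q_def using int by (simp add: int)
  also have "\<dots> \<le> (\<integral>s. measure_pmf.prob (case h s of None \<Rightarrow> map_pmf (first_result d h) (replicate_pmf r D)
      | Some x \<Rightarrow> return_pmf x) A \<partial>measure_pmf D)"
  proof (rule integral_mono)
    show "integrable (measure_pmf D) (\<lambda>s. indicator ?G s + F * (1 - indicator ?G s) - indicator ?B s)"
      using int by (intro Bochner_Integration.integrable_diff Bochner_Integration.integrable_add integrable_mult_right) auto
    show "integrable (measure_pmf D) (\<lambda>s. measure_pmf.prob (case h s of None \<Rightarrow>
        map_pmf (first_result d h) (replicate_pmf r D) | Some x \<Rightarrow> return_pmf x) A)"
      by (intro measure_pmf.integrable_const_bound[of _ 1]) auto
    show "indicator ?G s + F * (1 - indicator ?G s) - indicator ?B s \<le> measure_pmf.prob (case h s of None \<Rightarrow>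
        map_pmf (first_result d h) (replicate_pmf r D) | Some x \<Rightarrow> return_pmf x) A" for s
      using F by (auto simp: indicator_def F_def split: option.split)
  qed
  also have "\<dots> = measure_pmf.prob (map_pmf (first_result d h) (replicate_pmf (Suc r) D)) A"
    unfolding eq prob_bind_pmf ..
  finally have step: "g + F * (1 - g) - q \<le> measure_pmf.prob (map_pmf (first_result d h) (replicate_pmf (Suc r) D)) A" .
  have "(1 - real r * q - (1 - g) ^ r) * (1 - g) \<le> F * (1 - g)"
    using Suc.IH q unfolding F_def by (intro mult_right_mono) auto
  moreover have "real r * q * (1 - g) \<le> real r * q" using q by (intro mult_left_le) auto
  ultimately have "1 - real (Suc r) * q - (1 - g) ^ Suc r \<le> g + F * (1 - g) - q"
    by (simp add: algebra_simps)
  then show ?case using step by linarith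
qed simp

text \<open>Rejection sampling: a uniform element \<open>x\<close> is kept with probability
  \<open>q x\<close>, and \<open>None\<close> stands for an idle instance. This realises the weights
  without normalising them.\<close>

lemma subsampled_pmf:
  fixes S :: "'a set" and q :: "'a \<Rightarrow> real"
  assumes S: "finite S" "S \<noteq> {}" and q: "\<And>x. x \<in> S \<Longrightarrow> 0 \<le> q x \<and> q x \<le> 1"
  obtains D where "\<And>x. x \<in> S \<Longrightarrow> pmf D (Some x) = q x / real (card S)"
    "set_pmf D \<subseteq> insert None (Some ` S)"
proof
  define D where "D = bind_pmf (pmf_of_set S)
    (\<lambda>x. map_pmf (\<lambda>b. if b then Some x else None) (bernoulli_pmf (if x \<in> S then q x else 0)))"
  show "set_pmf D \<subseteq> insert None (Some ` S)" using S by (auto simp: D_def set_pmf_of_set)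
  show "pmf D (Some y) = q y / real (card S)" if y: "y \<in> S" for y
  proof -
    have "pmf (map_pmf (\<lambda>b. if b then Some x else None) (bernoulli_pmf (if x \<in> S then q x else 0))) (Some y) =
        (if x = y then q y else 0)" if "x \<in> S" for x
    proof -
      have "(\<lambda>b. if b then Some x else None) -` {Some y} = (if x = y then {True} else {})"
        by (auto split: if_splits)
      then show ?thesis using q[OF that] that by (auto simp: pmf_map measure_pmf_single)
    qed
    then have "(\<Sum>x\<in>S. pmf (map_pmf (\<lambda>b. if b then Some x else None)
        (bernoulli_pmf (if x \<in> S then q x else 0))) (Some y)) = (\<Sum>x\<in>S. if x = y then q y else 0)"
      by (intro sum.cong) auto
    then show ?thesis unfolding D_def using S y by (subst pmf_bind_pmf_of_set) auto
  qed
qed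

text \<open>Bernoulli's inequality together with \<open>(1 - x) ^ r * (1 + x) ^ r \<le> 1\<close>.
  Polynomial decay suffices, as the number of instances may be polynomial in
  \<open>1 / \<delta>\<close>.\<close>

lemma one_minus_power_le:
  fixes x :: real
  assumes "0 < x" "x \<le> 1" "0 < r"
  shows "(1 - x) ^ r \<le> 1 / (real r * x)"
proof -
  have "(1 - x) ^ r * (real r * x) \<le> (1 - x) ^ r * (1 + real r * x)"
    using assms by (intro mult_left_mono) auto
  also have "\<dots> \<le> (1 - x) ^ r * (1 + x) ^ r"
    using assms by (intro mult_left_mono Bernoulli_inequality) auto
  also have "\<dots> = (1 - x ^ 2) ^ r"
    by (simp add: power_mult_distrib[symmetric] algebra_simps power2_eq_square)
  also have "\<dots> \<le> 1" using assms by (intro power_le_one) (auto simp: abs_square_le_1)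
  finally show ?thesis using assms by (simp add: pos_le_divide_eq)
qed

definition instance_step ::
  "int \<Rightarrow> int \<Rightarrow> int \<Rightarrow> token set \<Rightarrow> nat \<Rightarrow> (nat \<times> nat) option \<Rightarrow> token set option \<Rightarrow> token \<Rightarrow> token set option" where
  "instance_step H W T U r s K z =
     (case s of None \<Rightarrow> K | Some (v, k) \<Rightarrow> grow_state H W T U r v k K z)"

definition instance_result ::
  "int \<Rightarrow> int \<Rightarrow> int \<Rightarrow> nat \<Rightarrow> (nat \<times> nat) option \<times> token set option \<Rightarrow> (nat \<times> nat set \<times> edge set) option" where
  "instance_result H W T l = (\<lambda>(s, K). case s of None \<Rightarrow> None | Some (v, k) \<Rightarrow>
     (case K of None \<Rightarrow> None | Some K \<Rightarrow>
        if accepted H W T l v k K then Some (v, found H W v k K) else None))"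

lemma foldl_map_pairs:
  "foldl (\<lambda>L z. map (\<lambda>(s, K). (s, f s K z)) L) (map (\<lambda>s. (s, K0)) ss) xs =
    map (\<lambda>s. (s, foldl (f s) K0 xs)) ss"
  by (induction xs rule: rev_induct) (auto simp: o_def)

lemma first_result_map: "first_result d h (map f ss) = first_result d (\<lambda>s. h (f s)) ss"
  by (induction ss) (auto split: option.split)

text \<open>For a given stream the instances are independent, because the only coins of each are its
  initial pair. Running them side by side is again an automaton, started in a product
  distribution.\<close>

lemma instances_algorithm:
  fixes D :: "(nat \<times> nat) option pmf"
  assumes S: "finite S" "set_pmf D \<subseteq> insert None (Some ` S)" and U: "finite U"
    and s: "((card S + 1) * ((card U + 1) ^ r + 1)) ^ R \<le> 2 ^ s"
  obtains A where "uses_space A (real s)"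
    "\<And>xs. run A xs = map_pmf (first_result d
        (\<lambda>s. instance_result H W T l (s, foldl (instance_step H W T U r s) (Some {}) xs))) (replicate_pmf R D)"
proof -
  let ?Ks = "insert None (Some ` {K. K \<subseteq> U \<and> card K \<le> r})"
  let ?Q = "{L. set L \<subseteq> insert None (Some ` S) \<times> ?Ks \<and> length L = R}"
  let ?st = "\<lambda>L z. map (\<lambda>(s, K). (s, instance_step H W T U r s K z)) L"
  have finK: "finite {K. K \<subseteq> U \<and> card K \<le> r}"
    by (rule finite_subset[of _ "Pow U"]) (auto simp: U)
  have fin: "finite (insert None (Some ` S) \<times> ?Ks)" using finK S by auto
  have a: "card (insert None (Some ` S)) = card S + 1"
    using S by (subst card_insert_disjoint) (auto simp: card_image)
  have b: "card ?Ks \<le> (card U + 1) ^ r + 1"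
    using finK card_bounded_subsets_le[OF U, of r] by (subst card_insert_disjoint) (auto simp: card_image)
  have "card (insert None (Some ` S) \<times> ?Ks) \<le> (card S + 1) * ((card U + 1) ^ r + 1)"
    unfolding card_cartesian_product a using b by (rule mult_le_mono2)
  then have "card (insert None (Some ` S) \<times> ?Ks) ^ R \<le> ((card S + 1) * ((card U + 1) ^ r + 1)) ^ R"
    by (rule power_mono) simp
  then have card: "card ?Q \<le> 2 ^ s" using s by (simp only: card_lists_length_eq[OF fin])
  have finQ: "finite ?Q" using fin by (rule finite_lists_length_eq)
  have step: "?st L z \<in> ?Q" if "L \<in> ?Q" for L z
  proof -
    have "(s, instance_step H W T U r s K z) \<in> insert None (Some ` S) \<times> ?Ks"
      if sK: "(s, K) \<in> insert None (Some ` S) \<times> ?Ks" for s K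
    proof (cases s)
      case None
      then show ?thesis using sK by (auto simp: instance_step_def)
    next
      case (Some vk)
      obtain v k where "vk = (v, k)" by (cases vk)
      moreover have "grow_state H W T U r v k K z \<in> ?Ks"
      proof (cases K)
        case None
        then show ?thesis by (simp add: grow_state_def)
      next
        case (Some K0)
        then have "K0 \<subseteq> U" using sK by auto
        then show ?thesis using kept_subset[of H W T v k "insert z K0" "snd z"]
          unfolding grow_state_def Some Let_def by auto
      qed
      ultimately show ?thesis using sK Some by (simp add: instance_step_def)
    qed
    then have "(case x of (s, K) \<Rightarrow> (s, instance_step H W T U r s K z)) \<in> insert None (Some ` S) \<times> ?Ks"
      if "x \<in> insert None (Some ` S) \<times> ?Ks" for x
      using that by (cases x) simp
    then show ?thesis using that unfolding mem_Collect_eq set_map length_map by blast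
  qed
  have init: "set_pmf (map_pmf (map (\<lambda>s. (s, Some {}))) (replicate_pmf R D)) \<subseteq> ?Q"
    using S(2) unfolding set_map_pmf set_replicate_pmf by (auto simp: lists_eq_set)
  obtain A where A: "uses_space A (real s)"
    "\<And>xs. run A xs = map_pmf (\<lambda>L. first_result d (instance_result H W T l) (foldl ?st L xs))
       (map_pmf (map (\<lambda>s. (s, Some {}))) (replicate_pmf R D))"
    by (rule automaton_streaming[where st = ?st and an = "first_result d (instance_result H W T l)",
          OF finQ card init]) (use step in \<open>blast+\<close>)
  show ?thesis
  proof (rule that[OF A(1)])
    fix xs
    show "run A xs = map_pmf (first_result d
        (\<lambda>s. instance_result H W T l (s, foldl (instance_step H W T U r s) (Some {}) xs))) (replicate_pmf R D)"
      unfolding A(2) map_pmf_comp foldl_map_pairs first_result_map ..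
  qed
qed

section \<open>From a single run to the failure probability\<close>

context random_batches
begin

text \<open>The bridge from streams to start times. The second part requires a moderate load in
  every window, as otherwise the cap \<open>l * q + l ^ 2\<close> could abandon a favourable
  exploration.\<close>

lemma instance_outcome:
  fixes xs :: "token list" and ts :: "edge \<Rightarrow> int" and q :: nat and U :: "token set"
  assumes t: "t \<in> P \<rightarrow>\<^sub>E {0..1}" and xs: "set xs = (\<lambda>e. (e, ts e)) ` E" "sorted (map snd xs)"
    and ts: "\<And>e B. B \<in> P \<Longrightarrow> e \<in> B \<Longrightarrow> \<lfloor>t B * N\<rfloor> \<le> ts e"
      "\<And>e B. B \<in> P \<Longrightarrow> e \<in> B \<Longrightarrow> ts e \<le> \<lfloor>t B * N\<rfloor> + W"
    and U: "all_edges n \<times> {0..\<lfloor>N\<rfloor> + W} \<subseteq> U"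
  defines "h \<equiv> \<lambda>s. instance_result H W (int l * H) l
      (s, foldl (instance_step H W (int l * H) U (l * q + l ^ 2) s) (Some {}) xs)"
  shows "v < n \<Longrightarrow> k \<le> l \<Longrightarrow> h (Some (v, k)) = Some y \<Longrightarrow> y \<notin> {(v, C). v < n \<and> C = component E v} \<Longrightarrow>
      false_growth v k t"
    and "v < n \<Longrightarrow> card (comp v) \<le> l \<Longrightarrow> t \<in> sched_box v \<Longrightarrow>
      (\<And>z. z \<in> {-4 * W..\<lfloor>N\<rfloor>} \<Longrightarrow> load z t < real q) \<Longrightarrow>
      h (Some (v, level v)) = Some (v, component E v)"
proof -
  let ?X = "\<lambda>B. \<lfloor>t B * N\<rfloor>" and ?T = "int l * H" and ?r = "l * q + l ^ 2"
  interpret T: timed_batches n E P ts ?X H W ?T l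
    using W H ts by unfold_locales auto
  have HW: "0 \<le> H" "0 \<le> W" using H W by auto
  have xs_tok: "set xs = T.tokens" by (simp add: xs(1) T.tokens_def)
  have step: "instance_step H W ?T U ?r (Some (v, k)) = grow_state H W ?T U ?r v k" for v k
    by (intro ext) (simp add: instance_step_def)
  have kT: "int k * H \<le> ?T" if "k \<le> l" for k using that H by (intro mult_right_mono) auto
  show "false_growth v k t"
    if v: "v < n" and k: "k \<le> l" and hy: "h (Some (v, k)) = Some y"
      and y: "y \<notin> {(v, C). v < n \<and> C = component E v}"
  proof -
    obtain K where K: "foldl (grow_state H W ?T U ?r v k) (Some {}) xs = Some K"
      "accepted H W ?T l v k K" "y = (v, found H W v k K)"
      using hy unfolding h_def instance_result_def step by (auto split: option.splits if_splits)
    obtain x where x: "K = kept H W ?T v k T.tokens x"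
      using grow_state_fold[OF HW kT[OF k] xs(2) K(1)] xs_tok by auto
    have "found H W v k K \<noteq> component E v" using y v unfolding K(3) by simp
    then show ?thesis
      using T.false_positive[OF v k, of x] K(2) unfolding x false_growth_def by simp
  qed
  show "h (Some (v, level v)) = Some (v, component E v)"
    if v: "v < n" and cv: "card (comp v) \<le> l" and sb: "t \<in> sched_box v"
      and load: "\<And>z. z \<in> {-4 * W..\<lfloor>N\<rfloor>} \<Longrightarrow> load z t < real q"
  proof -
    let ?k = "level v"
    have lv: "?k \<le> l" using level_properties(3)[OF v] cv by simp
    have os: "T.on_schedule v"
      unfolding T.on_schedule_def using sched_boxD[OF v sb] by blast
    have X01: "0 \<le> ?X B" "?X B \<le> \<lfloor>N\<rfloor>" if "B \<in> P" for B
    proof -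
      have "0 \<le> t B" "t B \<le> 1" using t that by (auto simp: PiE_iff)
      then have "0 \<le> t B * N" "t B * N \<le> 1 * N" using N by (auto intro!: mult_right_mono)
      then show "0 \<le> ?X B" "?X B \<le> \<lfloor>N\<rfloor>" by (auto intro: floor_mono)
    qed
    have win: "card {e \<in> E. y \<le> ts e \<and> ts e \<le> y + 3 * W} \<le> q" for y
    proof -
      let ?S = "{B \<in> P. y - W \<le> ?X B \<and> ?X B \<le> y + 3 * W}"
      have sub: "{e \<in> E. y \<le> ts e \<and> ts e \<le> y + 3 * W} \<subseteq> (\<Union>B\<in>?S. B)"
      proof
        fix e assume e: "e \<in> {e \<in> E. y \<le> ts e \<and> ts e \<le> y + 3 * W}"
        then have B: "batch e \<in> P" "e \<in> batch e" using batch by auto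
        then have "batch e \<in> ?S" using e ts[OF B] by auto
        then show "e \<in> (\<Union>B\<in>?S. B)" using B(2) by blast
      qed
      show ?thesis
      \<comment> \<open>Rounded start times lie between 0 and \<open>\<lfloor>N\<rfloor>\<close>, so
        other windows catch no batch. Only finitely many windows enter the union bound over
        loads.\<close>
      proof (cases "y - W \<in> {-4 * W..\<lfloor>N\<rfloor>}")
        case True
        have fB: "finite B" if "B \<in> P" for B using batch_subset[OF that] finE by (rule finite_subset)
        have "card {e \<in> E. y \<le> ts e \<and> ts e \<le> y + 3 * W} \<le> card (\<Union>B\<in>?S. B)"
          using sub finP fB by (intro card_mono) auto
        also have "\<dots> \<le> (\<Sum>B\<in>?S. card B)" using finP by (intro card_UN_le) simp
        finally have "real (card {e \<in> E. y \<le> ts e \<and> ts e \<le> y + 3 * W}) \<le> real (\<Sum>B\<in>?S. card B)"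
          by (simp only: of_nat_le_iff)
        also have "\<dots> = (\<Sum>B\<in>P. if y - W \<le> ?X B \<and> ?X B \<le> y + 3 * W then real (card B) else 0)"
          unfolding of_nat_sum by (rule sum.inter_filter[OF finP])
        also have "\<dots> = load (y - W) t"
          unfolding load_def
        proof (intro sum.cong refl)
          fix B
          have "y - W \<le> ?X B \<and> ?X B \<le> y + 3 * W \<longleftrightarrow> y - W \<le> ?X B \<and> ?X B < y - W + 4 * W + 1"
            by auto
          also have "\<dots> \<longleftrightarrow> t B \<in> {of_int (y - W) / N..<of_int (y - W + 4 * W + 1) / N}"
            unfolding le_floor_mult_iff[OF N] floor_mult_less_iff[OF N] by simp
          finally show "(if y - W \<le> ?X B \<and> ?X B \<le> y + 3 * W then real (card B) else 0) =
              real (card B) * indicator {of_int (y - W) / N..<of_int (y - W + 4 * W + 1) / N} (t B)"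
            by (simp add: indicator_def)
        qed
        also have "\<dots> < real q" using load[OF True] .
        finally show ?thesis by simp
      next
        case False
        have "B \<notin> ?S" for B
        proof
          assume "B \<in> ?S"
          then have "0 \<le> ?X B" "?X B \<le> \<lfloor>N\<rfloor>" "y - W \<le> ?X B" "?X B \<le> y + 3 * W"
            using X01 by auto
          then have "- 4 * W \<le> y - W" "y - W \<le> \<lfloor>N\<rfloor>" by linarith+
          then show False using False by simp
        qed
        then have "?S = {}" by blast
        then have "{e \<in> E. y \<le> ts e \<and> ts e \<le> y + 3 * W} = {}" using sub by blast
        then show ?thesis by (simp only: card.empty zero_le)
      qed
    qed
    have xsU: "set xs \<subseteq> U"
    proof
      fix z assume "z \<in> set xs"
      then obtain e where e: "e \<in> E" "z = (e, ts e)" using xs(1) by blast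
      then have B: "batch e \<in> P" "e \<in> batch e" using batch by auto
      then have "0 \<le> ts e" "ts e \<le> \<lfloor>N\<rfloor> + W" using ts[OF B] X01[OF B(1)] by linarith+
      then have "ts e \<in> {0..\<lfloor>N\<rfloor> + W}" by simp
      then show "z \<in> U" using e U E by auto
    qed
    have "\<exists>K. foldl (grow_state H W ?T U ?r v ?k) (Some {}) xs = Some K"
    proof (rule grow_state_fold_Some[OF HW kT[OF lv] xs(2) xsU])
      fix ys zs assume ys: "xs = ys @ zs" "ys \<noteq> []"
      have sorted: "sorted (map snd ys)" "\<And>z z'. z \<in> set ys \<Longrightarrow> z' \<in> set zs \<Longrightarrow> snd z \<le> snd z'"
        using xs(2) unfolding ys(1) by (auto simp: sorted_append)
      obtain us z where us: "ys = us @ [z]" using ys(2) by (cases ys rule: rev_cases) auto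
      show "card (kept H W ?T v ?k (set ys) (snd (last ys))) \<le> ?r"
      proof (rule T.kept_card[OF v cv os])
        show "set ys \<subseteq> T.tokens" using ys(1) xs_tok by auto
        show "snd z \<le> snd z'" if "z \<in> set ys" "z' \<in> T.tokens - set ys" for z z'
          using sorted(2)[of z z'] that ys(1) xs_tok by auto
        show "snd z' \<le> snd (last ys)" if "z' \<in> set ys" for z'
          using sorted(1) that unfolding us by (auto simp: sorted_append)
      qed (rule win)
    qed
    then obtain K where K: "foldl (grow_state H W ?T U ?r v ?k) (Some {}) xs = Some K" by blast
    obtain x where x: "K = kept H W ?T v ?k T.tokens x"
      using grow_state_fold[OF HW kT[OF lv] xs(2) K] xs_tok by auto
    show ?thesis
      using T.true_positive[OF v cv os, of x] unfolding h_def instance_result_def step K x by simp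
  qed
qed

text \<open>An instance for \<open>(v, k)\<close> is started with probability proportional to
  \<open>\<sigma>^(l - 1 - k)\<close>, which compensates the factor \<open>\<sigma>^k\<close> for hitting \<open>k\<close> slots: all
  levels then contribute correct and wrong acceptances on the same scale \<open>\<sigma>^(l - 1)\<close>.\<close>

lemma failure_function:
  fixes b R q :: nat and \<beta> \<delta> :: real and d :: 'r
  assumes b: "1 \<le> b" "\<And>B. B \<in> P \<Longrightarrow> card B \<le> b" and n: "1 \<le> n"
    and WH: "6 * real l * of_int W \<le> of_int H" and s3: "real l ^ 3 * \<sigma> \<le> 1 / 4"
    and \<beta>: "0 < \<beta>" "\<beta> * real n \<le> real (card {v \<in> {..<n}. card (comp v) \<le> l})"
    and fp: "real R * (4 * real l ^ 3 * \<sigma> ^ l + 2 * real l ^ 2 * ((6 * of_int W + 1) / N)) \<le> \<delta> / 4"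
    and \<mu>0: "\<mu>0 = \<beta> * \<sigma> ^ (l - 1) / (4 * real l)" and R: "1 \<le> R" and tp: "2 / (real R * \<mu>0) \<le> \<delta> / 4"
    and cheb: "4 * (real l ^ 2 * real b / real n) / \<mu>0 \<le> \<delta> / 4"
    and over: "(N + 4 * of_int W + 1) * exp (2 * ((4 * of_int W + 1) / N) * real (card E) / real b - real q / real b) \<le> \<delta> / 4"
  obtains f where "integrable M f" "(\<integral>t. f t \<partial>M) \<le> \<delta>"
    "\<And>t D (A :: 'r set) h. t \<in> P \<rightarrow>\<^sub>E {0..1} \<Longrightarrow>
      set_pmf D \<subseteq> insert None (Some ` ({..<n} \<times> {..<l})) \<Longrightarrow>
      (\<And>v k. v < n \<Longrightarrow> k < l \<Longrightarrow> pmf D (Some (v, k)) = \<sigma> ^ (l - 1 - k) / (real n * real l)) \<Longrightarrow>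
      h None = None \<Longrightarrow>
      (\<And>v k y. v < n \<Longrightarrow> k < l \<Longrightarrow> h (Some (v, k)) = Some y \<Longrightarrow> y \<notin> A \<Longrightarrow> false_growth v k t) \<Longrightarrow>
      ((\<And>z. z \<in> {-4 * W..\<lfloor>N\<rfloor>} \<Longrightarrow> load z t < real q) \<Longrightarrow>
        \<forall>v. v < n \<and> card (comp v) \<le> l \<and> t \<in> sched_box v \<longrightarrow> h (Some (v, level v)) \<in> Some ` A) \<Longrightarrow>
      measure_pmf.prob (map_pmf (first_result d h) (replicate_pmf R D)) A \<ge> 1 - f t"
proof -
  let ?wt = "\<lambda>k. \<sigma> ^ (l - 1 - k) / (real n * real l)"
  let ?u = "(6 * of_int W + 1) / N"
  have lp: "0 < real l" "0 < real n" using l n by auto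
  have \<tau>l: "real l ^ 2 * \<tau> = real l ^ 3 * \<sigma>" by (simp add: \<tau>_def power3_eq_cube power2_eq_square)
  have \<tau>4: "\<tau> \<le> 1 / (4 * real l ^ 2)"
    using s3 lp unfolding \<tau>l[symmetric] by (simp add: field_simps)
  have \<tau>2: "real l ^ 2 * \<tau> \<le> 1 / 2" using s3 unfolding \<tau>l by simp
  have s1: "\<sigma> \<le> 1" using sg by simp
  have \<mu>0p: "0 < \<mu>0" unfolding \<mu>0 using \<beta>(1) sg lp by simp
  have "\<forall>v k. \<exists>S. k < l \<longrightarrow> S \<in> sets M \<and> measure M S \<le> 4 * real l ^ 2 * \<tau> * \<sigma> ^ k + 2 * real l ^ 2 * ?u \<and>
      (\<forall>t. t \<in> P \<rightarrow>\<^sub>E {0..1} \<longrightarrow> false_growth v k t \<longrightarrow> t \<in> S)"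
  proof (intro allI)
    fix v k
    show "\<exists>S. k < l \<longrightarrow> S \<in> sets M \<and> measure M S \<le> 4 * real l ^ 2 * \<tau> * \<sigma> ^ k + 2 * real l ^ 2 * ?u \<and>
      (\<forall>t. t \<in> P \<rightarrow>\<^sub>E {0..1} \<longrightarrow> false_growth v k t \<longrightarrow> t \<in> S)"
    proof (cases "k < l")
      case True
      show ?thesis by (rule false_growth_bound[OF True \<tau>4, of v]) blast
    qed simp
  qed
  then obtain FP where FP: "\<And>v k. k < l \<Longrightarrow> FP v k \<in> sets M"
    "\<And>v k. k < l \<Longrightarrow> measure M (FP v k) \<le> 4 * real l ^ 2 * \<tau> * \<sigma> ^ k + 2 * real l ^ 2 * ?u"
    "\<And>v k t. k < l \<Longrightarrow> t \<in> P \<rightarrow>\<^sub>E {0..1} \<Longrightarrow> false_growth v k t \<Longrightarrow> t \<in> FP v k"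
    by metis
  let ?S = "{..<n} \<times> {..<l}"
  \<comment> \<open>For fixed \<open>t\<close>, a bound on the chance that a random instance accepts
    wrongly. It enters the failure bound linearly, so its expectation is all that matters.\<close>
  define bad where "bad t = (\<Sum>x\<in>?S. ?wt (snd x) * indicator (FP (fst x) (snd x)) t)" for t
  have int_ind: "integrable M (\<lambda>t. indicator S t :: real)" if "S \<in> sets M" for S
    using that by (intro integrable_real_indicator) (auto simp: emeasure_eq_measure)
  have int_bad: "integrable M bad"
    unfolding bad_def using FP(1) by (intro Bochner_Integration.integrable_sum integrable_mult_right int_ind) auto
  have "(\<integral>t. bad t \<partial>M) = (\<Sum>x\<in>?S. ?wt (snd x) * measure M (FP (fst x) (snd x)))"
    unfolding bad_def using FP(1) int_ind
    by (subst Bochner_Integration.integral_sum) (auto intro!: sum.cong)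
  also have "\<dots> \<le> (\<Sum>x\<in>?S. (4 * real l ^ 3 * \<sigma> ^ l + 2 * real l ^ 2 * ?u) / (real n * real l))"
  proof (rule sum_mono)
    fix x assume "x \<in> ?S"
    then have k: "snd x < l" by auto
    let ?k = "snd x"
    have "?wt ?k * measure M (FP (fst x) ?k) \<le> ?wt ?k * (4 * real l ^ 2 * \<tau> * \<sigma> ^ ?k + 2 * real l ^ 2 * ?u)"
      using FP(2)[OF k] sg lp by (intro mult_left_mono) auto
    also have "\<dots> = (4 * real l ^ 2 * \<tau> * (\<sigma> ^ (l - 1 - ?k) * \<sigma> ^ ?k) + \<sigma> ^ (l - 1 - ?k) * (2 * real l ^ 2 * ?u)) / (real n * real l)"
      by (simp add: field_simps)
    also have "\<sigma> ^ (l - 1 - ?k) * \<sigma> ^ ?k = \<sigma> ^ (l - 1)" using k by (simp add: power_add[symmetric])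
    also have "4 * real l ^ 2 * \<tau> * \<sigma> ^ (l - 1) = 4 * real l ^ 3 * \<sigma> ^ l"
    proof -
      have "\<sigma> ^ l = \<sigma> * \<sigma> ^ (l - 1)" using l by (cases l) auto
      then show ?thesis by (simp add: \<tau>_def power3_eq_cube power2_eq_square)
    qed
    also have "\<sigma> ^ (l - 1 - ?k) * (2 * real l ^ 2 * ?u) \<le> 1 * (2 * real l ^ 2 * ?u)"
      using sg s1 N W by (intro mult_right_mono power_le_one mult_nonneg_nonneg divide_nonneg_pos) auto
    finally show "?wt ?k * measure M (FP (fst x) ?k) \<le>
        (4 * real l ^ 3 * \<sigma> ^ l + 2 * real l ^ 2 * ?u) / (real n * real l)"
      using lp by (simp add: divide_right_mono)
  qed
  also have "\<dots> = 4 * real l ^ 3 * \<sigma> ^ l + 2 * real l ^ 2 * ?u" using lp by (simp add: card_cartesian_product)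
  finally have E_bad: "(\<integral>t. bad t \<partial>M) \<le> 4 * real l ^ 3 * \<sigma> ^ l + 2 * real l ^ 2 * ?u" .
  define V where "V = {v \<in> {..<n}. card (comp v) \<le> l}"
  have finV: "finite V" by (simp add: V_def)
  have levV: "level v < l" if "v \<in> V" for v
    using level_properties(3)[of v] that by (auto simp: V_def)
  define a where "a v = ?wt (level v)" for v
  have a0: "0 \<le> a v" "a v \<le> 1 / (real n * real l)" for v
    using sg s1 lp unfolding a_def by (auto intro!: divide_right_mono power_le_one)
  \<comment> \<open>The chance of a correct acceptance, in contrast, has to be large for most
    \<open>t\<close> and not only on average, hence the second moment bound.\<close>
  define \<mu> where "\<mu> = (\<Sum>v\<in>V. a v * prob (sched_box v))"
  have \<mu>: "\<mu>0 \<le> \<mu>"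
  proof -
    have "\<mu>0 = \<beta> * real n * (\<sigma> ^ (l - 1) / (4 * real n * real l))" unfolding \<mu>0 using lp by simp
    also have "\<dots> \<le> real (card V) * (\<sigma> ^ (l - 1) / (4 * real n * real l))"
      using \<beta>(2) sg lp unfolding V_def by (intro mult_right_mono) auto
    also have "\<dots> = (\<Sum>v\<in>V. \<sigma> ^ (l - 1) / (4 * real n * real l))" by simp
    also have "\<dots> \<le> \<mu>" unfolding \<mu>_def
    proof (rule sum_mono)
      fix v assume v: "v \<in> V"
      have "\<sigma> ^ (l - 1) = \<sigma> ^ (l - 1 - level v) * \<sigma> ^ level v"
        using levV[OF v] by (simp add: power_add[symmetric])
      then have "\<sigma> ^ (l - 1) / (4 * real n * real l) = a v * (\<sigma> ^ level v / 4)"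
        unfolding a_def by simp
      also have "\<dots> \<le> a v * prob (sched_box v)"
        using v WH \<tau>2 a0 by (intro mult_left_mono measure_sched_box) (auto simp: V_def)
      finally show "\<sigma> ^ (l - 1) / (4 * real n * real l) \<le> a v * prob (sched_box v)" .
    qed
    finally show ?thesis .
  qed
  define Low where "Low = {t \<in> space M. (\<Sum>v\<in>V. a v * indicator (sched_box v) t) \<le> \<mu> / 2}"
  have Low_sets: "Low \<in> sets M"
  proof -
    have [measurable]: "sched_box v \<in> sets M" for v by (rule sched_box_sets)
    show ?thesis unfolding Low_def by measurable
  qed
  have "prob Low \<le> 4 * (real l ^ 2 * real b / real n) / \<mu>"
    unfolding Low_def
  proof (rule weighted_count_lower_tail[where dep = "\<lambda>v v'. touching (comp v) \<inter> touching (comp v') \<noteq> {}"])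
    show "prob (sched_box v \<inter> sched_box v') = prob (sched_box v) * prob (sched_box v')"
      if "v \<in> V" "v' \<in> V" "\<not> touching (comp v) \<inter> touching (comp v') \<noteq> {}" for v v'
      using that by (intro sched_box_indep) (auto simp: V_def)
    show "(\<Sum>v'\<in>{v' \<in> V. touching (comp v) \<inter> touching (comp v') \<noteq> {}}. a v') \<le> real l ^ 2 * real b / real n"
      if v: "v \<in> V" for v
    proof -
      let ?dep = "{v' \<in> V. touching (comp v) \<inter> touching (comp v') \<noteq> {}}"
      have "card ?dep \<le> l ^ 3 * b"
      proof -
        have "?dep = {v'. v' < n \<and> card (comp v') \<le> l \<and> touching (comp v) \<inter> touching (comp v') \<noteq> {}}"
          unfolding V_def by auto
        then show ?thesis using card_dependent_le[OF b(2), of v] v unfolding V_def by simp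
      qed
      then have "real (card ?dep) \<le> real (l ^ 3 * b)" by (simp only: of_nat_le_iff)
      then have "real (card ?dep) \<le> real l ^ 3 * real b" by simp
      moreover have "(\<Sum>v'\<in>?dep. a v') \<le> real (card ?dep) * (1 / (real n * real l))"
        using a0(2) by (intro sum_bounded_above)
      ultimately have "(\<Sum>v'\<in>?dep. a v') \<le> real l ^ 3 * real b * (1 / (real n * real l))"
        using mult_right_mono[of "real (card ?dep)" "real l ^ 3 * real b" "1 / (real n * real l)"] by simp
      also have "\<dots> = real l ^ 2 * real b / real n" using lp by (simp add: power3_eq_cube power2_eq_square)
      finally show ?thesis .
    qed
    show "\<mu> = (\<Sum>v\<in>V. a v * prob (sched_box v))" by (rule \<mu>_def)
    show "0 < \<mu>" using \<mu> \<mu>0p by simp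
  qed (use finV a0 sched_box_sets in auto)
  also have "\<dots> \<le> 4 * (real l ^ 2 * real b / real n) / \<mu>0"
    using \<mu> \<mu>0p by (intro divide_left_mono) auto
  also have "\<dots> \<le> \<delta> / 4" by (rule cheb)
  finally have P_Low: "prob Low \<le> \<delta> / 4" .
  define Over where "Over = (\<Union>z\<in>{-4 * W..\<lfloor>N\<rfloor>}. {t \<in> space M. real q \<le> load z t})"
  have Over_sets: "Over \<in> sets M" unfolding Over_def by measurable
  let ?e = "exp (2 * ((4 * of_int W + 1) / N) * real (card E) / real b - real q / real b)"
  have "prob Over \<le> (\<Sum>z\<in>{-4 * W..\<lfloor>N\<rfloor>}. prob {t \<in> space M. real q \<le> load z t})"
    unfolding Over_def by (intro finite_measure_subadditive_finite) auto
  also have "\<dots> \<le> (\<Sum>z\<in>{-4 * W..\<lfloor>N\<rfloor>}. ?e)" using b by (intro sum_mono load_tail)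
  also have "\<dots> = of_int (\<lfloor>N\<rfloor> + 4 * W + 1) * ?e" using N W by simp
  also have "\<dots> \<le> (N + 4 * of_int W + 1) * ?e"
    using of_int_floor_le[of N] by (intro mult_right_mono) auto
  also have "\<dots> \<le> \<delta> / 4" by (rule over)
  finally have P_Over: "prob Over \<le> \<delta> / 4" .
  \<comment> \<open>Four equal shares of \<delta>: overloaded windows, too few favourable vertices,
    wrong acceptances, and bad luck in the \<open>R\<close> draws.\<close>
  define f where "f t = indicator Over t + indicator Low t + real R * bad t + \<delta> / 4" for t
  have R0: "0 < real R" using R by simp
  have d0: "0 \<le> \<delta> / 4"
  proof -
    have "0 \<le> 2 / (real R * \<mu>0)" using R0 \<mu>0p by simp
    then show ?thesis using tp by linarith
  qed
  have intf: "integrable M f"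
    unfolding f_def using Over_sets Low_sets int_bad
    by (intro Bochner_Integration.integrable_add integrable_mult_right int_ind) auto
  have "(\<integral>t. f t \<partial>M) = prob Over + prob Low + real R * (\<integral>t. bad t \<partial>M) + \<delta> / 4"
    unfolding f_def using int_ind[OF Over_sets] int_ind[OF Low_sets] int_bad Over_sets Low_sets
    by (simp add: prob_space)
  also have "\<dots> \<le> \<delta> / 4 + \<delta> / 4 + \<delta> / 4 + \<delta> / 4"
    using P_Over P_Low fp mult_left_mono[OF E_bad, of "real R"] by linarith
  finally have int_le: "(\<integral>t. f t \<partial>M) \<le> \<delta>" by simp
  have bad0: "0 \<le> bad t" for t unfolding bad_def using sg lp by (intro sum_nonneg) auto
  show ?thesis
  proof (rule that[OF intf int_le])
    fix t D and A :: "'r set" and h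
    assume t: "t \<in> P \<rightarrow>\<^sub>E {0..1}" and D: "set_pmf D \<subseteq> insert None (Some ` ?S)"
      and pD: "\<And>v k. v < n \<Longrightarrow> k < l \<Longrightarrow> pmf D (Some (v, k)) = ?wt k"
      and h0: "h None = None"
      and hb: "\<And>v k y. v < n \<Longrightarrow> k < l \<Longrightarrow> h (Some (v, k)) = Some y \<Longrightarrow> y \<notin> A \<Longrightarrow> false_growth v k t"
      and hg: "(\<And>z. z \<in> {-4 * W..\<lfloor>N\<rfloor>} \<Longrightarrow> load z t < real q) \<Longrightarrow>
        \<forall>v. v < n \<and> card (comp v) \<le> l \<and> t \<in> sched_box v \<longrightarrow> h (Some (v, level v)) \<in> Some ` A"
    let ?p = "measure_pmf.prob (map_pmf (first_result d h) (replicate_pmf R D)) A"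
    have tM: "t \<in> space M" using t by (auto simp: space_start_times PiE_iff)
    show "1 - f t \<le> ?p"
    proof (cases "t \<in> Over \<or> t \<in> Low")
      case True
      then have "1 \<le> f t" unfolding f_def using bad0[of t] R0 d0
        by (auto simp: indicator_def add_nonneg_nonneg)
      then show ?thesis by (meson diff_le_0_iff_le measure_nonneg order_trans)
    next
      case False
      let ?G = "{s. h s \<in> Some ` A}" and ?B = "{s. h s \<notin> insert None (Some ` A)}"
      let ?X = "\<Sum>v\<in>V. a v * indicator (sched_box v) t"
      have "load z t < real q" if "z \<in> {-4 * W..\<lfloor>N\<rfloor>}" for z
        using False tM that unfolding Over_def by force
      note hg' = hg[OF this]
      have X: "\<mu> / 2 < ?X" using False tM unfolding Low_def by auto
      have "measure_pmf.prob D ?B \<le> bad t"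
      proof -
        let ?F = "{x \<in> ?S. t \<in> FP (fst x) (snd x)}"
        have "measure_pmf.prob D ?B = measure_pmf.prob D (?B \<inter> set_pmf D)" by (rule measure_Int_set_pmf[symmetric])
        also have "\<dots> \<le> measure_pmf.prob D (Some ` ?F)"
        proof (rule measure_pmf.finite_measure_mono)
          show "?B \<inter> set_pmf D \<subseteq> Some ` ?F"
          proof
            fix s assume s: "s \<in> ?B \<inter> set_pmf D"
            then have "s \<in> insert None (Some ` ?S)" "s \<noteq> None" using D h0 by auto
            then obtain v k where vk: "s = Some (v, k)" "v < n" "k < l" by auto
            obtain y where y: "h s = Some y" "y \<notin> A" using s by (cases "h s") auto
            have "t \<in> FP v k" using FP(3)[OF vk(3) t] hb[OF vk(2,3)] y unfolding vk(1) by blast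
            then show "s \<in> Some ` ?F" using vk by auto
          qed
        qed simp
        also have "\<dots> = (\<Sum>x\<in>?F. pmf D (Some x))"
          by (subst measure_measure_pmf_finite) (auto simp: sum.reindex)
        also have "\<dots> = (\<Sum>x\<in>?F. ?wt (snd x))" using pD by (intro sum.cong) auto
        also have "\<dots> = bad t" unfolding bad_def
          by (subst sum.inter_filter) (auto intro!: sum.cong)
        finally show ?thesis .
      qed
      then have b1: "real R * measure_pmf.prob D ?B \<le> real R * bad t" using R0 by simp
      define g where "g = measure_pmf.prob D ?G"
      have "?X \<le> g"
      proof -
        let ?F = "{v \<in> V. t \<in> sched_box v}"
        have "?X = (\<Sum>v\<in>?F. a v)"
          unfolding sum.inter_filter[OF finV] by (intro sum.cong) (auto simp: indicator_def)
        also have "\<dots> = (\<Sum>v\<in>?F. pmf D (Some (v, level v)))"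
          using levV pD by (intro sum.cong) (auto simp: a_def V_def)
        also have "\<dots> = measure_pmf.prob D ((\<lambda>v. Some (v, level v)) ` ?F)"
          using finV by (subst measure_measure_pmf_finite) (auto simp: sum.reindex inj_on_def)
        also have "\<dots> \<le> g" unfolding g_def
          using hg' by (intro measure_pmf.finite_measure_mono) (auto simp: V_def)
        finally show ?thesis .
      qed
      then have g: "\<mu>0 / 2 < g" using X \<mu> by simp
      have g1: "g \<le> 1" unfolding g_def by simp
      have "(1 - g) ^ R \<le> 1 / (real R * g)" using g g1 \<mu>0p R by (intro one_minus_power_le) auto
      also have "\<dots> \<le> 1 / (real R * (\<mu>0 / 2))"
        using g \<mu>0p R0 by (intro divide_left_mono mult_left_mono mult_pos_pos) auto
      also have "\<dots> = 2 / (real R * \<mu>0)" by simp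
      also have "\<dots> \<le> \<delta> / 4" by (rule tp)
      finally have g2: "(1 - g) ^ R \<le> \<delta> / 4" .
      have "1 - real R * measure_pmf.prob D ?B - (1 - g) ^ R \<le> ?p"
        unfolding g_def by (rule first_result_prob)
      moreover have "f t = real R * bad t + \<delta> / 4" using False by (simp add: f_def)
      ultimately show ?thesis using b1 g2 by linarith
    qed
  qed
qed

end

text \<open>The algorithm is obtained before graph, batches and adversary are fixed, so it knows
  only the parameters. The hypotheses collect the inequalities that the four shares of failure and
  the state count demand.\<close>

lemma growth_algorithm:
  fixes n b c l R q s :: nat and H W :: int and w \<beta> \<delta> m' :: real
  defines "N \<equiv> real n ^ c" and "\<rho> \<equiv> of_int H / real n ^ c"
    and "U \<equiv> all_edges n \<times> {0..\<lfloor>real n ^ c\<rfloor> + \<lceil>w * real n ^ c\<rceil>}"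
  assumes n: "1 \<le> n" and l: "1 \<le> l" and b: "1 \<le> b" and H: "0 < H" and w: "0 \<le> w"
    and Weq: "W = \<lceil>w * N\<rceil>" and lH: "real l * of_int H \<le> N"
    and WH: "6 * real l * of_int W \<le> of_int H" and s3: "real l ^ 3 * \<rho> \<le> 1 / 4" and \<beta>: "0 < \<beta>"
    and fp: "real R * (4 * real l ^ 3 * \<rho> ^ l + 2 * real l ^ 2 * ((6 * of_int W + 1) / N)) \<le> \<delta> / 4"
    and R: "1 \<le> R" and tp: "2 / (real R * (\<beta> * \<rho> ^ (l - 1) / (4 * real l))) \<le> \<delta> / 4"
    and cheb: "4 * (real l ^ 2 * real b / real n) / (\<beta> * \<rho> ^ (l - 1) / (4 * real l)) \<le> \<delta> / 4"
    and over: "(N + 4 * of_int W + 1) * exp (2 * ((4 * of_int W + 1) / N) * m' / real b - real q / real b) \<le> \<delta> / 4"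
    and s: "((n * l + 1) * ((card U + 1) ^ (l * q + l ^ 2) + 1)) ^ R \<le> 2 ^ s"
  obtains A where "uses_space A (real s)"
    "\<And>E P adv. E \<subseteq> all_edges n \<Longrightarrow> real (card E) \<le> m' \<Longrightarrow>
       \<beta> * real n \<le> real (card {v \<in> {..<n}. card (component_vertices E v) \<le> l}) \<Longrightarrow>
       hidden_batch_adversary n c b w E P adv \<Longrightarrow>
       output_prob A n c P adv {(v, C). v < n \<and> C = component E v} \<ge> 1 - \<delta>"
proof -
  let ?S = "{..<n} \<times> {..<l}"
  have N: "0 < N" using n by (simp add: N_def)
  have \<rho>: "0 < \<rho>" "\<rho> \<le> 1"
  proof -
    show 0: "0 < \<rho>" using H n by (simp add: \<rho>_def)
    have "\<rho> \<le> real l ^ 3 * \<rho>" using 0 l by (simp add: one_le_power)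
    then show "\<rho> \<le> 1" using s3 by simp
  qed
  have "0 \<le> w * N" using w N by simp
  then have W0: "0 \<le> W" unfolding Weq by linarith
  have "?S \<noteq> {}" using n l by (auto simp: lessThan_empty_iff)
  obtain D :: "(nat \<times> nat) option pmf" where
    D: "\<And>x. x \<in> ?S \<Longrightarrow> pmf D (Some x) = \<rho> ^ (l - 1 - snd x) / real (card ?S)"
      "set_pmf D \<subseteq> insert None (Some ` ?S)"
  proof (rule subsampled_pmf[of ?S "\<lambda>x. \<rho> ^ (l - 1 - snd x)"])
    show "0 \<le> \<rho> ^ (l - 1 - snd x) \<and> \<rho> ^ (l - 1 - snd x) \<le> 1" for x :: "nat \<times> nat"
      using \<rho> by (auto intro: power_le_one)
  qed (use \<open>?S \<noteq> {}\<close> in auto)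
  have finU: "finite U" by (simp add: U_def)
  let ?d = "undefined :: nat \<times> nat set \<times> edge set"
  define h where "h xs = (\<lambda>s. instance_result H W (int l * H) l
        (s, foldl (instance_step H W (int l * H) U (l * q + l ^ 2) s) (Some {}) xs))" for xs
  have s': "((card ?S + 1) * ((card U + 1) ^ (l * q + l ^ 2) + 1)) ^ R \<le> 2 ^ s"
    using s by (simp add: card_cartesian_product)
  have finS: "finite ?S" by simp
  obtain A where A: "uses_space A (real s)"
    "\<And>xs. run A xs = map_pmf (first_result ?d (h xs)) (replicate_pmf R D)"
    unfolding h_def
    by (rule instances_algorithm[OF finS D(2) finU s', where d = ?d and H = H and W = W
          and T = "int l * H" and l = l]) blast
  show ?thesis
  proof (rule that[OF A(1)])
    fix E P adv
    assume Em: "E \<subseteq> all_edges n" "real (card E) \<le> m'"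
      and small: "\<beta> * real n \<le> real (card {v \<in> {..<n}. card (component_vertices E v) \<le> l})"
      and adv: "hidden_batch_adversary n c b w E P adv"
    have part: "partition_on E P" and cb: "\<And>B. B \<in> P \<Longrightarrow> card B \<le> b"
      using adv by (simp_all add: hidden_batch_adversary_def)
    interpret random_batches n E P N H W l
      using Em(1) part N H W0 l lH by unfold_locales
    have sg_eq: "\<rho> = \<sigma>" unfolding \<sigma>_def unfolding \<rho>_def N_def ..
    have "2 * ((4 * of_int W + 1) / N) * real (card E) / real b \<le> 2 * ((4 * of_int W + 1) / N) * m' / real b"
      using Em(2) W0 N by (intro divide_right_mono mult_left_mono) auto
    then have "exp (2 * ((4 * of_int W + 1) / N) * real (card E) / real b - real q / real b) \<le>
        exp (2 * ((4 * of_int W + 1) / N) * m' / real b - real q / real b)" by simp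
    then have over': "(N + 4 * of_int W + 1) * exp (2 * ((4 * of_int W + 1) / N) * real (card E) / real b - real q / real b) \<le> \<delta> / 4"
      using mult_left_mono[of _ _ "N + 4 * of_int W + 1"] W0 N over by (smt (verit) of_int_nonneg)
    show "output_prob A n c P adv {(v, C). v < n \<and> C = component E v} \<ge> 1 - \<delta>"
    proof (rule failure_function[where d = ?d, OF b cb n WH s3[unfolded sg_eq] \<beta> small fp[unfolded sg_eq] refl R
          tp[unfolded sg_eq] cheb[unfolded sg_eq] over'])
      fix f :: "(edge set \<Rightarrow> real) \<Rightarrow> real"
      assume f: "integrable M f" "(\<integral>t. f t \<partial>M) \<le> \<delta>"
        and f3: "\<And>t D (A :: (nat \<times> nat set \<times> edge set) set) h. t \<in> P \<rightarrow>\<^sub>E {0..1} \<Longrightarrow>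
      set_pmf D \<subseteq> insert None (Some ` ({..<n} \<times> {..<l})) \<Longrightarrow>
      (\<And>v k. v < n \<Longrightarrow> k < l \<Longrightarrow> pmf D (Some (v, k)) = \<sigma> ^ (l - 1 - k) / (real n * real l)) \<Longrightarrow>
      h None = None \<Longrightarrow>
      (\<And>v k y. v < n \<Longrightarrow> k < l \<Longrightarrow> h (Some (v, k)) = Some y \<Longrightarrow> y \<notin> A \<Longrightarrow> false_growth v k t) \<Longrightarrow>
      ((\<And>z. z \<in> {-4 * W..\<lfloor>N\<rfloor>} \<Longrightarrow> load z t < real q) \<Longrightarrow>
        \<forall>v. v < n \<and> card (comp v) \<le> l \<and> t \<in> sched_box v \<longrightarrow> h (Some (v, level v)) \<in> Some ` A) \<Longrightarrow>
      measure_pmf.prob (map_pmf (first_result ?d h) (replicate_pmf R D)) A \<ge> 1 - f t"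
      show "output_prob A n c P adv {(v, C). v < n \<and> C = component E v} \<ge> 1 - \<delta>"
      proof (rule output_prob_ge[OF adv finP f])
        fix t assume t: "t \<in> P \<rightarrow>\<^sub>E {0..1::real}"
        let ?o = "observed n c (adv t)"
        obtain ts where o: "set ?o = (\<lambda>e. (e, ts e)) ` E" "sorted (map snd ?o)"
          "\<And>e B. B \<in> P \<Longrightarrow> e \<in> B \<Longrightarrow> \<lfloor>t B * N\<rfloor> \<le> ts e"
          "\<And>e B. B \<in> P \<Longrightarrow> e \<in> B \<Longrightarrow> ts e \<le> \<lfloor>t B * N\<rfloor> + W"
          by (rule adversary_stream[OF adv t, folded N_def, folded Weq]) blast
        have U: "all_edges n \<times> {0..\<lfloor>N\<rfloor> + W} \<subseteq> U" by (simp add: U_def N_def Weq)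
        show "1 - f t \<le> measure_pmf.prob (run A ?o) {(v, C). v < n \<and> C = component E v}"
          unfolding A(2)
        proof (rule f3[OF t D(2)])
          show "pmf D (Some (v, k)) = \<sigma> ^ (l - 1 - k) / (real n * real l)" if "v < n" "k < l" for v k
            using D(1)[of "(v, k)"] that by (simp add: sg_eq card_cartesian_product)
          show "h ?o None = None" by (simp add: h_def instance_result_def)
          show "false_growth v k t"
            if "v < n" "k < l" "h ?o (Some (v, k)) = Some y" "y \<notin> {(v, C). v < n \<and> C = component E v}" for v k y
            using instance_outcome(1)[OF t o U that(1) _ that(3)[unfolded h_def] that(4)] that(2) by simp
          show "\<forall>v. v < n \<and> card (comp v) \<le> l \<and> t \<in> sched_box v \<longrightarrow>
              h ?o (Some (v, level v)) \<in> Some ` {(v, C). v < n \<and> C = component E v}"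
            if "\<And>z. z \<in> {-4 * W..\<lfloor>N\<rfloor>} \<Longrightarrow> load z t < real q"
          proof (intro allI impI)
            fix v assume v: "v < n \<and> card (comp v) \<le> l \<and> t \<in> sched_box v"
            have "h ?o (Some (v, level v)) = Some (v, component E v)"
              unfolding h_def using v that by (intro instance_outcome(2)[OF t o U]) auto
            then show "h ?o (Some (v, level v)) \<in> Some ` {(v, C). v < n \<and> C = component E v}"
              using v by simp
          qed
        qed
      qed
    qed
  qed
qed

section \<open>Elementary estimates for the space bound\<close>

lemma bits_for:
  fixes x :: real
  assumes "1 \<le> x"
  obtains s where "x \<le> 2 ^ s" "real s \<le> 2 * ln x + 1"
proof
  let ?s = "nat \<lceil>log 2 x\<rceil>"
  have 0: "0 \<le> log 2 x" using assms by simp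
  then have s: "real ?s \<ge> log 2 x" "real ?s \<le> log 2 x + 1" by linarith+
  have "x = 2 powr log 2 x" using assms by simp
  also have "\<dots> \<le> 2 powr real ?s" using s(1) by (intro powr_mono) auto
  finally show "x \<le> 2 ^ ?s" by (simp add: powr_realpow)
  have "ln x \<le> (2 * ln x) * ln 2"
    using mult_left_mono[OF ln2_ge_two_thirds, of "ln x"] ln_ge_zero[OF assms] by simp
  then have "log 2 x \<le> 2 * ln x" unfolding log_def by (simp add: pos_divide_le_eq)
  then show "real ?s \<le> 2 * ln x + 1" using s(2) by simp
qed

text \<open>The exponent \<open>l - 1\<close> matters: for \<open>l = 1\<close> the base \<Lambda>
  can be arbitrarily close to 1 and cannot absorb a constant, whereas for \<open>l \<ge> 2\<close>
  it is at least 2 and \<open>2112 \<le> 2 ^ 12\<close>. Hence \<open>17 = 12 + 5\<close>.\<close>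

lemma power_pred_le:
  fixes \<Lambda> :: real
  assumes "real l \<le> \<Lambda>" "1 \<le> l"
  shows "(2112 * \<Lambda> ^ 5) ^ (l - 1) \<le> \<Lambda> ^ (17 * l)"
proof (cases "l = 1")
  case True
  then show ?thesis using assms by (simp add: one_le_power)
next
  case False
  then have \<Lambda>: "2 \<le> \<Lambda>" using assms by linarith
  have "(2112::real) \<le> 2 ^ 12" by simp
  also have "\<dots> \<le> \<Lambda> ^ 12" using \<Lambda> by (intro power_mono) auto
  finally have "2112 * \<Lambda> ^ 5 \<le> \<Lambda> ^ 12 * \<Lambda> ^ 5" using \<Lambda> by (intro mult_right_mono) auto
  also have "\<dots> = \<Lambda> ^ 17" by (simp add: power_add[symmetric])
  finally have "(2112 * \<Lambda> ^ 5) ^ (l - 1) \<le> (\<Lambda> ^ 17) ^ (l - 1)" using \<Lambda> by (intro power_mono) auto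
  also have "\<dots> = \<Lambda> ^ (17 * (l - 1))" by (simp add: power_mult)
  also have "\<dots> \<le> \<Lambda> ^ (17 * l)" using \<Lambda> by (intro power_increasing) auto
  finally show ?thesis .
qed

subsection \<open>Choice of the parameters\<close>

text \<open>Storing \<open>min m (n * l)\<close> edges is affordable here: \<open>n * l\<close> is
  at most \<open>\<Xi> * b * l\<close> if \<open>n < \<Xi> * b\<close>, and \<open>m\<close> is at
  most \<open>\<Xi> * w * m\<close> if \<open>w > 1 / \<Xi>\<close>.\<close>

lemma small_regime:
  fixes n l m b :: nat and w \<Xi> :: real
  assumes n: "1 \<le> n" and l: "1 \<le> l" and b: "1 \<le> b" and w: "0 \<le> w" and \<Xi>: "1 \<le> \<Xi>"
    and regime: "real n < \<Xi> * real b \<or> 1 / \<Xi> < w"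
  obtains A where "uses_space A (5 * \<Xi> * real l * (real b + w * real m) * (1 + ln (real n)))"
    "\<And>E P adv c b w v. E \<subseteq> all_edges n \<Longrightarrow> card E \<le> m \<Longrightarrow>
       v < n \<Longrightarrow> card (component_vertices E v) \<le> l \<Longrightarrow> hidden_batch_adversary n c b w E P adv \<Longrightarrow>
       output_prob A n c P adv {(v, C). v < n \<and> C = component E v} \<ge> 1"
proof -
  let ?B = "real b + w * real m" and ?L = "1 + ln (real n)"
  define k where "k = min m (n * l)"
  have L: "1 \<le> ?L" using n by simp
  have wm: "0 \<le> w * real m" using w by simp
  have B: "1 \<le> ?B" using b wm by simp
  have k: "real k \<le> \<Xi> * real l * ?B"
    using regime
  proof
    assume a: "real n < \<Xi> * real b"
    have "real k \<le> real n * real l" unfolding k_def by (metis of_nat_le_iff of_nat_mult min.cobounded2)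
    also have "\<dots> \<le> \<Xi> * real b * real l" using a by (intro mult_right_mono) auto
    also have "\<dots> \<le> \<Xi> * ?B * real l" using wm \<Xi> by (intro mult_right_mono mult_left_mono) auto
    finally show ?thesis by (simp add: ac_simps)
  next
    assume "1 / \<Xi> < w"
    then have "1 \<le> \<Xi> * w" using \<Xi> by (simp add: field_simps)
    then have "1 * real m \<le> \<Xi> * w * real m" by (intro mult_right_mono) auto
    also have "\<dots> \<le> \<Xi> * ?B" using \<Xi> by (simp add: distrib_left)
    also have "\<dots> \<le> \<Xi> * ?B * real l"
    proof -
      have "0 \<le> \<Xi> * ?B" using \<Xi> B by (intro mult_nonneg_nonneg) auto
      then show ?thesis using mult_left_mono[of 1 "real l" "\<Xi> * ?B"] l by simp
    qed
    finally have "real m \<le> \<Xi> * real l * ?B" by (simp add: ac_simps)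
    moreover have "real k \<le> real m" unfolding k_def by simp
    ultimately show ?thesis by simp
  qed
  have "1 \<le> real n ^ 2" using n by (intro one_le_power) simp
  then have x1: "1 \<le> 2 * real n ^ 2" by simp
  obtain s where s: "2 * real n ^ 2 \<le> 2 ^ s" "real s \<le> 2 * ln (2 * real n ^ 2) + 1"
    using bits_for[OF x1] by blast
  have "ln (2::real) \<le> 1" using ln_add_one_self_le_self[of 1] by simp
  then have s4: "real s \<le> 4 * ?L"
    using s(2) n by (simp add: ln_mult ln_realpow)
  have n2: "1 \<le> n ^ 2" using n by simp
  have "card (all_edges n) + 1 \<le> n ^ 2 + 1" using card_all_edges_le[of n] by simp
  also have "\<dots> \<le> 2 * n ^ 2" using n2 by linarith
  also have "\<dots> \<le> 2 ^ s"
  proof -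
    have "real (2 * n ^ 2) \<le> real (2 ^ s)" using s(1) by simp
    then show ?thesis by (simp only: of_nat_le_iff)
  qed
  finally have "(card (all_edges n) + 1) ^ k \<le> (2 ^ s) ^ k" by (rule power_mono) simp
  then have "(card (all_edges n) + 1) ^ k + 1 \<le> 2 ^ (s * k) + 2 ^ (s * k)"
    by (intro add_mono) (simp_all add: power_mult)
  then have bits: "(card (all_edges n) + 1) ^ min m (n * l) + 1 \<le> 2 ^ (s * k + 1)"
    by (simp add: k_def)
  obtain A where A: "uses_space A (real (s * k + 1))"
    "\<And>E P adv c b w v. E \<subseteq> all_edges n \<Longrightarrow> card E \<le> m \<Longrightarrow>
       v < n \<Longrightarrow> card (component_vertices E v) \<le> l \<Longrightarrow> hidden_batch_adversary n c b w E P adv \<Longrightarrow>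
       output_prob A n c P adv {(v, C). v < n \<and> C = component E v} \<ge> 1"
  proof (rule low_degree_algorithm[OF bits])
    fix A assume "uses_space A (real (s * k + 1))"
      "\<And>E P adv c b w v. E \<subseteq> all_edges n \<Longrightarrow> card E \<le> m \<Longrightarrow>
       v < n \<Longrightarrow> card (component_vertices E v) \<le> l \<Longrightarrow> hidden_batch_adversary n c b w E P adv \<Longrightarrow>
       output_prob A n c P adv {(v, C). v < n \<and> C = component E v} \<ge> 1"
    then show thesis by (rule that)
  qed
  have Lp: "1 \<le> \<Xi> * real l * ?B * ?L"
    using \<Xi> l B L by (intro mult_ge1_I[OF mult_ge1_I[OF mult_ge1_I]]) auto
  have "real (s * k + 1) = real s * real k + 1" by simp
  also have "\<dots> \<le> 4 * ?L * (\<Xi> * real l * ?B) + \<Xi> * real l * ?B * ?L"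
    using s4 k Lp L by (intro add_mono mult_mono) auto
  also have "\<dots> = 5 * \<Xi> * real l * ?B * ?L" by (simp add: algebra_simps)
  finally have "uses_space A (5 * \<Xi> * real l * ?B * ?L)" using A(1) uses_space_mono by blast
  from this A(2) show ?thesis by (rule that)
qed


lemma large_regime:
  fixes n l m b c :: nat and w \<beta> \<delta> :: real
  defines "\<Lambda> \<equiv> real l / (\<beta> * \<delta>)"
  defines "G \<equiv> (2112 * \<Lambda> ^ 5) ^ l"
  assumes n: "1 \<le> n" and l: "1 \<le> l" and b: "1 \<le> b" and w: "0 \<le> w" and c: "2 \<le> c"
    and \<beta>: "0 < \<beta>" "\<beta> \<le> 1" and \<delta>: "0 < \<delta>" "\<delta> < 1"
    and nb: "7000 * \<Lambda> ^ 4 * G * real b \<le> real n" and wX: "w \<le> 1 / (7000 * \<Lambda> ^ 4 * G)"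
  obtains A where "uses_space A (33 * (4 + (60 + real c) * (2 * real c + 9)) * \<Lambda> ^ 3 *
      (2112 * \<Lambda> ^ 5) ^ (l - 1) * (real b + w * real m) * (1 + ln (real n)) ^ 2)"
    "\<And>E P adv. E \<subseteq> all_edges n \<Longrightarrow> card E \<le> m \<Longrightarrow>
       \<beta> * real n \<le> real (card {v \<in> {..<n}. card (component_vertices E v) \<le> l}) \<Longrightarrow>
       hidden_batch_adversary n c b w E P adv \<Longrightarrow>
       output_prob A n c P adv {(v, C). v < n \<and> C = component E v} \<ge> 1 - \<delta>"
proof -
  let ?L = "1 + ln (real n)" and ?B = "real b + w * real m"
  define N where "N = real n ^ c"
  \<comment> \<open>\<open>1 / M\<close> is the intended slot length. With
    \<open>33 * \<Lambda> / \<rho> ^ (l - 1)\<close> instances the regular wrong acceptances weigh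
    \<open>132 * \<Lambda> ^ 4 * \<rho>\<close>, and \<open>1056 = 8 * 132\<close> brings this down
    to \<open>1 / (8 * \<Lambda>)\<close>.\<close>
  define M where "M = 1056 * \<Lambda> ^ 5"
  define H where "H = \<lfloor>N / M\<rfloor>"
  define \<rho> where "\<rho> = of_int H / N"
  define W where "W = \<lceil>w * N\<rceil>"
  define u where "u = (6 * of_int W + 1) / N"
  have bd: "0 < \<beta> * \<delta>" "\<beta> * \<delta> \<le> 1" using \<beta> \<delta> by (auto intro: mult_le_one)
  have lL: "real l \<le> \<Lambda>" unfolding \<Lambda>_def using bd by (simp add: pos_le_divide_eq mult_left_le)
  then have L1: "1 \<le> \<Lambda>" using l by simp
  have Lbd: "\<Lambda> * (\<beta> * \<delta>) = real l" unfolding \<Lambda>_def using \<beta> \<delta> by simp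
  have Ld: "1 \<le> \<Lambda> * \<delta>"
  proof -
    have "1 \<le> \<Lambda> * (\<beta> * \<delta>)" using Lbd l by simp
    also have "\<dots> \<le> \<Lambda> * (1 * \<delta>)" using \<beta> \<delta> L1 by (intro mult_left_mono mult_right_mono) auto
    finally show ?thesis by simp
  qed
  have inv: "1 / \<Lambda> \<le> \<delta>" using Ld L1 by (simp add: field_simps)
  have pw: "1 \<le> \<Lambda> ^ i" for i using L1 by (rule one_le_power)
  have M2: "G = (2 * M) ^ l" "1056 \<le> M" unfolding G_def M_def using pw[of 5] by (auto simp: power_mult_distrib)
  have G2: "2 * M \<le> G" unfolding M2(1) using M2(2) l by (intro self_le_power) auto
  have G1: "1 \<le> G" using G2 M2(2) by simp
  define \<Xi> where "\<Xi> = 7000 * \<Lambda> ^ 4 * G"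
  have XG: "7000 * G \<le> \<Xi>" unfolding \<Xi>_def using pw[of 4] G1 by simp
  then have X1: "1 \<le> \<Xi>" using G1 by simp
  have "\<Xi> * 1 \<le> \<Xi> * real b" using b X1 by (intro mult_left_mono) auto
  then have nX: "\<Xi> \<le> real n" using nb unfolding \<Xi>_def by simp
  have nN: "real n \<le> N" unfolding N_def using n c by (intro self_le_power) auto
  have n2N: "real n ^ 2 \<le> N" unfolding N_def using n c by (intro power_increasing) auto
  have N: "0 < N" "\<Xi> \<le> N" using nX nN X1 by auto
  have NM: "2 * M \<le> N" using G2 XG N(2) G1 by linarith
  have H: "0 < H"
  proof -
    have "1 \<le> N / M" using NM M2(2) by (simp add: field_simps)
    then show ?thesis unfolding H_def by linarith
  qed
  have \<rho>0: "0 < \<rho>" unfolding \<rho>_def using H N by simp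
  have \<rho>M: "\<rho> * M \<le> 1"
  proof -
    have "of_int H \<le> N / M" unfolding H_def by simp
    then have "of_int H * M \<le> N" using M2(2) by (simp add: field_simps)
    then show ?thesis unfolding \<rho>_def using N by (simp add: field_simps)
  qed
  have \<rho>L: "\<rho> * \<Lambda> ^ 5 \<le> 1 / 1056" using \<rho>M unfolding M_def by simp
  \<comment> \<open>Rounding \<open>H\<close> down at most halves the slot. This is why
    \<open>2112 = 2 * 1056\<close> is the base of \<open>G\<close>, which bounds
    \<open>1 / \<rho> ^ l\<close>.\<close>
  have \<rho>2: "1 / (2 * M) \<le> \<rho>"
  proof -
    have "N / M - 1 \<le> of_int H" unfolding H_def by linarith
    moreover have "N / (2 * M) \<le> N / M - 1" using NM M2(2) by (simp add: field_simps)
    ultimately have "N / (2 * M) \<le> of_int H" by linarith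
    then show ?thesis unfolding \<rho>_def using N M2(2) by (simp add: field_simps)
  qed
  have \<rho>1: "\<rho> \<le> 1"
  proof -
    have "\<rho> * 1 \<le> \<rho> * M" using \<rho>0 M2(2) by (intro mult_left_mono) auto
    then show ?thesis using \<rho>M by simp
  qed
  have \<rho>G: "1 \<le> G * \<rho> ^ l"
  proof -
    have "1 = G * (1 / (2 * M)) ^ l" unfolding M2(1) using M2(2) by (simp add: power_divide)
    also have "\<dots> \<le> G * \<rho> ^ l" using \<rho>2 M2(2) G1 by (intro mult_left_mono power_mono) auto
    finally show ?thesis .
  qed
  have \<rho>l: "\<rho> ^ l = \<rho> * \<rho> ^ (l - 1)" using l by (cases l) auto
  have \<rho>l1: "\<rho> ^ l \<le> \<rho> ^ (l - 1)" "0 < \<rho> ^ (l - 1)" "\<rho> ^ l \<le> \<rho>" "0 < \<rho> ^ l"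
    unfolding \<rho>l using \<rho>0 \<rho>1 power_le_one[of \<rho> "l - 1"] by (auto intro: mult_left_le_one_le mult_left_le)
  have w1: "w \<le> 1 / \<Xi>" using wX unfolding \<Xi>_def .
  have W0: "0 \<le> w * N" using w N by simp
  then have W: "0 \<le> W" "of_int W \<le> w * N + 1" unfolding W_def by linarith+
  have wle: "w \<le> 1"
  proof -
    have "1 / \<Xi> \<le> 1" using X1 by simp
    then show ?thesis using w1 by linarith
  qed
  have uu: "u \<le> 13 / \<Xi>"
  proof -
    have "u \<le> (6 * (w * N + 1) + 1) / N" unfolding u_def using W N by (intro divide_right_mono) auto
    also have "\<dots> = 6 * w + 7 * (1 / N)" using N by (simp add: field_simps)
    also have "1 / N \<le> 1 / \<Xi>" using N X1 by (intro divide_left_mono) auto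
    finally show ?thesis using w1 by simp
  qed
  \<comment> \<open>\<open>528 = 2 * 8 * 33\<close> will make the coincidences weigh at most
    \<open>\<rho> / (8 * \<Lambda>)\<close> over all instances; 7000 exceeds
    \<open>13 * 528\<close>.\<close>
  have u\<rho>: "u * (528 * \<Lambda> ^ 4) \<le> \<rho> ^ l"
  proof -
    have "u * (528 * \<Lambda> ^ 4) \<le> 13 / \<Xi> * (528 * \<Lambda> ^ 4)" using uu pw[of 4] by (intro mult_right_mono) auto
    also have "\<dots> = 6864 / 7000 / G" unfolding \<Xi>_def using L1 G1 by (simp add: field_simps)
    also have "\<dots> \<le> 1 / G" using G1 by (intro divide_right_mono) auto
    also have "\<dots> \<le> \<rho> ^ l" using \<rho>G G1 by (simp add: field_simps)
    finally show ?thesis .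
  qed
  have u0: "0 \<le> u" unfolding u_def using W N by simp
  have lH: "real l * of_int H \<le> N"
  proof -
    have "\<Lambda> \<le> \<Lambda> ^ 5" using L1 by (intro self_le_power) auto
    then have "real l \<le> M" unfolding M_def using lL L1 by linarith
    then have "real l * \<rho> \<le> M * \<rho>" using \<rho>0 by (intro mult_right_mono) auto
    then show ?thesis using \<rho>M N unfolding \<rho>_def by (simp add: field_simps)
  qed
  have WH: "6 * real l * of_int W \<le> of_int H"
  proof -
    have "real l \<le> 528 * \<Lambda> ^ 4" using lL L1 self_le_power[of \<Lambda> 4] by linarith
    then have "real l * u \<le> 528 * \<Lambda> ^ 4 * u" using u0 by (intro mult_right_mono) auto
    then have "real l * u \<le> \<rho>" using u\<rho> \<rho>l1(3) by (simp add: ac_simps)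
    moreover have "real l * (6 * of_int W / N) \<le> real l * u"
      unfolding u_def using N by (intro mult_left_mono divide_right_mono) auto
    ultimately have "real l * (6 * of_int W / N) \<le> of_int H / N" unfolding \<rho>_def by linarith
    then show ?thesis using N by (simp add: field_simps)
  qed
  have l3: "real l ^ 3 \<le> \<Lambda> ^ 3" "real l ^ 2 \<le> \<Lambda> ^ 2" using lL by (auto intro: power_mono)
  have s3: "real l ^ 3 * \<rho> \<le> 1 / 4"
  proof -
    have "real l ^ 3 \<le> \<Lambda> ^ 5"
      by (rule order_trans[OF l3(1) power_increasing]) (use L1 in auto)
    then have "real l ^ 3 * \<rho> \<le> \<Lambda> ^ 5 * \<rho>" using \<rho>0 by (intro mult_right_mono) auto
    then show ?thesis using \<rho>L by (simp add: ac_simps)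
  qed
  \<comment> \<open>Chosen so that \<open>R\<close> times the guaranteed mean
    \<open>\<beta> * \<rho> ^ (l - 1) / (4 * l)\<close> is at least
    \<open>8 / \<delta>\<close>.\<close>
  define R where "R = nat \<lceil>32 * \<Lambda> / \<rho> ^ (l - 1)\<rceil>"
  have R0: "32 * \<Lambda> \<le> 32 * \<Lambda> / \<rho> ^ (l - 1)"
  proof -
    have "\<rho> ^ (l - 1) \<le> 1" using \<rho>0 \<rho>1 by (intro power_le_one) auto
    then show ?thesis using \<rho>l1(2) L1 by (simp add: pos_le_divide_eq mult_left_le)
  qed
  have R: "32 * \<Lambda> / \<rho> ^ (l - 1) \<le> real R" "real R \<le> 33 * \<Lambda> / \<rho> ^ (l - 1)" "1 \<le> R"
  proof -
    show 1: "32 * \<Lambda> / \<rho> ^ (l - 1) \<le> real R" unfolding R_def by (rule real_nat_ceiling_ge)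
    have "1 \<le> \<Lambda> / \<rho> ^ (l - 1)" using R0 L1 by simp
    moreover have "real R \<le> 32 * \<Lambda> / \<rho> ^ (l - 1) + 1" unfolding R_def using R0 L1 by linarith
    moreover have "33 * \<Lambda> / \<rho> ^ (l - 1) = 32 * \<Lambda> / \<rho> ^ (l - 1) + \<Lambda> / \<rho> ^ (l - 1)"
      by (simp add: add_divide_distrib[symmetric])
    ultimately show "real R \<le> 33 * \<Lambda> / \<rho> ^ (l - 1)" by linarith
    have "1 \<le> real R" using 1 R0 L1 by linarith
    then show "1 \<le> R" by simp
  qed
  have fp: "real R * (4 * real l ^ 3 * \<rho> ^ l + 2 * real l ^ 2 * u) \<le> \<delta> / 4"
  proof -
    have "2 * real l ^ 2 * u \<le> 2 * \<Lambda> ^ 2 * u" using l3(2) u0 by (intro mult_right_mono) auto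
    also have "\<dots> \<le> \<rho> ^ l / (264 * \<Lambda> ^ 2)"
    proof -
      have "2 * \<Lambda> ^ 2 * u * (264 * \<Lambda> ^ 2) = u * (528 * \<Lambda> ^ 4)" by algebra
      moreover have "0 < 264 * \<Lambda> ^ 2" using L1 by simp
      ultimately show ?thesis using u\<rho> pos_le_divide_eq by metis
    qed
    finally have 1: "2 * real l ^ 2 * u \<le> \<rho> ^ l / (264 * \<Lambda> ^ 2)" .
    have 2: "4 * real l ^ 3 * \<rho> ^ l \<le> 4 * \<Lambda> ^ 3 * \<rho> ^ l"
      using l3(1) \<rho>l1 by (intro mult_right_mono) auto
    have "real R * (4 * real l ^ 3 * \<rho> ^ l + 2 * real l ^ 2 * u) \<le>
        33 * \<Lambda> / \<rho> ^ (l - 1) * (4 * \<Lambda> ^ 3 * \<rho> ^ l + \<rho> ^ l / (264 * \<Lambda> ^ 2))"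
      using R(2) 1 2 u0 \<rho>l1 L1 \<rho>0
      by (intro mult_mono add_mono add_nonneg_nonneg mult_nonneg_nonneg) auto
    also have "\<dots> = 132 * \<Lambda> ^ 4 * \<rho> + \<rho> / (8 * \<Lambda>)"
    proof -
      let ?x = "\<rho> ^ (l - 1)"
      have "33 * \<Lambda> / ?x * (4 * \<Lambda> ^ 3 * (\<rho> * ?x)) = 132 * \<Lambda> ^ 4 * \<rho>"
        using \<rho>l1(2) by (simp add: eval_nat_numeral)
      moreover have "33 * \<Lambda> / ?x * (\<rho> * ?x / (264 * \<Lambda> ^ 2)) = \<rho> / (8 * \<Lambda>)"
        using \<rho>l1(2) L1 by (simp add: power2_eq_square)
      ultimately show ?thesis unfolding \<rho>l distrib_left by simp
    qed
    also have "132 * \<Lambda> ^ 4 * \<rho> \<le> 1 / (8 * \<Lambda>)"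
    proof -
      have "\<Lambda> ^ 5 = \<Lambda> ^ 4 * \<Lambda>" by (simp add: eval_nat_numeral)
      then show ?thesis using \<rho>L L1 by (simp add: pos_le_divide_eq ac_simps)
    qed
    also have "\<rho> / (8 * \<Lambda>) \<le> 1 / (8 * \<Lambda>)" using \<rho>1 L1 by (intro divide_right_mono) auto
    also have "1 / (8 * \<Lambda>) + 1 / (8 * \<Lambda>) = (1 / \<Lambda>) / 4" by simp
    also have "\<dots> \<le> \<delta> / 4" using inv by (intro divide_right_mono) auto
    finally show ?thesis by simp
  qed
  have tp: "2 / (real R * (\<beta> * \<rho> ^ (l - 1) / (4 * real l))) \<le> \<delta> / 4"
  proof -
    have "8 / \<delta> = 32 * \<Lambda> / \<rho> ^ (l - 1) * (\<beta> * \<rho> ^ (l - 1) / (4 * real l))"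
      unfolding \<Lambda>_def using l \<beta> \<delta> \<rho>0 by (simp add: field_simps)
    also have "\<dots> \<le> real R * (\<beta> * \<rho> ^ (l - 1) / (4 * real l))"
      using R(1) \<beta> \<rho>l1(2) by (intro mult_right_mono) auto
    finally have le: "8 / \<delta> \<le> real R * (\<beta> * \<rho> ^ (l - 1) / (4 * real l))" .
    have "0 < 8 / \<delta>" using \<delta> by simp
    from divide_left_mono[OF le _ mult_pos_pos[OF less_le_trans[OF this le] this], of 2]
    have "2 / (real R * (\<beta> * \<rho> ^ (l - 1) / (4 * real l))) \<le> 2 / (8 / \<delta>)" by simp
    then show ?thesis by simp
  qed
  \<comment> \<open>The lower bound on \<open>n\<close> in terms of \<open>b\<close> enters here:
    the variance caused by shared batches must be small against the mean.\<close>
  have cheb: "4 * (real l ^ 2 * real b / real n) / (\<beta> * \<rho> ^ (l - 1) / (4 * real l)) \<le> \<delta> / 4"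
  proof -
    have "64 * real l ^ 3 * real b \<le> 7000 * \<Lambda> ^ 3 * real l * real b"
    proof -
      have "64 * real l ^ 3 * real b \<le> 7000 * real l ^ 3 * real b" by (intro mult_right_mono) auto
      also have "real l ^ 3 \<le> \<Lambda> ^ 3 * real l"
        using l3(1) l mult_mono[of "real l ^ 3" "\<Lambda> ^ 3" 1 "real l"] L1 by simp
      finally show ?thesis using b by (simp add: ac_simps)
    qed
    also have "\<dots> = 7000 * \<Lambda> ^ 4 * real b * (\<beta> * \<delta>)"
      using Lbd by (simp add: eval_nat_numeral ac_simps)
    also have "\<dots> \<le> 7000 * \<Lambda> ^ 4 * real b * (\<beta> * \<delta>) * (G * \<rho> ^ (l - 1))"
    proof -
      have "1 \<le> G * \<rho> ^ (l - 1)"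
        using \<rho>G mult_left_mono[OF \<rho>l1(1), of G] G1 by linarith
      then show ?thesis using bd L1
        mult_left_mono[of 1 "G * \<rho> ^ (l - 1)" "7000 * \<Lambda> ^ 4 * real b * (\<beta> * \<delta>)"] by simp
    qed
    also have "\<dots> = (7000 * \<Lambda> ^ 4 * G * real b) * (\<beta> * \<delta> * \<rho> ^ (l - 1))" by (simp add: ac_simps)
    also have "\<dots> \<le> real n * (\<beta> * \<delta> * \<rho> ^ (l - 1))"
      using nb bd \<rho>l1(2) by (intro mult_right_mono) auto
    finally have "64 * real l ^ 3 * real b \<le> real n * (\<beta> * \<delta> * \<rho> ^ (l - 1))" .
    then show ?thesis using n l \<beta> \<rho>0 by (simp add: field_simps eval_nat_numeral)
  qed
  \<comment> \<open>There are at most \<open>n ^ 2\<close> edges, and \<open>n ^ 2 \<le> N\<close>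
    because \<open>c \<ge> 2\<close>. So the term \<open>10 / N\<close> that rounding adds to
    \<open>U4\<close> contributes only a constant to the expected load.\<close>
  define m' where "m' = min (real m) (real n ^ 2)"
  define U4 where "U4 = 2 * ((4 * of_int W + 1) / N)"
  \<comment> \<open>The logarithm of the number of windows over the failure share
    \<open>\<delta> / 4\<close>; \<open>q\<close> adds \<open>b\<close> times it to the bound
    \<open>U4 * m'\<close> on twice the mean load.\<close>
  define L4 where "L4 = ln (4 * (N + 4 * of_int W + 1) / \<delta>)"
  define q where "q = nat \<lceil>U4 * m' + real b * L4\<rceil>"
  have NW: "1 \<le> N + 4 * of_int W + 1" using N W by simp
  have L40: "0 \<le> L4"
  proof -
    have "1 \<le> 4 * (N + 4 * of_int W + 1) / \<delta>" using NW \<delta> by (simp add: pos_le_divide_eq)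
    then show ?thesis unfolding L4_def by (rule ln_ge_zero)
  qed
  have m'0: "0 \<le> m'" unfolding m'_def by simp
  have U40: "0 \<le> U4" unfolding U4_def using W N by simp
  have over: "(N + 4 * of_int W + 1) * exp (2 * ((4 * of_int W + 1) / N) * m' / real b - real q / real b) \<le> \<delta> / 4"
  proof -
    have "U4 * m' + real b * L4 \<le> real q" unfolding q_def by (rule real_nat_ceiling_ge)
    then have "(U4 * m' + real b * L4) / real b \<le> real q / real b" by (intro divide_right_mono) auto
    then have "U4 * m' / real b - real q / real b \<le> - L4" using b by (simp add: add_divide_distrib)
    then have "exp (U4 * m' / real b - real q / real b) \<le> exp (- L4)" by simp
    also have "\<dots> = \<delta> / (4 * (N + 4 * of_int W + 1))"
      unfolding L4_def exp_minus using NW \<delta> by simp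
    finally have "(N + 4 * of_int W + 1) * exp (U4 * m' / real b - real q / real b) \<le>
        (N + 4 * of_int W + 1) * (\<delta> / (4 * (N + 4 * of_int W + 1)))"
      using NW by (intro mult_left_mono) auto
    also have "\<dots> = \<delta> / 4"
    proof -
      have "x * (\<delta> / (4 * x)) = \<delta> / 4" if "1 \<le> x" for x :: real using that by simp
      then show ?thesis using NW .
    qed
    finally show ?thesis unfolding U4_def .
  qed
  define U where "U = all_edges n \<times> {0..\<lfloor>N\<rfloor> + W}"
  have Ln1: "1 \<le> ?L" "0 \<le> ln (real n)" using n by auto
  have wm: "0 \<le> w * real m" using w by simp
  have B1: "1 \<le> ?B" using b wm by simp
  have WN: "of_int W \<le> N + 1"
  proof -
    have "w * N \<le> 1 * N" using wle N(1) by (intro mult_right_mono) auto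
    then show ?thesis using W(2) by linarith
  qed
  have N1: "1 \<le> N" using N X1 by linarith
  have cardU: "real (card U) + 1 \<le> 5 * (real n ^ 2 * N)"
  proof -
    have "real (card U) = real (card (all_edges n)) * of_int (\<lfloor>N\<rfloor> + W + 1)"
      unfolding U_def card_cartesian_product using W N by simp
    also have "\<dots> \<le> real n ^ 2 * (2 * N + 2)"
    proof (intro mult_mono)
      show "real (card (all_edges n)) \<le> real n ^ 2"
        using card_all_edges_le[of n] by (metis of_nat_le_iff of_nat_power)
      show "of_int (\<lfloor>N\<rfloor> + W + 1) \<le> 2 * N + 2"
        unfolding of_int_add of_int_1 using WN of_int_floor_le[of N] by linarith
    qed (use W N in auto)
    also have "\<dots> \<le> real n ^ 2 * (4 * N)" using N1 by (intro mult_left_mono) auto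
    finally have "real (card U) \<le> 4 * (real n ^ 2 * N)" by simp
    moreover have "1 * 1 \<le> real n ^ 2 * N" using n N1 by (intro mult_mono) auto
    ultimately show ?thesis by simp
  qed
  have xs1: "1 \<le> 5 * (real n ^ 2 * N)" using cardU by linarith
  obtain s1 where s1: "5 * (real n ^ 2 * N) \<le> 2 ^ s1" "real s1 \<le> 2 * ln (5 * (real n ^ 2 * N)) + 1"
    using bits_for[OF xs1] by blast
  have s1L: "real s1 \<le> (2 * real c + 9) * ?L"
  proof -
    have "ln (5::real) \<le> 4" using ln_le_minus_one[of 5] by simp
    moreover have "ln (5 * (real n ^ 2 * N)) = ln 5 + (2 * ln (real n) + real c * ln (real n))"
      using n N unfolding N_def by (simp add: ln_mult ln_realpow)
    ultimately have "real s1 \<le> 9 + (2 * real c + 4) * ln (real n)" using s1(2) by (simp add: algebra_simps)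
    also have "\<dots> \<le> (2 * real c + 9) * ?L" using Ln1(2) c by (simp add: algebra_simps)
    finally show ?thesis .
  qed
  have xs2: "1 \<le> 2 * real n * real l" using n l mult_mono[of 1 "real n" 1 "real l"] by simp
  obtain s2 where s2: "2 * real n * real l \<le> 2 ^ s2" "real s2 \<le> 2 * ln (2 * real n * real l) + 1"
    using bits_for[OF xs2] by blast
  \<comment> \<open>\<open>l\<close> need not be bounded by \<open>n\<close>, so its logarithm is
    charged to \<Lambda> and not to the logarithm of \<open>n\<close>.\<close>
  have s2L: "real s2 + 1 \<le> 4 * \<Lambda> * ?L"
  proof -
    have "ln (2::real) \<le> 1" using ln_le_minus_one[of 2] by simp
    moreover have "ln (real l) \<le> real l - 1" using ln_le_minus_one[of "real l"] l by simp
    moreover have "ln (2 * real n * real l) = ln 2 + ln (real n) + ln (real l)"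
      using n l by (simp add: ln_mult)
    ultimately have "real s2 + 1 \<le> 2 * ?L + 2 * \<Lambda>" using s2(2) lL by simp
    also have "\<dots> \<le> 2 * (\<Lambda> * ?L) + 2 * (\<Lambda> * ?L)"
    proof -
      have "1 * ?L \<le> \<Lambda> * ?L" using L1 Ln1(1) by (intro mult_right_mono) auto
      moreover have "\<Lambda> * 1 \<le> \<Lambda> * ?L" using L1 Ln1(1) by (intro mult_left_mono) auto
      ultimately show ?thesis by linarith
    qed
    finally show ?thesis by simp
  qed
  define r where "r = l * q + l ^ 2"
  define s where "s = (s2 + (s1 * r + 1)) * R"
  have bits: "((n * l + 1) * ((card U + 1) ^ (l * q + l ^ 2) + 1)) ^ R \<le> 2 ^ s"
  proof -
    have "1 * 1 \<le> real n * real l" using n l by (intro mult_mono) auto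
    then have "real (n * l + 1) \<le> 2 ^ s2" using s2(1) by simp
    then have a: "n * l + 1 \<le> 2 ^ s2" by (metis of_nat_le_iff of_nat_numeral of_nat_power)
    have "real (card U + 1) \<le> 2 ^ s1" using s1(1) cardU by simp
    then have "card U + 1 \<le> 2 ^ s1" by (metis of_nat_le_iff of_nat_numeral of_nat_power)
    then have "(card U + 1) ^ r \<le> (2 ^ s1) ^ r" by (rule power_mono) simp
    then have "(card U + 1) ^ r + 1 \<le> 2 ^ (s1 * r) + 2 ^ (s1 * r)"
      by (intro add_mono) (simp_all add: power_mult)
    also have "\<dots> = 2 ^ (s1 * r + 1)" by simp
    finally have "(n * l + 1) * ((card U + 1) ^ r + 1) \<le> 2 ^ s2 * 2 ^ (s1 * r + 1)"
      using a by (rule mult_le_mono[rotated])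
    then have "((n * l + 1) * ((card U + 1) ^ r + 1)) ^ R \<le> (2 ^ s2 * 2 ^ (s1 * r + 1)) ^ R"
      by (rule power_mono) simp
    also have "\<dots> = 2 ^ s" unfolding s_def power_add[symmetric] power_mult ..
    finally show ?thesis unfolding r_def .
  qed
  obtain A where A: "uses_space A (real s)"
    "\<And>E P adv. E \<subseteq> all_edges n \<Longrightarrow> real (card E) \<le> m' \<Longrightarrow>
       \<beta> * real n \<le> real (card {v \<in> {..<n}. card (component_vertices E v) \<le> l}) \<Longrightarrow>
       hidden_batch_adversary n c b w E P adv \<Longrightarrow>
       output_prob A n c P adv {(v, C). v < n \<and> C = component E v} \<ge> 1 - \<delta>"
    by (rule growth_algorithm[OF n l b H w W_def[unfolded N_def] lH[unfolded N_def] WH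
      s3[unfolded \<rho>_def N_def] \<beta>(1) fp[unfolded u_def \<rho>_def N_def] R(3)
      tp[unfolded \<rho>_def N_def] cheb[unfolded \<rho>_def N_def] over[unfolded N_def]
      bits[unfolded U_def W_def N_def]]) blast
  have q: "real q \<le> (59 + real c) * \<Lambda> * ?L * ?B"
  proof -
    have "U4 * m' \<le> 8 * ?B + 10"
    proof -
      have "U4 \<le> 2 * ((4 * (w * N + 1) + 1) / N)"
        unfolding U4_def using W(2) N by (intro mult_left_mono divide_right_mono) auto
      also have "\<dots> = 8 * w + 10 / N" using N by (simp add: field_simps)
      finally have "U4 * m' \<le> (8 * w + 10 / N) * m'" using m'0 by (rule mult_right_mono)
      also have "\<dots> = 8 * w * m' + 10 * (m' / N)" by (simp add: field_simps)
      also have "8 * w * m' \<le> 8 * w * real m" using w unfolding m'_def by (intro mult_left_mono) auto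
      also have "m' / N \<le> 1" using n2N N unfolding m'_def by simp
      finally have "U4 * m' \<le> 8 * w * real m + 10" by simp
      then show ?thesis by simp
    qed
    moreover have "real b * L4 \<le> ?B * ((40 + real c) * \<Lambda> * ?L)"
    proof (intro mult_mono)
      have "4 * (N + 4 * of_int W + 1) / \<delta> \<le> 40 * N * \<Lambda>"
      proof -
        have "4 * (N + 4 * x + 1) \<le> 40 * N" if "x \<le> N + 1" for x using that N1 by argo
        from this[OF WN] have "4 * (N + 4 * of_int W + 1) \<le> 40 * N" .
        from mult_mono[OF this Ld] have "4 * (N + 4 * of_int W + 1) * 1 \<le> (40 * N) * (\<Lambda> * \<delta>)"
          using N1 by simp
        then show ?thesis using \<delta> by (simp add: pos_divide_le_eq ac_simps)
      qed
      then have "L4 \<le> ln (40 * N * \<Lambda>)" unfolding L4_def using NW \<delta> by (intro ln_mono) auto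
      also have "\<dots> = ln 40 + real c * ln (real n) + ln \<Lambda>"
        using N L1 n unfolding N_def by (simp add: ln_mult ln_realpow)
      also have "ln (40::real) \<le> 39" using ln_le_minus_one[of 40] by simp
      also have "ln \<Lambda> \<le> \<Lambda>" using ln_le_minus_one[of \<Lambda>] L1 by simp
      finally have "L4 \<le> 39 + real c * ln (real n) + \<Lambda>" by simp
      also have "\<dots> \<le> 39 * (\<Lambda> * ?L) + real c * (\<Lambda> * ?L) + \<Lambda> * ?L"
      proof (intro add_mono mult_left_mono)
        have "1 * 1 \<le> \<Lambda> * ?L" using L1 Ln1 by (intro mult_mono) auto
        then show "39 \<le> 39 * (\<Lambda> * ?L)" by simp
        have "1 * ln (real n) \<le> \<Lambda> * ?L" using L1 Ln1 by (intro mult_mono) auto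
        then show "ln (real n) \<le> \<Lambda> * ?L" by simp
        show "\<Lambda> \<le> \<Lambda> * ?L" using mult_left_mono[OF Ln1(1), of \<Lambda>] L1 by simp
      qed auto
      also have "\<dots> = (40 + real c) * \<Lambda> * ?L" by (simp add: algebra_simps)
      finally show "L4 \<le> (40 + real c) * \<Lambda> * ?L" .
    qed (use wm L40 b in auto)
    moreover have "real q \<le> U4 * m' + real b * L4 + 1"
      unfolding q_def using mult_nonneg_nonneg[OF U40 m'0] mult_nonneg_nonneg[OF _ L40, of "real b"] by linarith
    ultimately have "real q \<le> 8 * ?B + 11 + ?B * ((40 + real c) * \<Lambda> * ?L)" by linarith
    also have "\<dots> \<le> 19 * (\<Lambda> * ?L * ?B) + ?B * ((40 + real c) * \<Lambda> * ?L)"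
    proof -
      have "1 * 1 \<le> \<Lambda> * ?L" using L1 Ln1 by (intro mult_mono) auto
      then have "1 * ?B \<le> \<Lambda> * ?L * ?B" using B1 by (intro mult_right_mono) auto
      then have "19 * ?B \<le> 19 * (\<Lambda> * ?L * ?B)" by simp
      moreover have "8 * x + 11 \<le> 19 * x" if "1 \<le> x" for x :: real using that by simp
      from this[OF B1] have "8 * ?B + 11 \<le> 19 * ?B" .
      ultimately have "8 * ?B + 11 \<le> 19 * (\<Lambda> * ?L * ?B)" by (rule order_trans[rotated])
      then show ?thesis by (rule add_right_mono)
    qed
    also have "\<dots> = (59 + real c) * \<Lambda> * ?L * ?B" by (simp add: algebra_simps)
    finally show ?thesis .
  qed
  have LB: "1 \<le> ?L * ?B" using mult_mono[OF Ln1(1) B1] Ln1 by simp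
  have r: "real r \<le> (60 + real c) * (\<Lambda> ^ 2 * (?L * ?B))"
  proof -
    have "real r = real l * real q + real l * real l" unfolding r_def by (simp add: power2_eq_square)
    also have "\<dots> \<le> \<Lambda> * ((59 + real c) * \<Lambda> * ?L * ?B) + \<Lambda> * \<Lambda>"
      using lL q L1 by (intro add_mono mult_mono) auto
    also have "\<Lambda> * \<Lambda> \<le> \<Lambda> * \<Lambda> * (?L * ?B)"
      using mult_left_mono[OF LB, of "\<Lambda> * \<Lambda>"] L1 by simp
    finally show ?thesis by (simp add: algebra_simps power2_eq_square)
  qed
  have sum: "real s2 + (real s1 * real r + 1) \<le> (4 + (60 + real c) * (2 * real c + 9)) * (\<Lambda> ^ 2 * (?L ^ 2 * ?B))"
  proof -
    have "real s1 * real r \<le> ((2 * real c + 9) * ?L) * ((60 + real c) * (\<Lambda> ^ 2 * (?L * ?B)))"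
      using s1L r Ln1 by (intro mult_mono) auto
    moreover have "4 * \<Lambda> * ?L \<le> 4 * (\<Lambda> ^ 2 * (?L ^ 2 * ?B))"
    proof -
      have "\<Lambda> * ?L \<le> (\<Lambda> * ?L) * (\<Lambda> * (?L * ?B))"
      proof -
        have "1 * 1 \<le> \<Lambda> * (?L * ?B)" using L1 LB by (intro mult_mono) auto
        then show ?thesis using mult_left_mono[of 1 "\<Lambda> * (?L * ?B)" "\<Lambda> * ?L"] L1 Ln1 by simp
      qed
      then have "4 * (\<Lambda> * ?L) \<le> 4 * ((\<Lambda> * ?L) * (\<Lambda> * (?L * ?B)))" by (rule mult_left_mono) simp
      also have "(\<Lambda> * ?L) * (\<Lambda> * (?L * ?B)) = \<Lambda> ^ 2 * (?L ^ 2 * ?B)" by algebra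
      finally show ?thesis by (simp only: mult.assoc)
    qed
    ultimately have "real s2 + (real s1 * real r + 1) \<le> 4 * (\<Lambda> ^ 2 * (?L ^ 2 * ?B)) +
        ((2 * real c + 9) * ?L) * ((60 + real c) * (\<Lambda> ^ 2 * (?L * ?B)))" using s2L by linarith
    also have "\<dots> = (4 + (60 + real c) * (2 * real c + 9)) * (\<Lambda> ^ 2 * (?L ^ 2 * ?B))"
      by algebra
    finally show ?thesis .
  qed
  have R2: "real R \<le> 33 * \<Lambda> * (2 * M) ^ (l - 1)"
  proof -
    have "1 = (2 * M) ^ (l - 1) * (1 / (2 * M)) ^ (l - 1)" using M2(2) by (simp add: power_divide)
    also have "\<dots> \<le> (2 * M) ^ (l - 1) * \<rho> ^ (l - 1)"
      using \<rho>2 M2(2) by (intro mult_left_mono power_mono) auto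
    finally have "1 / \<rho> ^ (l - 1) \<le> (2 * M) ^ (l - 1)" using \<rho>l1(2) by (simp add: pos_divide_le_eq)
    then have "33 * \<Lambda> * (1 / \<rho> ^ (l - 1)) \<le> 33 * \<Lambda> * (2 * M) ^ (l - 1)" using L1 by (intro mult_left_mono) auto
    then show ?thesis using R(2) by simp
  qed
  have "real s = real R * (real s2 + (real s1 * real r + 1))" unfolding s_def by (simp add: algebra_simps)
  also have "\<dots> \<le> 33 * \<Lambda> * (2 * M) ^ (l - 1) * ((4 + (60 + real c) * (2 * real c + 9)) * (\<Lambda> ^ 2 * (?L ^ 2 * ?B)))"
    using R2 sum L1 M2(2) by (intro mult_mono) auto
  also have "\<dots> = 33 * (4 + (60 + real c) * (2 * real c + 9)) * \<Lambda> ^ 3 *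
      (2112 * \<Lambda> ^ 5) ^ (l - 1) * ?B * ?L ^ 2"
  proof -
    have "2 * M = 2112 * \<Lambda> ^ 5" by (simp add: M_def)
    moreover have "33 * \<Lambda> * x * (K * (\<Lambda> ^ 2 * (y * z))) = 33 * K * \<Lambda> ^ 3 * x * z * y" for x K y z :: real
      by (simp add: power3_eq_cube power2_eq_square)
    ultimately show ?thesis by (simp only:)
  qed
  finally have space: "uses_space A (33 * (4 + (60 + real c) * (2 * real c + 9)) * \<Lambda> ^ 3 *
      (2112 * \<Lambda> ^ 5) ^ (l - 1) * ?B * ?L ^ 2)"
    using A(1) uses_space_mono by blast
  show ?thesis
  proof (rule that[OF space])
    fix E P adv
    assume E: "E \<subseteq> all_edges n" "card E \<le> m"
      and small: "\<beta> * real n \<le> real (card {v \<in> {..<n}. card (component_vertices E v) \<le> l})"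
      and adv: "hidden_batch_adversary n c b w E P adv"
    have "card E \<le> n ^ 2"
      using card_mono[OF finite_all_edges E(1)] card_all_edges_le[of n] by simp
    then have "real (card E) \<le> real (n ^ 2)" by (simp only: of_nat_le_iff)
    then have "real (card E) \<le> m'" using E(2) unfolding m'_def by simp
    then show "output_prob A n c P adv {(v, C). v < n \<and> C = component E v} \<ge> 1 - \<delta>"
      using A(2) E(1) small adv by blast
  qed
qed

text \<open>\<open>27 = 17 + 10\<close>: \<open>power_pred_le\<close> yields \<open>17 * l\<close>,
  and the remaining factors are at most \<open>\<Lambda> ^ 10\<close>. The constant
  \<open>73920000 = 5 * 7000 * 2112\<close> comes from the small regime, the other summand from the
  large one.\<close>

lemma component_finding_algorithm:
  fixes n l m b c :: nat and w \<beta> \<delta> :: real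
  defines "\<Lambda> \<equiv> real l / (\<beta> * \<delta>)"
  assumes n: "1 \<le> n" and l: "1 \<le> l" and b: "1 \<le> b" and w: "0 \<le> w" and c: "2 \<le> c"
    and \<beta>: "0 < \<beta>" "\<beta> \<le> 1" and \<delta>: "0 < \<delta>" "\<delta> < 1"
  shows "\<exists>A. uses_space A (\<Lambda> ^ (27 * l) * (real b + w * real m) *
      ((73920000 + 33 * (4 + (60 + real c) * (2 * real c + 9))) * (1 + ln (real n)) ^ 2)) \<and>
    (\<forall>E P adv. E \<subseteq> all_edges n \<and> card E \<le> m \<and>
       \<beta> * real n \<le> real (card {v \<in> {..<n}. card (component_vertices E v) \<le> l}) \<and>
       hidden_batch_adversary n c b w E P adv \<longrightarrow>
       output_prob A n c P adv {(v, C). v < n \<and> C = component E v} \<ge> 1 - \<delta>)"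
proof -
  let ?G = "(2112 * \<Lambda> ^ 5) ^ l" and ?B = "real b + w * real m" and ?L = "1 + ln (real n)"
  let ?C = "4 + (60 + real c) * (2 * real c + 9)"
  define \<Xi> where "\<Xi> = 7000 * \<Lambda> ^ 4 * ?G"
  have "\<beta> * \<delta> \<le> 1" using \<beta> \<delta> by (intro mult_le_one) auto
  then have lL: "real l \<le> \<Lambda>" unfolding \<Lambda>_def using \<beta> \<delta> by (simp add: pos_le_divide_eq mult_left_le)
  then have L1: "1 \<le> \<Lambda>" using l by simp
  have pw: "1 \<le> \<Lambda> ^ i" for i using L1 by (rule one_le_power)
  have L: "1 \<le> ?L" using n by simp
  have B: "0 \<le> ?B" using w by simp
  have C: "0 \<le> ?C" by simp
  have G1: "1 \<le> ?G" using pw[of 5] by (intro one_le_power) simp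
  have X1: "1 \<le> \<Xi>"
    unfolding \<Xi>_def using mult_mono[of 1 "7000 * \<Lambda> ^ 4" 1 ?G] pw[of 4] G1 by simp
  note pl = power_pred_le[OF lL l]
  have inc: "\<Lambda> ^ i * \<Lambda> ^ (17 * l) \<le> \<Lambda> ^ (27 * l)" if "i \<le> 10" for i
    unfolding power_add[symmetric] using that l L1 by (intro power_increasing) auto
  have LL: "?L \<le> ?L ^ 2" using L by (intro self_le_power) auto
  consider (small) "real n < \<Xi> * real b \<or> 1 / \<Xi> < w" | (large) "\<Xi> * real b \<le> real n" "w \<le> 1 / \<Xi>"
    by linarith
  then show ?thesis
  proof cases
    case small
    obtain A where A: "uses_space A (5 * \<Xi> * real l * ?B * ?L)"
      "\<And>E P adv c b w v. E \<subseteq> all_edges n \<Longrightarrow> card E \<le> m \<Longrightarrow>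
       v < n \<Longrightarrow> card (component_vertices E v) \<le> l \<Longrightarrow> hidden_batch_adversary n c b w E P adv \<Longrightarrow>
       output_prob A n c P adv {(v, C). v < n \<and> C = component E v} \<ge> 1"
      by (rule small_regime[OF n l b w X1 small, of m]) blast
    have "?G = 2112 * \<Lambda> ^ 5 * (2112 * \<Lambda> ^ 5) ^ (l - 1)" using l by (cases l) auto
    also have "\<dots> \<le> 2112 * \<Lambda> ^ 5 * \<Lambda> ^ (17 * l)" using pl L1 by (intro mult_left_mono) auto
    finally have G: "?G \<le> 2112 * \<Lambda> ^ 5 * \<Lambda> ^ (17 * l)" .
    have "5 * \<Xi> * real l = 35000 * (\<Lambda> ^ 4 * real l) * ?G" unfolding \<Xi>_def by simp
    also have "\<dots> \<le> 35000 * (\<Lambda> ^ 4 * \<Lambda>) * (2112 * \<Lambda> ^ 5 * \<Lambda> ^ (17 * l))"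
      using G G1 lL L1 by (intro mult_mono) auto
    also have "\<dots> = 73920000 * (\<Lambda> ^ 10 * \<Lambda> ^ (17 * l))" by (simp add: eval_nat_numeral)
    also have "\<dots> \<le> 73920000 * \<Lambda> ^ (27 * l)" using inc[of 10] by simp
    finally have "5 * \<Xi> * real l \<le> 73920000 * \<Lambda> ^ (27 * l)" .
    from mult_right_mono[OF this B]
    have "5 * \<Xi> * real l * ?B * ?L \<le> 73920000 * \<Lambda> ^ (27 * l) * ?B * ?L ^ 2"
      by (rule mult_mono[OF _ LL]) (use B L L1 in auto)
    also have "\<dots> \<le> (73920000 + 33 * ?C) * \<Lambda> ^ (27 * l) * ?B * ?L ^ 2"
      using B C L1 by (intro mult_right_mono) auto
    finally have sp: "5 * \<Xi> * real l * ?B * ?L \<le> \<Lambda> ^ (27 * l) * ?B * ((73920000 + 33 * ?C) * ?L ^ 2)"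
      by (simp only: ac_simps)
    show ?thesis
    proof (intro exI[of _ A] conjI allI impI)
      show "uses_space A (\<Lambda> ^ (27 * l) * ?B * ((73920000 + 33 * ?C) * ?L ^ 2))"
        using A(1) sp by (rule uses_space_mono)
      fix E P adv
      assume a: "E \<subseteq> all_edges n \<and> card E \<le> m \<and>
       \<beta> * real n \<le> real (card {v \<in> {..<n}. card (component_vertices E v) \<le> l}) \<and>
       hidden_batch_adversary n c b w E P adv"
      have "0 < \<beta> * real n" using \<beta> n by simp
      then have "0 < card {v \<in> {..<n}. card (component_vertices E v) \<le> l}" using a by linarith
      then obtain v where "v < n" "card (component_vertices E v) \<le> l"
        by (auto simp: card_gt_0_iff)
      then have "1 \<le> output_prob A n c P adv {(v, C). v < n \<and> C = component E v}"
        using a by (intro A(2)[of E v]) auto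
      then show "1 - \<delta> \<le> output_prob A n c P adv {(v, C). v < n \<and> C = component E v}" using \<delta> by simp
    qed
  next
    case large
    obtain A where A: "uses_space A (33 * ?C * \<Lambda> ^ 3 * (2112 * \<Lambda> ^ 5) ^ (l - 1) * ?B * ?L ^ 2)"
      "\<And>E P adv. E \<subseteq> all_edges n \<Longrightarrow> card E \<le> m \<Longrightarrow>
       \<beta> * real n \<le> real (card {v \<in> {..<n}. card (component_vertices E v) \<le> l}) \<Longrightarrow>
       hidden_batch_adversary n c b w E P adv \<Longrightarrow>
       output_prob A n c P adv {(v, C). v < n \<and> C = component E v} \<ge> 1 - \<delta>"
      by (rule large_regime[OF n l b w c \<beta> \<delta>, of m, folded \<Lambda>_def, folded \<Xi>_def, OF large]) blast
    have "33 * ?C * \<Lambda> ^ 3 * (2112 * \<Lambda> ^ 5) ^ (l - 1) \<le> 33 * ?C * \<Lambda> ^ 3 * \<Lambda> ^ (17 * l)"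
      using pl C L1 by (intro mult_left_mono) auto
    also have "\<dots> = 33 * ?C * (\<Lambda> ^ 3 * \<Lambda> ^ (17 * l))" by simp
    also have "\<dots> \<le> (73920000 + 33 * ?C) * \<Lambda> ^ (27 * l)"
      using inc[of 3] C L1 by (intro mult_mono) auto
    finally have "33 * ?C * \<Lambda> ^ 3 * (2112 * \<Lambda> ^ 5) ^ (l - 1) * ?B * ?L ^ 2 \<le>
        (73920000 + 33 * ?C) * \<Lambda> ^ (27 * l) * ?B * ?L ^ 2"
      using B by (intro mult_right_mono) auto
    then have sp: "33 * ?C * \<Lambda> ^ 3 * (2112 * \<Lambda> ^ 5) ^ (l - 1) * ?B * ?L ^ 2 \<le>
        \<Lambda> ^ (27 * l) * ?B * ((73920000 + 33 * ?C) * ?L ^ 2)"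
      by (simp only: ac_simps)
    show ?thesis
      using uses_space_mono[OF A(1) sp] A(2) by blast
  qed
qed


theorem mainTheorem5:
  "\<exists>c0::nat. \<forall>c\<ge>c0.
    \<exists>(g :: nat \<Rightarrow> real) (h :: nat \<Rightarrow> real) (k :: nat).
      g \<in> O(\<lambda>l. real l) \<and> h \<in> O(\<lambda>n. ln (real n) ^ k) \<and>
      (\<forall>(\<delta>::real) (b::nat) (w::real) (\<beta>::real) (l::nat) (n::nat) (m::nat).
        0 < \<delta> \<and> \<delta> < 1 \<and> 1 \<le> b \<and> 0 \<le> w \<and> 0 < \<beta> \<and> \<beta> \<le> 1 \<and> 1 \<le> l \<and> 1 \<le> n \<longrightarrow>
        (\<exists>A :: (nat \<times> nat set \<times> edge set) streaming_algorithm.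
          uses_space A
            ((real l / (\<beta> * \<delta>)) powr g l * (real b + w * real m) * h n) \<and>
          (\<forall>E P adv.
            simple_graph n E \<and> card E \<le> m \<and>
            real (card {v \<in> {..<n}. card (component_vertices E v) \<le> l}) \<ge> \<beta> * real n \<and>
            hidden_batch_adversary n c b w E P adv \<longrightarrow>
            output_prob A n c P adv {(v, C). v < n \<and> C = component E v} \<ge> 1 - \<delta>)))"
proof (intro exI[of _ "2::nat"] allI impI)
  fix c :: nat assume c: "2 \<le> c"
  define K where "K = 73920000 + 33 * (4 + (60 + real c) * (2 * real c + 9))"
  have K: "0 \<le> K" by (simp add: K_def)
  \<comment> \<open>All numerical constants go into \<open>?h\<close>, as \<Lambda> may be close to
    1. Using \<open>1 + ln n\<close> keeps the bound positive at \<open>n = 1\<close>.\<close>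
  let ?g = "\<lambda>l. real (27 * l)" and ?h = "\<lambda>n. K * (1 + ln (real n)) ^ 2"
  have g: "?g \<in> O(\<lambda>l. real l)" by (intro bigoI[of _ 27]) auto
  have h: "?h \<in> O(\<lambda>n. ln (real n) ^ 2)"
  proof (rule bigoI[of _ "4 * K"])
    show "\<forall>\<^sub>F n in sequentially. norm (?h n) \<le> 4 * K * norm (ln (real n) ^ 2)"
    proof (rule eventually_sequentiallyI[of 3])
      fix n :: nat assume "3 \<le> n"
      then have "exp 1 \<le> real n" using exp_le by linarith
      then have "1 \<le> ln (real n)" using ln_mono[of "exp 1" "real n"] by simp
      then have "(1 + ln (real n)) ^ 2 \<le> (2 * ln (real n)) ^ 2" by (intro power_mono) auto
      then have "K * (1 + ln (real n)) ^ 2 \<le> K * (4 * ln (real n) ^ 2)"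
        using K by (intro mult_left_mono) (auto simp: power_mult_distrib)
      then show "norm (?h n) \<le> 4 * K * norm (ln (real n) ^ 2)" using K by (simp add: ac_simps)
    qed
  qed
  show "\<exists>(g :: nat \<Rightarrow> real) (h :: nat \<Rightarrow> real) (k :: nat).
      g \<in> O(\<lambda>l. real l) \<and> h \<in> O(\<lambda>n. ln (real n) ^ k) \<and>
      (\<forall>(\<delta>::real) (b::nat) (w::real) (\<beta>::real) (l::nat) (n::nat) (m::nat).
        0 < \<delta> \<and> \<delta> < 1 \<and> 1 \<le> b \<and> 0 \<le> w \<and> 0 < \<beta> \<and> \<beta> \<le> 1 \<and> 1 \<le> l \<and> 1 \<le> n \<longrightarrow>
        (\<exists>A :: (nat \<times> nat set \<times> edge set) streaming_algorithm.
          uses_space A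
            ((real l / (\<beta> * \<delta>)) powr g l * (real b + w * real m) * h n) \<and>
          (\<forall>E P adv.
            simple_graph n E \<and> card E \<le> m \<and>
            real (card {v \<in> {..<n}. card (component_vertices E v) \<le> l}) \<ge> \<beta> * real n \<and>
            hidden_batch_adversary n c b w E P adv \<longrightarrow>
            output_prob A n c P adv {(v, C). v < n \<and> C = component E v} \<ge> 1 - \<delta>)))"
  proof (rule exI[of _ ?g], rule exI[of _ ?h], rule exI[of _ "2::nat"], intro conjI g h allI impI)
    fix \<delta> w \<beta> :: real and b l n m :: nat
    assume a: "0 < \<delta> \<and> \<delta> < 1 \<and> 1 \<le> b \<and> 0 \<le> w \<and> 0 < \<beta> \<and> \<beta> \<le> 1 \<and> 1 \<le> l \<and> 1 \<le> n"
    then have pos: "0 < real l / (\<beta> * \<delta>)" by simp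
    show "\<exists>A :: (nat \<times> nat set \<times> edge set) streaming_algorithm.
          uses_space A
            ((real l / (\<beta> * \<delta>)) powr ?g l * (real b + w * real m) * ?h n) \<and>
          (\<forall>E P adv.
            simple_graph n E \<and> card E \<le> m \<and>
            real (card {v \<in> {..<n}. card (component_vertices E v) \<le> l}) \<ge> \<beta> * real n \<and>
            hidden_batch_adversary n c b w E P adv \<longrightarrow>
            output_prob A n c P adv {(v, C). v < n \<and> C = component E v} \<ge> 1 - \<delta>)"
      unfolding powr_realpow[OF pos] simple_graph_alt K_def
      using component_finding_algorithm[of n l b w c \<beta> \<delta> m] a c by blast
  qed
qed

end
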